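(* Let $\rho_n$ be an inverse-unfair permutation in $S_n$ and let $\mathrm{Inv}(\rho_n)=\sum_{1\le i<j\le n}\mathbf{1}(\rho_n(i)>\rho_n(j))$ be its number of inversions. Let $\mathcal{G}$ be a standard normal random variable. Then there is a constant $C$ independent of $n$ such that for all $n\ge 2$, $$d_W\left(\frac{\mathrm{Inv}(\rho_n)-\frac{1-\log 2}{2}\,n^2}{\sqrt{\mathrm{Var}(\mathrm{Inv}(\rho_n))}},\ \mathcal{G}\right)\le\frac{C}{\sqrt{n}}.$$ In particular, $$\frac{\mathrm{Inv}(\rho_n)-\frac{1-\log 2}{2}\,n^2}{\sqrt{\frac13-\frac{\pi^2}{18}+\frac{2\log 2}{3}-\frac{\log 3}{2}+\frac{2\log^2 2}{3}}\;n^{3/2}}\longrightarrow_d\mathcal{G}\quad\text{as } n\to\infty.$$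
   Context: $S_n$ is the symmetric group on $\{1,\dots,n\}$. Inverse-unfair permutation: let $\{X^{(i)}_j : 1\le i\le n,\ 1\le j\le i\}$ be independent random variables, each uniform on $(0,1)$, and set $Z_i=\max\{X^{(i)}_1,\dots,X^{(i)}_i\}$ for $i=1,\dots,n$. Let $R_i$ be the rank of $Z_i$ among $Z_1,\dots,Z_n$ (rank $1$ is the smallest value; ties have probability zero). Then $\rho_n=(R_1,\dots,R_n)$, i.e. $\rho_n(i)=R_i$. Here $\log$ is the natural logarithm, $\log^2 2=(\log 2)^2$, $d_W$ is the Wasserstein distance between the laws of two real random variables, $d_W(X,Y)=\sup\{|\mathbb{E}h(X)-\mathbb{E}h(Y)| : h:\mathbb{R}\to\mathbb{R}\ \text{1-Lipschitz}\}$, and $\to_d$ denotes convergence in distribution. *)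

theory Defs
  imports "HOL-Probability.Probability" "HOL-Analysis.Lipschitz" "HOL-Combinatorics.Permutations"
begin

locale unfair_array = prob_space M for M :: "'a measure" +
  fixes n :: nat and X :: "nat \<Rightarrow> nat \<Rightarrow> 'a \<Rightarrow> real"
  assumes indep: "indep_vars (\<lambda>_. borel) (\<lambda>(i, j). X i j) (SIGMA i:{1..n}. {1..i})"
    and uniform: "\<And>i j. 1 \<le> i \<Longrightarrow> i \<le> n \<Longrightarrow> 1 \<le> j \<Longrightarrow> j \<le> i \<Longrightarrow>
      distr M borel (X i j) = uniform_measure lborel {0<..<1}"

definition unfair_max :: "(nat \<Rightarrow> nat \<Rightarrow> 'a \<Rightarrow> real) \<Rightarrow> nat \<Rightarrow> 'a \<Rightarrow> real" where
  "unfair_max X i \<omega> = Max ((\<lambda>j. X i j \<omega>) ` {1..i})"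

text \<open>Write \<open>Z\<^sub>i\<close> for \<open>unfair_max X i \<omega>\<close>. The rank of \<open>Z\<^sub>i\<close> is the number of \<open>k\<close> with \<open>Z\<^sub>k \<le> Z\<^sub>i\<close>. Outside \<open>{1..n}\<close> the map is the identity,
  as for any element of the symmetric group represented by \<^const>\<open>permutes\<close>. On the null event that
  two of the \<open>Z\<^sub>i\<close> coincide it is not a permutation.\<close>

definition inverse_unfair :: "nat \<Rightarrow> (nat \<Rightarrow> nat \<Rightarrow> 'a \<Rightarrow> real) \<Rightarrow> 'a \<Rightarrow> nat \<Rightarrow> nat" where
  "inverse_unfair n X \<omega> i =
     (if i \<in> {1..n} then card {k \<in> {1..n}. unfair_max X k \<omega> \<le> unfair_max X i \<omega>} else i)"

lemma inverse_unfair_permutes: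
  assumes "inj_on (\<lambda>i. unfair_max X i \<omega>) {1..n}"
  shows "inverse_unfair n X \<omega> permutes {1..n}"
proof -
  let ?Z = "\<lambda>i. unfair_max X i \<omega>"
  let ?r = "inverse_unfair n X \<omega>"
  let ?S = "\<lambda>i. {k \<in> {1..n}. ?Z k \<le> ?Z i}"
  have less: "?r i < ?r j" if "i \<in> {1..n}" "j \<in> {1..n}" "?Z i < ?Z j" for i j
  proof -
    have "?S i \<subseteq> ?S j" "j \<in> ?S j" "j \<notin> ?S i"
      using that by (auto intro: order_trans less_imp_le)
    then have "?S i \<subset> ?S j" by blast
    then show ?thesis using that by (simp add: inverse_unfair_def psubset_card_mono)
  qed
  have inj: "inj_on ?r {1..n}"
  proof (rule inj_onI, rule ccontr)
    fix i j assume ij: "i \<in> {1..n}" "j \<in> {1..n}" "?r i = ?r j" "i \<noteq> j"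
    then have "?Z i \<noteq> ?Z j" using assms by (auto dest: inj_onD)
    then show False using less[of i j] less[of j i] ij by linarith
  qed
  have "?r i \<in> {1..n}" if "i \<in> {1..n}" for i
  proof -
    have "?S i \<noteq> {}" using that by auto
    then have "0 < card (?S i)" by (simp add: card_gt_0_iff)
    moreover have "card (?S i) \<le> card {1..n}" by (rule card_mono) auto
    ultimately show ?thesis using that by (simp add: inverse_unfair_def)
  qed
  then have "?r ` {1..n} \<subseteq> {1..n}" by blast
  then have "bij_betw ?r {1..n} {1..n}"
    using inj by (simp add: bij_betw_def endo_inj_surj)
  then show ?thesis
    by (rule bij_imp_permutes) (auto simp: inverse_unfair_def)
qed

definition inversions :: "nat \<Rightarrow> (nat \<Rightarrow> nat) \<Rightarrow> nat" where
  "inversions n \<sigma> = (\<Sum>j = 1..n. \<Sum>i = 1..<j. of_bool (\<sigma> i > \<sigma> j))"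

text \<open>The supremum is taken in \<^typ>\<open>ereal\<close>, where it always exists. For laws with a finite first moment
  every Lipschitz function is integrable; otherwise the Bochner integral may take its default value.\<close>

definition wasserstein :: "real measure \<Rightarrow> real measure \<Rightarrow> ereal" where
  "wasserstein \<mu> \<nu> =
     (SUP h \<in> {h :: real \<Rightarrow> real. 1-lipschitz_on UNIV h}.
        ereal \<bar>(\<integral>x. h x \<partial>\<mu>) - (\<integral>x. h x \<partial>\<nu>)\<bar>)"

end

(* The maxima Z_i are independent with distribution function t^i on [0,1], and Inv is the sum over
   i < j of 1(Z_i > Z_j). Hoeffding's decomposition writes Inv = E Inv + S + R with
   S = sum_i psi_i(Z_i), psi_i(x) = sum_j sgn(j - i) (x^j - i/(i+j)), and a degenerate remainder R whose
   terms are pairwise orthogonal, so E R^2 = O(n^2) while Var S is of order n^3. After division by the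
   standard deviation, R and the error E Inv - (1 - log 2) n^2 / 2 = O(n) contribute O(n^(-1/2)), and so
   does Stein's method applied to the independent summands psi_i(Z_i), which are bounded by n.

   Var S is a triple sum over i, j, k of a kernel homogeneous of degree 0. Symmetrised over the three
   indices, its increment in n is a positive double sum, a Riemann sum of n^2 times
   4 a b^2 / ((1+a)(1+b)(1+a+b)(a+b)) over 0 < a < b < 1. This integral is evaluated by explicit
   antiderivatives; its only non-elementary part is the dilogarithm at 1/2. *)
theory Submission
  imports Defs "HOL-Real_Asymp.Real_Asymp"
begin

section \<open>Stein's method for bounded independent summands\<close>

text \<open>The first claim normalises by the true standard deviation, so of Var S the rate needs
  only a lower bound c n^3, not a rate of convergence. The exact limit enters that bound through its
  positivity, and the second claim through its value. Both claims come from one estimate,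
  \<open>Inv_normal_approx\<close>, in which the scale s is left free. The obstacle in the variance
  is the sign pattern: \<open>order_sign i j * order_sign i k\<close> takes both signs, so neither
  positivity nor the size n^3 is visible in the triple sum. In the increments the negative fractions
  cancel. This also yields Var S > 0 for each n \<ge> 2, so that the finitely many small n are
  covered without explicit constants. Stein's equation is used with a bound on the second derivative
  of its solution. That bound needs a differentiable test function, so Lipschitz functions are
  averaged over short intervals beforehand. The rate then comes from dividing the bound n on a
  summand by a standard deviation of order n^(3/2).\<close>

lemma abs_le_of_deriv_le_tail:
  fixes q \<Psi> :: "real \<Rightarrow> real"
  assumes q: "\<And>x. x \<ge> a \<Longrightarrow> (q has_real_derivative q' x) (at x)"
    and \<Psi>: "\<And>x. x \<ge> a \<Longrightarrow> (\<Psi> has_real_derivative \<Psi>' x) (at x)"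
    and le: "\<And>x. x \<ge> a \<Longrightarrow> \<bar>q' x\<bar> \<le> - \<Psi>' x"
    and lim: "(q \<longlongrightarrow> 0) at_top" "(\<Psi> \<longlongrightarrow> 0) at_top"
  shows "\<bar>q a\<bar> \<le> \<Psi> a"
proof -
  \<comment> \<open>Since |q'| \<le> - \<Psi>', both \<Psi> + q and \<Psi> - q are nonincreasing;
    they tend to 0, hence are nonnegative at a. Tails are thus compared without integrating
    q'.\<close>
  have 1: "q y + \<Psi> y \<le> q a + \<Psi> a" "\<Psi> y - q y \<le> \<Psi> a - q a" if "y \<ge> a" for y
  proof -
    show "q y + \<Psi> y \<le> q a + \<Psi> a"
      by (rule DERIV_nonpos_imp_nonincreasing[OF that], rule exI[of _ "q' _ + \<Psi>' _"])
         (use le in \<open>force intro!: derivative_eq_intros q \<Psi>\<close>)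
    show "\<Psi> y - q y \<le> \<Psi> a - q a"
      by (rule DERIV_nonpos_imp_nonincreasing[OF that], rule exI[of _ "\<Psi>' _ - q' _"])
         (use le in \<open>force intro!: derivative_eq_intros q \<Psi>\<close>)
  qed
  have "0 \<le> q a + \<Psi> a"
    by (rule tendsto_upperbound[OF tendsto_add_zero[OF lim]])
       (auto intro!: eventually_at_top_linorderI[of a] 1)
  moreover have "0 \<le> \<Psi> a - q a"
    by (rule tendsto_upperbound[OF tendsto_diff[OF lim(2,1), simplified]])
       (auto intro!: eventually_at_top_linorderI[of a] 1)
  ultimately show ?thesis by linarith
qed

section \<open>Bounds for solutions of the Stein equation g' = x g + k\<close>

context
  fixes g k :: "real \<Rightarrow> real" and K :: real
  assumes g: "\<And>x. (g has_real_derivative x * g x + k x) (at x)"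
begin

text \<open>exp(-x^2/2) is the integrating factor of the equation: the term x g drops out, so decay
  of the product at infinity lets k control g.\<close>

lemma stein_ode_mult_exp:
  "((\<lambda>x. g x * exp (- x\<^sup>2 / 2)) has_real_derivative k x * exp (- x\<^sup>2 / 2)) (at x)"
  by (rule derivative_eq_intros g refl | simp add: algebra_simps)+

text \<open>K exp(-x^2/2) has derivative -K x exp(-x^2/2), so it is the comparison function for a
  right-hand side of linear growth.\<close>

lemma stein_ode_bound_right:
  assumes lim: "((\<lambda>x. g x * exp (- x\<^sup>2 / 2)) \<longlongrightarrow> 0) at_top"
    and k: "\<And>x. x \<ge> 1 \<Longrightarrow> \<bar>k x\<bar> \<le> K * x" and w: "w \<ge> 1"
  shows "\<bar>g w\<bar> \<le> K"
proof -
  have "\<bar>g w * exp (- w\<^sup>2 / 2)\<bar> \<le> K * exp (- w\<^sup>2 / 2)"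
  proof (rule abs_le_of_deriv_le_tail[OF stein_ode_mult_exp _ _ lim])
    show "((\<lambda>x. K * exp (- x\<^sup>2 / 2)) \<longlongrightarrow> 0) at_top" by real_asymp
    show "((\<lambda>x. K * exp (- x\<^sup>2 / 2)) has_real_derivative - (K * x * exp (- x\<^sup>2 / 2))) (at x)" for x
      by (rule derivative_eq_intros refl | simp)+
    show "\<bar>k x * exp (- x\<^sup>2 / 2)\<bar> \<le> - (- (K * x * exp (- x\<^sup>2 / 2)))" if "w \<le> x" for x
      using k[of x] w that by (simp add: abs_mult)
  qed
  then show ?thesis by (simp add: abs_mult)
qed

text \<open>The comparison function is the Mills ratio bound K exp(-x^2/2) / x. Thus a bounded
  right-hand side makes g decay like 1/w.\<close>

lemma stein_ode_bound_right':
  assumes lim: "((\<lambda>x. g x * exp (- x\<^sup>2 / 2)) \<longlongrightarrow> 0) at_top"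
    and k: "\<And>x. \<bar>k x\<bar> \<le> K" and w: "w > 0"
  shows "\<bar>w * g w\<bar> \<le> K"
proof -
  have "\<bar>g w * exp (- w\<^sup>2 / 2)\<bar> \<le> K * exp (- w\<^sup>2 / 2) / w"
  proof (rule abs_le_of_deriv_le_tail[OF stein_ode_mult_exp _ _ lim])
    show "((\<lambda>x. K * exp (- x\<^sup>2 / 2) / x) \<longlongrightarrow> 0) at_top" by real_asymp
    show "((\<lambda>x. K * exp (- x\<^sup>2 / 2) / x) has_real_derivative
        - (K * exp (- x\<^sup>2 / 2) * (1 + 1 / x\<^sup>2))) (at x)" if "w \<le> x" for x
      using that w by (auto intro!: derivative_eq_intros simp: field_simps power2_eq_square)
    show "\<bar>k x * exp (- x\<^sup>2 / 2)\<bar> \<le> - (- (K * exp (- x\<^sup>2 / 2) * (1 + 1 / x\<^sup>2)))" if "w \<le> x" for x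
    proof -
      have "\<bar>k x\<bar> * 1 \<le> K * (1 + 1 / x\<^sup>2)"
        using k[of x] by (intro mult_mono) auto
      then show ?thesis
        by (simp add: abs_mult mult.assoc mult.left_commute[of K])
    qed
  qed
  then show ?thesis using w by (simp add: abs_mult field_simps)
qed

end

text \<open>The negative half-line follows by reflection: -g(-x) solves the equation with right-hand
  side k(-x), and decay at -infinity becomes decay at +infinity.\<close>

lemma
  fixes g k :: "real \<Rightarrow> real"
  assumes g: "\<And>x. (g has_real_derivative x * g x + k x) (at x)"
    and lim: "((\<lambda>x. g x * exp (- x\<^sup>2 / 2)) \<longlongrightarrow> 0) at_top" "((\<lambda>x. g x * exp (- x\<^sup>2 / 2)) \<longlongrightarrow> 0) at_bot"
  shows stein_ode_bound: "\<lbrakk>\<And>x. \<bar>x\<bar> \<ge> 1 \<Longrightarrow> \<bar>k x\<bar> \<le> K * \<bar>x\<bar>; \<bar>w\<bar> \<ge> 1\<rbrakk> \<Longrightarrow> \<bar>g w\<bar> \<le> K"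
    and stein_ode_bound': "(\<And>x. \<bar>k x\<bar> \<le> K) \<Longrightarrow> \<bar>w * g w\<bar> \<le> K"
proof -
  have g': "((\<lambda>x. - g (- x)) has_real_derivative x * (- g (- x)) + k (- x)) (at x)" for x
    using DERIV_minus[OF DERIV_chain'[OF DERIV_minus[OF DERIV_ident] g[of "- x"]]]
    by simp
  have lim': "((\<lambda>x. - g (- x) * exp (- x\<^sup>2 / 2)) \<longlongrightarrow> 0) at_top"
    using tendsto_minus[OF lim(2)[unfolded filterlim_at_bot_mirror]] by simp
  show "\<bar>g w\<bar> \<le> K" if k: "\<And>x. \<bar>x\<bar> \<ge> 1 \<Longrightarrow> \<bar>k x\<bar> \<le> K * \<bar>x\<bar>" and w: "\<bar>w\<bar> \<ge> 1"
  proof (cases "w \<ge> 1")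
    case True
    have "\<bar>k x\<bar> \<le> K * x" if "x \<ge> 1" for x using k[of x] that by simp
    then show ?thesis by (rule stein_ode_bound_right[OF g lim(1) _ True])
  next
    case False
    have "\<bar>k (- x)\<bar> \<le> K * x" if "x \<ge> 1" for x using k[of "- x"] that by simp
    then have "\<bar>- g (- (- w))\<bar> \<le> K"
      by (rule stein_ode_bound_right[OF g' lim']) (use False w in auto)
    then show ?thesis by simp
  qed
  show "\<bar>w * g w\<bar> \<le> K" if k: "\<And>x. \<bar>k x\<bar> \<le> K"
  proof (cases w "0 :: real" rule: linorder_cases)
    case less
    have "\<bar>(- w) * (- g (- (- w)))\<bar> \<le> K"
      by (rule stein_ode_bound_right'[OF g' lim', of K "- w"]) (use less k in auto)
    then show ?thesis by simp
  next
    case equal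
    then show ?thesis using k[of 0] by simp
  next
    case greater
    then show ?thesis by (rule stein_ode_bound_right'[OF g lim(1) k])
  qed
qed

section \<open>Gaussian means of Lipschitz functions\<close>

abbreviation normal_mean :: "(real \<Rightarrow> real) \<Rightarrow> real" where
  "normal_mean h \<equiv> integral\<^sup>L std_normal_distribution h"

lemma integrable_std_normal_abs: "integrable std_normal_distribution (\<lambda>x. \<bar>x\<bar>)"
  using integrable_std_normal_moment_abs[of 1]
  by (simp add: integrable_real_density)

lemma normal_mean_abs_le: "normal_mean (\<lambda>x. \<bar>x\<bar>) \<le> 1"
proof -
  have "normal_mean (\<lambda>x. \<bar>x\<bar>) = sqrt (2 / pi)"
    using integral_std_normal_moment_abs_odd[of 0] by (simp add: integral_real_density)
  also have "\<dots> \<le> 1" using pi_gt3 by (simp add: real_sqrt_le_1_iff)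
  finally show ?thesis .
qed

lemma lipschitz_1_abs_le:
  fixes h :: "real \<Rightarrow> real"
  assumes "1-lipschitz_on UNIV h"
  shows "\<bar>h x - h y\<bar> \<le> \<bar>x - y\<bar>"
  using lipschitz_onD[OF assms, of x y] by (simp add: dist_real_def)

lemma lipschitz_1_borel_measurable:
  fixes h :: "real \<Rightarrow> real"
  shows "1-lipschitz_on UNIV h \<Longrightarrow> h \<in> borel_measurable borel"
  by (intro borel_measurable_continuous_onI lipschitz_on_continuous_on)

lemma (in prob_space) integrable_lipschitz:
  fixes h :: "real \<Rightarrow> real"
  assumes h: "1-lipschitz_on UNIV h" and X: "integrable M X"
  shows "integrable M (\<lambda>x. h (X x))"
proof (rule Bochner_Integration.integrable_bound)
  have [measurable]: "h \<in> borel_measurable borel" "X \<in> borel_measurable M"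
    using lipschitz_1_borel_measurable[OF h] X by auto
  show "integrable M (\<lambda>x. \<bar>h 0\<bar> + \<bar>X x\<bar>)" using X by auto
  show "(\<lambda>x. h (X x)) \<in> borel_measurable M" by measurable
  show "AE x in M. norm (h (X x)) \<le> norm (\<bar>h 0\<bar> + \<bar>X x\<bar>)"
    using lipschitz_1_abs_le[OF h, of _ 0] by (intro AE_I2) (smt (verit) real_norm_def)
qed

text \<open>|h x - E h(G)| \<le> E |x - G| \<le> |x| + E |G|, with E |G| = sqrt(2/pi) \<le> 1. This
  linear growth is the input for the sup bound on the Stein solution.\<close>

lemma abs_diff_normal_mean_le:
  assumes h: "1-lipschitz_on UNIV h"
  shows "integrable std_normal_distribution h" "\<bar>h x - normal_mean h\<bar> \<le> \<bar>x\<bar> + 1"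
proof -
  interpret N: prob_space std_normal_distribution by (rule prob_space_normal_density) simp
  have N1: "measure std_normal_distribution UNIV = 1" using N.prob_space by simp
  have [measurable]: "h \<in> borel_measurable borel" by (rule lipschitz_1_borel_measurable[OF h])
  have i: "integrable std_normal_distribution (\<lambda>x. x :: real)"
    using integrable_std_normal_abs by (subst (asm) integrable_abs_iff) auto
  show I: "integrable std_normal_distribution h"
    using N.integrable_lipschitz[OF h i] .
  have "\<bar>h x - normal_mean h\<bar> = \<bar>normal_mean (\<lambda>y. h x - h y)\<bar>"
    using I by (simp add: N1)
  also have "\<dots> \<le> normal_mean (\<lambda>y. \<bar>h x - h y\<bar>)" by (rule integral_abs_bound)
  also have "\<dots> \<le> normal_mean (\<lambda>y. \<bar>x\<bar> + \<bar>y\<bar>)"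
    using I integrable_std_normal_abs lipschitz_1_abs_le[OF h, of x]
    by (intro integral_mono) (auto intro: order_trans[OF _ abs_triangle_ineq4])
  also have "\<dots> \<le> \<bar>x\<bar> + 1"
    using integrable_std_normal_abs normal_mean_abs_le by (simp add: N1)
  finally show "\<bar>h x - normal_mean h\<bar> \<le> \<bar>x\<bar> + 1" .
qed

text \<open>The statement at +infinity is applied to the reflected function; the half-lines that
  have to be matched differ in a single point, a null set.\<close>

lemma tendsto_integral_at_bot:
  fixes f :: "real \<Rightarrow> real"
  assumes f: "integrable lborel f"
  shows "((\<lambda>y. \<integral>x. indicator {..y} x * f x \<partial>lborel) \<longlongrightarrow> 0) at_bot"
proof -
  have f': "integrable lborel (\<lambda>x. f (- x))"
    using lborel_integrable_real_affine[OF f, of "-1" 0] by simp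
  have "((\<lambda>y. (\<integral>x. f (- x) \<partial>lborel) - (\<integral>x. indicator {..y} x * f (- x) \<partial>lborel)) \<longlongrightarrow> 0) at_top"
    by (rule tendsto_eq_intros tendsto_integral_at_top[of lborel, OF _ f', simplified] refl | simp)+
  moreover have "(\<integral>x. f (- x) \<partial>lborel) - (\<integral>x. indicator {..y} x * f (- x) \<partial>lborel)
      = (\<integral>x. indicator {..-y} x * f x \<partial>lborel)" for y
  proof -
    have "(\<integral>x. f (- x) \<partial>lborel) - (\<integral>x. indicator {..y} x * f (- x) \<partial>lborel)
       = (\<integral>x. f (- x) - indicator {..y} x * f (- x) \<partial>lborel)"
      using integrable_mult_indicator[of "{..y}" lborel, OF _ f'] f' by simp
    also have "\<dots> = (\<integral>x. indicator {..-y} (-x) * f (- x) \<partial>lborel)"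
      by (rule integral_cong_AE) (use AE_lborel_singleton[of y] f f' in \<open>auto split: split_indicator\<close>)
    also have "\<dots> = (\<integral>x. indicator {..-y} x * f x \<partial>lborel)"
      using lborel_integral_real_affine[of "-1" "\<lambda>x. indicator {..-y} x * f x" 0] by simp
    finally show ?thesis .
  qed
  ultimately show ?thesis by (simp add: filterlim_at_bot_mirror)
qed

text \<open>The solution is exp(x^2/2) times the integral of (h - E h(G)) exp(-t^2/2) over
  (-infinity, x]. Centring h makes the total integral 0, which is why the product with exp(-x^2/2)
  vanishes at both ends and not only at -infinity.\<close>

lemma stein_solution_exists:
  fixes h :: "real \<Rightarrow> real"
  assumes h: "1-lipschitz_on UNIV h"
  obtains f where "\<And>x. (f has_real_derivative x * f x + (h x - normal_mean h)) (at x)"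
    "((\<lambda>x. f x * exp (- x\<^sup>2 / 2)) \<longlongrightarrow> 0) at_top" "((\<lambda>x. f x * exp (- x\<^sup>2 / 2)) \<longlongrightarrow> 0) at_bot"
proof -
  define k where "k x = h x - normal_mean h" for x
  define p where "p x = k x * exp (- x\<^sup>2 / 2)" for x
  define q where "q y = (\<integral>x. indicator {..y} x * p x \<partial>lborel)" for y
  have p_eq: "p x = sqrt (2 * pi) * (std_normal_density x * k x)" for x
    by (simp add: p_def std_normal_density_def)
  have ch: "continuous_on UNIV h" by (rule lipschitz_on_continuous_on[OF h])
  have cp: "continuous_on UNIV p"
    unfolding p_def k_def by (intro continuous_intros ch) simp
  interpret N: prob_space std_normal_distribution by (rule prob_space_normal_density) simp
  have N1: "measure std_normal_distribution UNIV = 1" using N.prob_space by simp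
  have kN: "integrable std_normal_distribution k"
    unfolding k_def using abs_diff_normal_mean_le(1)[OF h] by simp
  have [measurable]: "k \<in> borel_measurable borel" using kN by simp
  have ip: "integrable lborel p"
    using kN unfolding p_eq by (simp add: integrable_real_density)
  have "normal_mean k = 0"
    unfolding k_def using abs_diff_normal_mean_le(1)[OF h] by (simp add: N1)
  then have p0: "(\<integral>x. p x \<partial>lborel) = 0"
    unfolding p_eq by (simp add: integral_real_density)
  have top: "(q \<longlongrightarrow> 0) at_top"
    using tendsto_integral_at_top[of lborel, OF _ ip] by (simp add: q_def[abs_def] p0)
  have bot: "(q \<longlongrightarrow> 0) at_bot"
    unfolding q_def[abs_def] by (rule tendsto_integral_at_bot[OF ip])
  \<comment> \<open>\<open>q\<close> is a Lebesgue integral over a half-line; its derivative is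
    found by showing that it differs by a constant from an antiderivative of the continuous
    \<open>p\<close>.\<close>
  obtain F where F: "\<And>x. (F has_vector_derivative p x) (at x)"
    using einterval_antiderivative[of "-\<infinity>" "\<infinity>" p] cp by (auto simp: continuous_on_eq_continuous_at)
  have q_diff: "q b = q a + (F b - F a)" if "a \<le> b" for a b
  proof -
    have "q b = (\<integral>x. indicator {..a} x * p x + indicator {a..b} x *\<^sub>R p x \<partial>lborel)"
      unfolding q_def
      by (rule integral_cong_AE)
         (use AE_lborel_singleton[of a] that ip in \<open>auto split: split_indicator\<close>)
    also have "\<dots> = q a + (\<integral>x. indicator {a..b} x *\<^sub>R p x \<partial>lborel)"
      unfolding q_def
      using integrable_mult_indicator[of _ lborel, OF _ ip] by (subst Bochner_Integration.integral_add) auto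
    also have "(\<integral>x. indicator {a..b} x *\<^sub>R p x \<partial>lborel) = F b - F a"
      by (rule integral_FTC_atLeastAtMost[OF that])
         (auto intro: has_vector_derivative_at_within F continuous_on_subset[OF cp])
    finally show ?thesis .
  qed
  have "q x = q 0 - F 0 + F x" for x
    using q_diff[of 0 x] q_diff[of x 0] by (cases "x \<ge> 0") auto
  then have q_eq: "q = (\<lambda>x. q 0 - F 0 + F x)" by blast
  have dq: "(q has_real_derivative p x) (at x)" for x
    by (subst q_eq) (auto intro!: derivative_eq_intros F simp: has_real_derivative_iff_has_vector_derivative)
  define f where "f x = q x * exp (x\<^sup>2 / 2)" for x
  have fq: "f x * exp (- x\<^sup>2 / 2) = q x" for x
    by (simp add: f_def mult.assoc flip: exp_add)
  show ?thesis
  proof (rule that[of f])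
    show "(f has_real_derivative x * f x + (h x - normal_mean h)) (at x)" for x
    proof -
      have "p x * exp (x\<^sup>2 / 2) = k x" by (simp add: p_def mult.assoc flip: exp_add)
      then show ?thesis unfolding f_def[abs_def]
        by (auto intro!: derivative_eq_intros dq simp: k_def)
    qed
  qed (simp_all only: fq top bot)
qed

text \<open>|f| is at most 6 / exp(-1/2). Hence |x f'| and |f + h'| are both at most 6 / exp(-1/2) +
  1, and f'' is the sum of x f' and f + h'.\<close>

definition stein_const :: real where
  "stein_const = 2 * (6 / exp (- 1 / 2) + 1)"

text \<open>The derivative \<open>f'\<close> solves the same equation with right-hand side \<open>f + h'\<close>, which is bounded.
  This bounds \<open>x * f' x\<close> and hence \<open>f''\<close>.\<close>

lemma stein_solution:
  fixes h h' :: "real \<Rightarrow> real"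
  assumes dh: "\<And>x. (h has_real_derivative h' x) (at x)"
    and h': "\<And>x. \<bar>h' x\<bar> \<le> 1"
  obtains f f' f'' where "\<And>x. (f has_real_derivative f' x) (at x)"
    "\<And>x. (f' has_real_derivative f'' x) (at x)" "\<And>x. \<bar>f'' x\<bar> \<le> stein_const"
    "\<And>x. f' x - x * f x = h x - normal_mean h"
proof -
  have h: "1-lipschitz_on UNIV h"
  proof (rule lipschitz_onI)
    show "dist (h x) (h y) \<le> 1 * dist x y" for x y
      using field_differentiable_bound[of UNIV h h' 1 x y] dh h'
      by (simp add: dist_norm)
  qed simp
  obtain f where f: "\<And>x. (f has_real_derivative x * f x + (h x - normal_mean h)) (at x)"
    and lim: "((\<lambda>x. f x * exp (- x\<^sup>2 / 2)) \<longlongrightarrow> 0) at_top" "((\<lambda>x. f x * exp (- x\<^sup>2 / 2)) \<longlongrightarrow> 0) at_bot"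
    using stein_solution_exists[OF h] by blast
  note hb = abs_diff_normal_mean_le(2)[OF h]
  define e :: real where "e = exp (- 1 / 2)"
  have e: "0 < e" "e < 1" by (auto simp: e_def)
  have f1: "\<bar>f w\<bar> \<le> 2" if "\<bar>w\<bar> \<ge> 1" for w
  proof (rule stein_ode_bound[OF f lim _ that])
    show "\<bar>h x - normal_mean h\<bar> \<le> 2 * \<bar>x\<bar>" if "1 \<le> \<bar>x\<bar>" for x using hb[of x] that by linarith
  qed
  \<comment> \<open>Inside [-1, 1] the product f(x) exp(-x^2/2) is compared with its value at 1,
    which is at most 2. Its derivative is at most 2 and |w - 1| \<le> 2, so the product is at most 2
    + 4 = 6. Dividing by exp(-w^2/2) \<ge> \<open>e\<close> gives the bound.\<close>
  have fA: "\<bar>f w\<bar> \<le> 6 / e" for w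
  proof (cases "\<bar>w\<bar> \<ge> 1")
    case True
    have "\<bar>f w\<bar> * e \<le> 2 * 1" using f1[OF True] e by (intro mult_mono) auto
    then show ?thesis using e by (simp add: field_simps)
  next
    case False
    have "norm (f w * exp (- w\<^sup>2 / 2) - f 1 * exp (- 1\<^sup>2 / 2)) \<le> 2 * norm (w - 1)"
    proof (rule field_differentiable_bound[of "{-1..1}" _ "\<lambda>x. (h x - normal_mean h) * exp (- x\<^sup>2 / 2)"])
      show "((\<lambda>x. f x * exp (- x\<^sup>2 / 2)) has_real_derivative (h z - normal_mean h) * exp (- z\<^sup>2 / 2)) (at z within {- 1..1})" for z
        by (rule has_field_derivative_at_within[OF stein_ode_mult_exp[OF f]])
      show "norm ((h z - normal_mean h) * exp (- z\<^sup>2 / 2)) \<le> 2" if "z \<in> {-1..1}" for z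
      proof -
        have "\<bar>h z - normal_mean h\<bar> * exp (- z\<^sup>2 / 2) \<le> 2 * 1"
          using hb[of z] that by (intro mult_mono) auto
        then show ?thesis by (simp add: abs_mult)
      qed
    qed (use False in auto)
    moreover have "norm (f 1 * exp (- 1\<^sup>2 / 2)) \<le> 2 * 1"
      using f1[of 1] unfolding norm_mult by (intro mult_mono) auto
    moreover have "norm (w - 1) \<le> 2" using False by auto
    ultimately have "\<bar>f w * exp (- w\<^sup>2 / 2)\<bar> \<le> 6"
      using norm_triangle_sub[of "f w * exp (- w\<^sup>2 / 2)" "f 1 * exp (- 1\<^sup>2 / 2)"]
      unfolding real_norm_def by argo
    moreover have "e \<le> exp (- w\<^sup>2 / 2)"
      using False by (auto simp: e_def abs_square_le_1)
    ultimately have "\<bar>f w\<bar> * e \<le> 6"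
      using mult_left_mono[of e "exp (- w\<^sup>2 / 2)" "\<bar>f w\<bar>"] by (simp add: abs_mult)
    then show ?thesis using e by (simp add: field_simps)
  qed
  define f' where "f' x = x * f x + (h x - normal_mean h)" for x
  have df': "(f' has_real_derivative x * f' x + (f x + h' x)) (at x)" for x
    unfolding f'_def[abs_def]
    by (rule derivative_eq_intros f dh refl | simp add: algebra_simps)+
  \<comment> \<open>A crude linear bound is enough here: it makes f' exp(-x^2/2) vanish at both
    ends, as the comparison for the differentiated equation requires.\<close>
  have f'b: "\<bar>f' x\<bar> \<le> (6 / e + 1) * \<bar>x\<bar> + 1" for x
  proof -
    have "\<bar>x * f x\<bar> \<le> 6 / e * \<bar>x\<bar>" using mult_right_mono[OF fA[of x], of "\<bar>x\<bar>"] by (simp add: abs_mult mult.commute)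
    then have "\<bar>f' x\<bar> \<le> 6 / e * \<bar>x\<bar> + (\<bar>x\<bar> + 1)"
      unfolding f'_def using hb[of x] by linarith
    then show ?thesis by (simp add: algebra_simps)
  qed
  have tb: "norm (f' x * exp (- x\<^sup>2 / 2)) \<le> ((6 / e + 1) * \<bar>x\<bar> + 1) * exp (- x\<^sup>2 / 2)" for x
    using f'b[of x] by (simp add: abs_mult)
  have B: "((\<lambda>x. (B * \<bar>x\<bar> + 1) * exp (- x\<^sup>2 / 2)) \<longlongrightarrow> 0) at_top" 
     "((\<lambda>x. (B * \<bar>x\<bar> + 1) * exp (- x\<^sup>2 / 2)) \<longlongrightarrow> 0) at_bot" for B :: real
    by real_asymp+
  have l1: "((\<lambda>x. f' x * exp (- x\<^sup>2 / 2)) \<longlongrightarrow> 0) at_top"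
    by (rule Lim_null_comparison[OF always_eventually[OF allI[OF tb]] B(1)])
  have l2: "((\<lambda>x. f' x * exp (- x\<^sup>2 / 2)) \<longlongrightarrow> 0) at_bot"
    by (rule Lim_null_comparison[OF always_eventually[OF allI[OF tb]] B(2)])
  have wf: "\<bar>w * f' w\<bar> \<le> 6 / e + 1" for w
  proof (rule stein_ode_bound'[OF df' l1 l2])
    show "\<bar>f x + h' x\<bar> \<le> 6 / e + 1" for x using fA[of x] h'[of x] by linarith
  qed
  show ?thesis
  proof (rule that[of f f' "\<lambda>x. x * f' x + (f x + h' x)"])
    show "\<bar>x * f' x + (f x + h' x)\<bar> \<le> stein_const" for x
      using order_trans[OF abs_triangle_ineq add_mono[OF wf[of x] order_trans[OF abs_triangle_ineq add_mono[OF fA[of x] h'[of x]]]]]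
      by (simp add: stein_const_def e_def)
  qed (use f df' in \<open>auto simp: f'_def\<close>)
qed

text \<open>Leave-one-out: D_i = W - \<xi>_i is independent of \<xi>_i, so E \<xi>_i f(D_i) = 0 and
  E \<xi>_i^2 f'(D_i) factorises. Two errors of size K B E \<xi>_i^2 remain, one from replacing
  f'(D_i) by f'(W) and one from the Taylor remainder of f. The second moments add up to 1, which
  leaves 2 K B.\<close>

lemma (in prob_space) stein_sum_bound:
  fixes \<xi> :: "'i \<Rightarrow> 'a \<Rightarrow> real"
  assumes fin: "finite I" and ind: "indep_vars (\<lambda>_. borel) \<xi> I"
    and bnd: "\<And>i. i \<in> I \<Longrightarrow> AE \<omega> in M. \<bar>\<xi> i \<omega>\<bar> \<le> B" and B: "0 \<le> B"
    and mean: "\<And>i. i \<in> I \<Longrightarrow> expectation (\<xi> i) = 0"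
    and var: "(\<Sum>i\<in>I. expectation (\<lambda>\<omega>. (\<xi> i \<omega>)\<^sup>2)) = 1"
    and f: "\<And>x. (f has_real_derivative f' x) (at x)"
    and f': "\<And>x. (f' has_real_derivative f'' x) (at x)"
    and f'': "\<And>x. \<bar>f'' x\<bar> \<le> K"
  defines "W \<equiv> \<lambda>\<omega>. \<Sum>i\<in>I. \<xi> i \<omega>"
  shows "\<bar>expectation (\<lambda>\<omega>. f' (W \<omega>) - W \<omega> * f (W \<omega>))\<bar> \<le> 2 * K * B"
proof -
  have K: "0 \<le> K" using f''[of 0] by linarith
  have rv: "\<xi> i \<in> borel_measurable M" if "i \<in> I" for i
    using ind that by (auto simp: indep_vars_def)
  have cf: "continuous_on UNIV f" "continuous_on UNIV f'"
    using f f' by (auto intro!: continuous_at_imp_continuous_on DERIV_isCont)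
  have [measurable]: "f \<in> borel_measurable borel" "f' \<in> borel_measurable borel"
    using cf by (auto intro: borel_measurable_continuous_onI)
  have Wm[measurable]: "W \<in> borel_measurable M"
    unfolding W_def using rv by auto
  define b where "b = real (card I) * B"
  have ae: "AE \<omega> in M. \<forall>i\<in>I. \<bar>\<xi> i \<omega>\<bar> \<le> B"
    using fin bnd by (simp add: AE_finite_all)
  have sum_b: "\<bar>\<Sum>i\<in>J. \<xi> i \<omega>\<bar> \<le> b" if "J \<subseteq> I" "\<forall>i\<in>I. \<bar>\<xi> i \<omega>\<bar> \<le> B" for J \<omega>
  proof -
    have "\<bar>\<Sum>i\<in>J. \<xi> i \<omega>\<bar> \<le> (\<Sum>i\<in>J. B)" using that by (intro sum_abs[THEN order_trans] sum_mono) auto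
    also have "\<dots> \<le> b" using that fin B by (auto simp: b_def intro!: mult_right_mono card_mono)
    finally show ?thesis .
  qed
  have Wb: "\<bar>W \<omega>\<bar> \<le> b" if "\<forall>i\<in>I. \<bar>\<xi> i \<omega>\<bar> \<le> B" for \<omega>
    unfolding W_def by (rule sum_b[OF subset_refl that])
  \<comment> \<open>f and f' are not assumed bounded. W and all D_i stay in [-b, b] almost surely,
    and continuity on this compact interval makes the expectations below finite.\<close>
  have "compact (f ` {-b..b} \<union> f' ` {-b..b})"
    by (intro compact_Un compact_continuous_image continuous_on_subset[OF cf(1)] continuous_on_subset[OF cf(2)]) auto
  then obtain c where c: "\<forall>x\<in>f ` {-b..b} \<union> f' ` {-b..b}. norm x \<le> c"
    by (auto dest!: compact_imp_bounded simp: bounded_iff)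
  have c': "\<bar>f x\<bar> \<le> c" "\<bar>f' x\<bar> \<le> c" if "\<bar>x\<bar> \<le> b" for x
    using c that by (auto simp: abs_le_iff)
  have int_W: "integrable M (\<lambda>\<omega>. f' (W \<omega>))"
    by (rule integrable_const_bound[where B = c]) (use ae in \<open>auto elim!: eventually_mono intro!: c' Wb\<close>)
  define D where "D i = (\<lambda>\<omega>. \<Sum>j\<in>I-{i}. \<xi> j \<omega>)" for i
  have D: "W \<omega> = \<xi> i \<omega> + D i \<omega>" if "i \<in> I" for i \<omega>
    unfolding W_def D_def using that fin by (subst sum.remove[of I i]) auto
  have Dm[measurable]: "D i \<in> borel_measurable M" for i
    unfolding D_def using rv by auto
  have Db: "\<bar>D i \<omega>\<bar> \<le> b" if "\<forall>i\<in>I. \<bar>\<xi> i \<omega>\<bar> \<le> B" for i \<omega>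
    unfolding D_def by (rule sum_b[OF Diff_subset that])
  have c0: "0 \<le> c" using c'(1)[of 0] B by (simp add: b_def)
  have key: "integrable M (\<lambda>\<omega>. \<xi> i \<omega> * f (W \<omega>))"
    "\<bar>expectation (\<lambda>\<omega>. (\<xi> i \<omega>)\<^sup>2) * expectation (\<lambda>\<omega>. f' (W \<omega>)) - expectation (\<lambda>\<omega>. \<xi> i \<omega> * f (W \<omega>))\<bar>
      \<le> 2 * K * B * expectation (\<lambda>\<omega>. (\<xi> i \<omega>)\<^sup>2)" if i: "i \<in> I" for i
  proof -
    have [measurable]: "\<xi> i \<in> borel_measurable M" by (rule rv[OF i])
    have ind_i: "indep_var borel (\<xi> i) borel (D i)"
      unfolding D_def by (rule indep_vars_sum) (use fin i ind in \<open>auto simp: insert_absorb\<close>)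
    have i1: "integrable M (\<xi> i)"
      by (rule integrable_const_bound[where B = B]) (use bnd[OF i] in auto)
    have i2: "integrable M (\<lambda>\<omega>. (\<xi> i \<omega>)\<^sup>2)"
    proof (rule integrable_const_bound[where B = "B\<^sup>2"])
      have "x\<^sup>2 \<le> B\<^sup>2" if "\<bar>x\<bar> \<le> B" for x using power_mono[OF that, of 2] by simp
      then show "AE \<omega> in M. norm ((\<xi> i \<omega>)\<^sup>2) \<le> B\<^sup>2" using bnd[OF i] by (auto elim!: eventually_mono)
    qed simp
    have iD: "integrable M (\<lambda>\<omega>. f (D i \<omega>))" "integrable M (\<lambda>\<omega>. f' (D i \<omega>))"
      by (rule integrable_const_bound[where B = c], use ae in \<open>auto elim!: eventually_mono intro!: c' Db\<close>)+
    show iW: "integrable M (\<lambda>\<omega>. \<xi> i \<omega> * f (W \<omega>))"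
      by (rule integrable_const_bound[where B = "B * c"])
         (use ae i c0 B in \<open>auto simp: abs_mult elim!: eventually_mono intro!: mult_mono c' Wb\<close>)
    have ind1: "indep_var borel (\<xi> i) borel (\<lambda>\<omega>. f (D i \<omega>))"
      using indep_var_compose[OF ind_i, of id borel f borel] by (simp add: comp_def)
    have ind2: "indep_var borel (\<lambda>\<omega>. (\<xi> i \<omega>)\<^sup>2) borel (\<lambda>\<omega>. f' (D i \<omega>))"
      using indep_var_compose[OF ind_i, of "\<lambda>x. x\<^sup>2" borel f' borel] by (simp add: comp_def)
    have e1: "expectation (\<lambda>\<omega>. \<xi> i \<omega> * f (D i \<omega>)) = 0"
      by (subst indep_var_lebesgue_integral[OF ind1 i1 iD(1)]) (simp add: mean[OF i])
    have e2: "expectation (\<lambda>\<omega>. (\<xi> i \<omega>)\<^sup>2 * f' (D i \<omega>)) =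
        expectation (\<lambda>\<omega>. (\<xi> i \<omega>)\<^sup>2) * expectation (\<lambda>\<omega>. f' (D i \<omega>))"
      by (rule indep_var_lebesgue_integral[OF ind2 i2 iD(2)])
    note j1 = indep_var_integrable[OF ind1 i1 iD(1)] and j2 = indep_var_integrable[OF ind2 i2 iD(2)]
    have A1: "\<bar>expectation (\<lambda>\<omega>. f' (W \<omega>)) - expectation (\<lambda>\<omega>. f' (D i \<omega>))\<bar> \<le> K * B"
    proof -
      have "\<bar>expectation (\<lambda>\<omega>. f' (W \<omega>)) - expectation (\<lambda>\<omega>. f' (D i \<omega>))\<bar>
          = \<bar>expectation (\<lambda>\<omega>. f' (W \<omega>) - f' (D i \<omega>))\<bar>"
        using int_W iD by simp
      also have "\<dots> \<le> expectation (\<lambda>\<omega>. \<bar>f' (W \<omega>) - f' (D i \<omega>)\<bar>)" by (rule integral_abs_bound)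
      also have "\<dots> \<le> expectation (\<lambda>\<omega>. K * B)"
      proof (rule integral_mono_AE)
        show "AE \<omega> in M. \<bar>f' (W \<omega>) - f' (D i \<omega>)\<bar> \<le> K * B"
          using bnd[OF i]
        proof (rule eventually_mono)
          fix \<omega> assume a: "\<bar>\<xi> i \<omega>\<bar> \<le> B"
          have "norm (f' (W \<omega>) - f' (D i \<omega>)) \<le> K * norm (W \<omega> - D i \<omega>)"
            by (rule field_differentiable_bound[of UNIV _ f'']) (use f' f'' in auto)
          also have "\<dots> \<le> K * B" using a D[OF i, of \<omega>] K by (intro mult_left_mono) auto
          finally show "\<bar>f' (W \<omega>) - f' (D i \<omega>)\<bar> \<le> K * B" by simp
        qed
      qed (use int_W iD in auto)
      finally show ?thesis by (simp add: prob_space)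
    qed
    have A2: "\<bar>expectation (\<lambda>\<omega>. \<xi> i \<omega> * f (W \<omega>)) - expectation (\<lambda>\<omega>. (\<xi> i \<omega>)\<^sup>2 * f' (D i \<omega>))\<bar>
        \<le> K * B * expectation (\<lambda>\<omega>. (\<xi> i \<omega>)\<^sup>2)"
    proof -
      have "\<bar>expectation (\<lambda>\<omega>. \<xi> i \<omega> * f (W \<omega>)) - expectation (\<lambda>\<omega>. (\<xi> i \<omega>)\<^sup>2 * f' (D i \<omega>))\<bar>
          = \<bar>expectation (\<lambda>\<omega>. \<xi> i \<omega> * f (W \<omega>) - \<xi> i \<omega> * f (D i \<omega>) - (\<xi> i \<omega>)\<^sup>2 * f' (D i \<omega>))\<bar>"
        using iW j1 j2 e1 by simp
      also have "\<dots> \<le> expectation (\<lambda>\<omega>. \<bar>\<xi> i \<omega> * f (W \<omega>) - \<xi> i \<omega> * f (D i \<omega>) - (\<xi> i \<omega>)\<^sup>2 * f' (D i \<omega>)\<bar>)"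
        by (rule integral_abs_bound)
      also have "\<dots> \<le> expectation (\<lambda>\<omega>. K * B * (\<xi> i \<omega>)\<^sup>2)"
      proof (rule integral_mono_AE)
        show "AE \<omega> in M. \<bar>\<xi> i \<omega> * f (W \<omega>) - \<xi> i \<omega> * f (D i \<omega>) - (\<xi> i \<omega>)\<^sup>2 * f' (D i \<omega>)\<bar> \<le> K * B * (\<xi> i \<omega>)\<^sup>2"
          using bnd[OF i]
        proof (rule eventually_mono)
          fix \<omega> assume a: "\<bar>\<xi> i \<omega>\<bar> \<le> B"
          define x d where "x = \<xi> i \<omega>" and "d = D i \<omega>"
          \<comment> \<open>The intermediate point is written as d + z with |z| \<le> |x|, a form
            common to both signs of x and trivial at x = 0.\<close>
          have "\<exists>z. \<bar>z\<bar> \<le> \<bar>x\<bar> \<and> f (x + d) - f d = x * f' (d + z)"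
          proof (cases x "0 :: real" rule: linorder_cases)
            case less
            obtain z where "x + d < z" "z < d" "f d - f (x + d) = (d - (x + d)) * f' z"
              using MVT2[of "x + d" d f f'] f less by auto
            then show ?thesis using less by (intro exI[of _ "z - d"]) (auto simp: algebra_simps)
          next
            case greater
            obtain z where "d < z" "z < x + d" "f (x + d) - f d = ((x + d) - d) * f' z"
              using MVT2[of d "x + d" f f'] f greater by auto
            then show ?thesis using greater by (intro exI[of _ "z - d"]) (auto simp: algebra_simps)
          qed auto
          then obtain z where z: "\<bar>z\<bar> \<le> \<bar>x\<bar>" "f (x + d) - f d = x * f' (d + z)" by blast
          have "norm (f' (d + z) - f' d) \<le> K * norm (d + z - d)"
            by (rule field_differentiable_bound[of UNIV _ f'']) (use f' f'' in auto)
          also have "\<dots> \<le> K * B" using z a K unfolding x_def by (intro mult_left_mono) auto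
          finally have "x\<^sup>2 * \<bar>f' (d + z) - f' d\<bar> \<le> x\<^sup>2 * (K * B)" by (intro mult_left_mono) auto
          moreover have "x * f (x + d) - x * f d - x\<^sup>2 * f' d = x\<^sup>2 * (f' (d + z) - f' d)"
          proof -
            have "x * f (x + d) - x * f d - x\<^sup>2 * f' d = x * (f (x + d) - f d) - x\<^sup>2 * f' d"
              by (simp add: algebra_simps)
            then show ?thesis unfolding z(2) by (simp add: algebra_simps power2_eq_square)
          qed
          ultimately show "\<bar>\<xi> i \<omega> * f (W \<omega>) - \<xi> i \<omega> * f (D i \<omega>) - (\<xi> i \<omega>)\<^sup>2 * f' (D i \<omega>)\<bar> \<le> K * B * (\<xi> i \<omega>)\<^sup>2"
            unfolding D[OF i] x_def d_def by (simp add: abs_mult ac_simps)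
        qed
      qed (use iW i2 j1 j2 in auto)
      finally show ?thesis by simp
    qed
    have ee: "0 \<le> expectation (\<lambda>\<omega>. (\<xi> i \<omega>)\<^sup>2)" by simp
    have "\<bar>expectation (\<lambda>\<omega>. (\<xi> i \<omega>)\<^sup>2) * (expectation (\<lambda>\<omega>. f' (W \<omega>)) - expectation (\<lambda>\<omega>. f' (D i \<omega>)))\<bar>
       \<le> expectation (\<lambda>\<omega>. (\<xi> i \<omega>)\<^sup>2) * (K * B)"
      unfolding abs_mult using A1 ee by (simp add: mult_left_mono)
    then show "\<bar>expectation (\<lambda>\<omega>. (\<xi> i \<omega>)\<^sup>2) * expectation (\<lambda>\<omega>. f' (W \<omega>)) - expectation (\<lambda>\<omega>. \<xi> i \<omega> * f (W \<omega>))\<bar>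
      \<le> 2 * K * B * expectation (\<lambda>\<omega>. (\<xi> i \<omega>)\<^sup>2)"
      using A2 unfolding e2 by (simp add: algebra_simps abs_if split: if_splits)
  qed
  have Wf: "W \<omega> * f (W \<omega>) = (\<Sum>i\<in>I. \<xi> i \<omega> * f (W \<omega>))" for \<omega>
    by (subst W_def) (simp add: sum_distrib_right)
  have "expectation (\<lambda>\<omega>. f' (W \<omega>) - W \<omega> * f (W \<omega>)) =
      expectation (\<lambda>\<omega>. f' (W \<omega>)) - (\<Sum>i\<in>I. expectation (\<lambda>\<omega>. \<xi> i \<omega> * f (W \<omega>)))"
    unfolding Wf using int_W key(1) by (subst Bochner_Integration.integral_diff) auto
  also have "\<dots> = (\<Sum>i\<in>I. expectation (\<lambda>\<omega>. (\<xi> i \<omega>)\<^sup>2) * expectation (\<lambda>\<omega>. f' (W \<omega>)) - expectation (\<lambda>\<omega>. \<xi> i \<omega> * f (W \<omega>)))"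
    unfolding sum_subtractf sum_distrib_right[symmetric] var by simp
  also have "\<bar>\<dots>\<bar> \<le> (\<Sum>i\<in>I. 2 * K * B * expectation (\<lambda>\<omega>. (\<xi> i \<omega>)\<^sup>2))"
    by (rule order_trans[OF sum_abs]) (intro sum_mono key(2))
  also have "\<dots> = 2 * K * B" unfolding sum_distrib_left[symmetric] var by simp
  finally show ?thesis .
qed

text \<open>The witness is the average of \<open>h\<close> over \<open>[x, x + \<epsilon>]\<close>.\<close>

lemma lipschitz_1_smooth_approx:
  fixes h :: "real \<Rightarrow> real"
  assumes h: "1-lipschitz_on UNIV h" and \<epsilon>: "\<epsilon> > 0"
  obtains g g' where "\<And>x. (g has_real_derivative g' x) (at x)" "\<And>x. \<bar>g' x\<bar> \<le> 1"
    "\<And>x. \<bar>g x - h x\<bar> \<le> \<epsilon>"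
proof -
  have ch: "continuous_on UNIV h" by (rule lipschitz_on_continuous_on[OF h])
  obtain H where H: "\<And>x. (H has_real_derivative h x) (at x)"
    using einterval_antiderivative[of "-\<infinity>" "\<infinity>" h] ch
    by (auto simp: continuous_on_eq_continuous_at has_real_derivative_iff_has_vector_derivative)
  show ?thesis
  proof (rule that[of "\<lambda>x. (H (x + \<epsilon>) - H x) / \<epsilon>" "\<lambda>x. (h (x + \<epsilon>) - h x) / \<epsilon>"])
    fix x
    have "((\<lambda>x. H (x + \<epsilon>)) has_real_derivative h (x + \<epsilon>)) (at x)"
      using H[of "x + \<epsilon>"] by (simp add: DERIV_shift)
    then show "((\<lambda>x. (H (x + \<epsilon>) - H x) / \<epsilon>) has_real_derivative (h (x + \<epsilon>) - h x) / \<epsilon>) (at x)"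
      using \<epsilon> by (auto intro!: derivative_eq_intros H)
    show "\<bar>(h (x + \<epsilon>) - h x) / \<epsilon>\<bar> \<le> 1"
      using lipschitz_1_abs_le[OF h, of "x + \<epsilon>" x] \<epsilon> by (simp add: field_simps)
    obtain z where z: "x < z" "z < x + \<epsilon>" "H (x + \<epsilon>) - H x = (x + \<epsilon> - x) * h z"
      using MVT2[of x "x + \<epsilon>" H h] H \<epsilon> by auto
    then have "(H (x + \<epsilon>) - H x) / \<epsilon> = h z" using \<epsilon> by simp
    then show "\<bar>(H (x + \<epsilon>) - H x) / \<epsilon> - h x\<bar> \<le> \<epsilon>"
      using lipschitz_1_abs_le[OF h, of z x] z by simp
  qed
qed

text \<open>The Stein solution is controlled for differentiable test functions only. An
  approximation within e / 2 in sup norm changes each of the two expectations by at most e / 2, and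
  e is arbitrary.\<close>

theorem (in prob_space) stein_lipschitz_bound:
  fixes \<xi> :: "'i \<Rightarrow> 'a \<Rightarrow> real"
  assumes fin: "finite I" and ind: "indep_vars (\<lambda>_. borel) \<xi> I"
    and bnd: "\<And>i. i \<in> I \<Longrightarrow> AE \<omega> in M. \<bar>\<xi> i \<omega>\<bar> \<le> B" and B: "0 \<le> B"
    and mean: "\<And>i. i \<in> I \<Longrightarrow> expectation (\<xi> i) = 0"
    and var: "(\<Sum>i\<in>I. expectation (\<lambda>\<omega>. (\<xi> i \<omega>)\<^sup>2)) = 1"
    and h: "1-lipschitz_on UNIV h"
  shows "\<bar>expectation (\<lambda>\<omega>. h (\<Sum>i\<in>I. \<xi> i \<omega>)) - normal_mean h\<bar> \<le> 2 * stein_const * B"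
proof (rule field_le_epsilon)
  fix e :: real assume e: "0 < e"
  define W where "W \<omega> = (\<Sum>i\<in>I. \<xi> i \<omega>)" for \<omega>
  obtain g g' where g: "\<And>x. (g has_real_derivative g' x) (at x)" "\<And>x. \<bar>g' x\<bar> \<le> 1"
    and gh: "\<And>x. \<bar>g x - h x\<bar> \<le> e / 2"
    using lipschitz_1_smooth_approx[OF h, of "e / 2"] e by auto
  obtain f f' f'' where f: "\<And>x. (f has_real_derivative f' x) (at x)"
    "\<And>x. (f' has_real_derivative f'' x) (at x)" "\<And>x. \<bar>f'' x\<bar> \<le> stein_const"
    "\<And>x. f' x - x * f x = g x - normal_mean g"
    using stein_solution[OF g] by blast
  have gl: "1-lipschitz_on UNIV g"
  proof (rule lipschitz_onI)
    show "dist (g x) (g y) \<le> 1 * dist x y" for x y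
      using field_differentiable_bound[of UNIV g g' 1 x y] g
      by (simp add: dist_norm)
  qed simp
  have rv: "\<xi> i \<in> borel_measurable M" if "i \<in> I" for i
    using ind that by (auto simp: indep_vars_def)
  have iW: "integrable M W"
    unfolding W_def using bnd rv by (intro Bochner_Integration.integrable_sum integrable_const_bound[where B = B]) auto
  \<comment> \<open>Stated for an arbitrary space because it is applied both to W on
    \<open>M\<close> and to the identity under the normal law.\<close>
  have close: "\<bar>integral\<^sup>L N (\<lambda>x. h (Y x)) - integral\<^sup>L N (\<lambda>x. g (Y x))\<bar> \<le> e / 2"
    if N: "prob_space N" and Y: "integrable N (Y :: _ \<Rightarrow> real)" for N :: "'c measure" and Y
  proof -
    interpret N: prob_space N by fact
    note i = N.integrable_lipschitz[OF h Y] N.integrable_lipschitz[OF gl Y]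
    have "\<bar>integral\<^sup>L N (\<lambda>x. h (Y x)) - integral\<^sup>L N (\<lambda>x. g (Y x))\<bar> = \<bar>integral\<^sup>L N (\<lambda>x. h (Y x) - g (Y x))\<bar>"
      using i by simp
    also have "\<dots> \<le> integral\<^sup>L N (\<lambda>x. \<bar>h (Y x) - g (Y x)\<bar>)" by (rule integral_abs_bound)
    also have "\<dots> \<le> integral\<^sup>L N (\<lambda>x. e / 2)"
      using i gh by (intro integral_mono) (auto simp: abs_minus_commute)
    finally show ?thesis by (simp add: N.prob_space)
  qed
  have iN: "integrable std_normal_distribution (\<lambda>x. x :: real)"
    using integrable_std_normal_abs by (subst (asm) integrable_abs_iff) auto
  have "\<bar>expectation (\<lambda>\<omega>. g (W \<omega>)) - normal_mean g\<bar> = \<bar>expectation (\<lambda>\<omega>. f' (W \<omega>) - W \<omega> * f (W \<omega>))\<bar>"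
    unfolding f using integrable_lipschitz[OF gl iW] by (simp add: prob_space)
  also have "\<dots> \<le> 2 * stein_const * B"
    unfolding W_def by (rule stein_sum_bound[OF fin ind bnd B mean var f(1-3)])
  finally have "\<bar>expectation (\<lambda>\<omega>. g (W \<omega>)) - normal_mean g\<bar> \<le> 2 * stein_const * B" .
  then show "\<bar>expectation (\<lambda>\<omega>. h (\<Sum>i\<in>I. \<xi> i \<omega>)) - normal_mean h\<bar> \<le> 2 * stein_const * B + e"
    using close[OF prob_space_axioms iW]
      close[OF prob_space_normal_density[of 1 0] iN]
    unfolding W_def[symmetric] by (simp add: abs_if split: if_splits)
qed

section \<open>Asymptotics of mean and variance\<close>

definition dilog :: "real \<Rightarrow> real" where
  "dilog x = (\<Sum>n. x ^ Suc n / real (Suc n)^2)"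

lemma dilog_0 [simp]: "dilog 0 = 0"
  by (simp add: dilog_def)

lemma dilog_1: "dilog 1 = pi\<^sup>2 / 6"
  using inverse_squares_sums by (simp add: dilog_def sums_iff add.commute)

lemma continuous_on_dilog: "continuous_on {-1..1} dilog"
proof -
  have "uniform_limit {-1..1} (\<lambda>n x. \<Sum>i<n. x ^ Suc i / real (Suc i)^2) dilog sequentially"
    unfolding dilog_def
  proof (rule Weierstrass_m_test)
    show "summable (\<lambda>n. 1 / real (Suc n)^2)"
      using inverse_squares_sums by (simp add: sums_iff add.commute)
    show "norm (x ^ Suc n / real (Suc n)^2) \<le> 1 / real (Suc n)^2" if "x \<in> {-1..1}" for n x
      using that power_le_one[of "\<bar>x\<bar>" "Suc n"]
      by (auto simp: norm_divide power_abs intro!: divide_right_mono simp del: power_Suc of_nat_Suc)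
  qed
  then show ?thesis
    by (rule uniform_limit_theorem[rotated]) (auto intro!: always_eventually continuous_intros)
qed

text \<open>Termwise differentiation. At x = 0 the quotient would take the default value 0, whereas
  the derivative is 1.\<close>

lemma dilog_has_derivative:
  assumes "\<bar>x\<bar> < 1" "x \<noteq> 0"
  shows "(dilog has_real_derivative - ln (1 - x) / x) (at x)"
proof -
  define c where "c n = (if n = 0 then 0 else 1 / (real n)\<^sup>2)" for n :: nat
  have sm: "summable (\<lambda>n. c n * y ^ n)" if "\<bar>y\<bar> < 1" for y
  proof (rule summable_comparison_test)
    show "\<exists>N. \<forall>n\<ge>N. norm (c n * y ^ n) \<le> \<bar>y\<bar> ^ n"
    proof (intro exI allI impI)
      fix n :: nat assume "n \<ge> 0"
      have "\<bar>c n\<bar> \<le> 1" by (cases n) (auto simp: c_def field_simps)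
      then have "\<bar>c n\<bar> * \<bar>y\<bar> ^ n \<le> 1 * \<bar>y\<bar> ^ n" by (intro mult_right_mono) auto
      then show "norm (c n * y ^ n) \<le> \<bar>y\<bar> ^ n" by (simp add: abs_mult power_abs)
    qed
  qed (use that in \<open>simp add: summable_geometric\<close>)
  have eq: "dilog y = (\<Sum>n. c n * y ^ n)" if "\<bar>y\<bar> < 1" for y
    using suminf_split_head[OF sm[OF that]] by (simp add: dilog_def c_def)
  have d: "((\<lambda>y. \<Sum>n. c n * y ^ n) has_real_derivative (\<Sum>n. diffs c n * x ^ n)) (at x)"
    by (rule termdiffs_strong'[of 1]) (use sm assms in auto)
  have diffs_eq: "(\<lambda>n. diffs c n * x ^ n) = (\<lambda>n. (x ^ Suc n / real (Suc n)) / x)"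
    using assms by (auto simp: diffs_def c_def fun_eq_iff power2_eq_square)
  have "(\<lambda>n. - (x ^ n / real n)) sums ln (1 - x)"
    using ln_series'[of "- x"] assms by simp
  from sums_minus[OF this] have "(\<lambda>n. x ^ n / real n) sums (- ln (1 - x))" by simp
  then have "(\<lambda>n. x ^ Suc n / real (Suc n)) sums (- ln (1 - x))" by (subst sums_Suc_iff) simp
  from sums_divide[OF this, of x] have "((\<lambda>y. \<Sum>n. c n * y ^ n) has_real_derivative - ln (1 - x) / x) (at x)"
    using d unfolding diffs_eq by (simp add: sums_iff)
  moreover have "\<forall>\<^sub>F y in nhds x. dilog y = (\<Sum>n. c n * y ^ n)"
    using assms eq by (intro eventually_nhds_in_open[of "{-1<..<1}" x, THEN eventually_mono]) auto
  ultimately show ?thesis by (subst DERIV_cong_ev[OF refl _ refl]) auto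
qed

text \<open>Euler's reflection: \<open>dilog x + dilog (1 - x) + ln x * ln (1 - x)\<close> has derivative \<open>0\<close>.\<close>

lemma dilog_half: "dilog (1 / 2) = pi\<^sup>2 / 12 - (ln 2)\<^sup>2 / 2"
proof -
  define J where "J x = dilog x + dilog (1 - x) + ln x * ln (1 - x)" for x
  have d: "(J has_real_derivative 0) (at x)" if "0 < x" "x < 1" for x
  proof -
    have "((\<lambda>x. dilog (1 - x)) has_real_derivative (- ln (1 - (1 - x)) / (1 - x)) * (- 1)) (at x)"
      by (rule DERIV_chain'[of "\<lambda>x. 1 - x" _ _ _ dilog])
         (use that dilog_has_derivative[of "1 - x"] in \<open>auto intro!: derivative_eq_intros\<close>)
    then show ?thesis unfolding J_def[abs_def] using that
      by (auto intro!: derivative_eq_intros dilog_has_derivative simp: divide_simps)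
  qed
  have c: "J x = J (1 / 2)" if "0 < x" "x < 1" for x
    by (rule DERIV_zero_connected_constant[of "{0<..<1}" "{}" J])
       (use that d in \<open>auto intro!: continuous_at_imp_continuous_on DERIV_isCont[OF d]\<close>)
  have c1: "((\<lambda>x. dilog x) \<longlongrightarrow> dilog 0) (at_right 0)"
    by (rule continuous_on_Icc_at_rightD[OF continuous_on_subset[OF continuous_on_dilog, of "{0..1}"]]) auto
  have c2: "(dilog \<longlongrightarrow> dilog 1) (at_left 1)"
    by (rule continuous_on_Icc_at_leftD[OF continuous_on_subset[OF continuous_on_dilog, of "{0..1}"]]) auto
  have c2': "((\<lambda>x. dilog (1 - x)) \<longlongrightarrow> dilog 1) (at_right 0)"
    by (rule filterlim_compose[OF c2]) real_asymp
  have c3: "((\<lambda>x::real. ln x * ln (1 - x)) \<longlongrightarrow> 0) (at_right 0)" by real_asymp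
  \<comment> \<open>The constant value of \<open>J\<close> is its limit at 0 from the right, pi^2/6;
    at 1/2 the same function equals 2 dilog(1/2) + (ln 2)^2.\<close>
  have "(J \<longlongrightarrow> dilog 0 + dilog 1 + 0) (at_right 0)"
    unfolding J_def[abs_def] by (intro tendsto_intros c1 c2' c3)
  moreover have "\<forall>\<^sub>F x in at_right 0. J x = J (1 / 2)"
    using eventually_at_right_real[OF zero_less_one] by (rule eventually_mono) (auto intro: c)
  then have "(J \<longlongrightarrow> J (1 / 2)) (at_right 0)" by (rule tendsto_eventually)
  ultimately have "J (1 / 2) = pi\<^sup>2 / 6"
    using tendsto_unique[OF trivial_limit_at_right_real] by (fastforce simp: dilog_1)
  then show ?thesis by (simp add: J_def ln_div power2_eq_square field_simps)
qed

text \<open>On each cell the mean value theorem turns the increment of F into g(z) / N, so only the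
  oscillation of g within cells counts. Differentiability is asked for in the open interval alone,
  since the derivative formulas used later fail or degenerate at endpoints. The upper limit m / N is
  independent of the mesh 1 / N because inner sums stop early.\<close>

lemma riemann_sum_error:
  fixes F g :: "real \<Rightarrow> real"
  assumes N: "N > 0" and F: "continuous_on {0..real m / real N} F"
    and dF: "\<And>x. 0 < x \<Longrightarrow> x < real m / real N \<Longrightarrow> (F has_real_derivative g x) (at x)"
    and close: "\<And>k x. k < m \<Longrightarrow> real k / real N < x \<Longrightarrow> x < real (Suc k) / real N \<Longrightarrow> \<bar>g (real k / real N) - g x\<bar> \<le> \<epsilon>"
  shows "\<bar>(\<Sum>k<m. g (real k / real N)) / real N - (F (real m / real N) - F 0)\<bar> \<le> \<epsilon> * real m / real N"
proof -
  let ?x = "\<lambda>k. real k / real N"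
  have step: "\<bar>g (?x k) / real N - (F (?x (Suc k)) - F (?x k))\<bar> \<le> \<epsilon> / real N" if k: "k < m" for k
  proof -
    have le: "?x k < ?x (Suc k)" "?x (Suc k) \<le> ?x m" using N k by (auto intro!: divide_strict_right_mono divide_right_mono)
    have "\<exists>l z. ?x k < z \<and> z < ?x (Suc k) \<and> (F has_real_derivative l) (at z) \<and> F (?x (Suc k)) - F (?x k) = (?x (Suc k) - ?x k) * l"
    proof (rule MVT[OF le(1)])
      show "continuous_on {?x k..?x (Suc k)} F"
        by (rule continuous_on_subset[OF F]) (use le N in auto)
      fix x assume x: "?x k < x" "x < ?x (Suc k)"
      have "0 \<le> ?x k" by simp
      with x le have "0 < x" "x < ?x m" by linarith+
      then show "F differentiable (at x)" using dF by (auto simp: real_differentiable_def)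
    qed
    then obtain l z where z: "?x k < z" "z < ?x (Suc k)" "(F has_real_derivative l) (at z)"
      "F (?x (Suc k)) - F (?x k) = (?x (Suc k) - ?x k) * l" by blast
    have "0 \<le> ?x k" by simp
    with z le have "0 < z" "z < ?x m" by linarith+
    then have "l = g z" using DERIV_unique[OF z(3) dF] by simp
    moreover have "?x (Suc k) - ?x k = 1 / real N" by (simp add: diff_divide_distrib[symmetric])
    ultimately have "g (?x k) / real N - (F (?x (Suc k)) - F (?x k)) = (g (?x k) - g z) / real N"
      using z(4) by (simp add: diff_divide_distrib)
    also have "\<bar>\<dots>\<bar> \<le> \<epsilon> / real N" using close[OF k z(1,2)] N by (simp add: divide_right_mono)
    finally show ?thesis .
  qed
  have "(\<Sum>k<m. g (?x k)) / real N - (F (?x m) - F 0) = (\<Sum>k<m. g (?x k) / real N - (F (?x (Suc k)) - F (?x k)))"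
    by (subst sum_subtractf, subst sum_lessThan_telescope) (simp add: sum_divide_distrib)
  also have "\<bar>\<dots>\<bar> \<le> (\<Sum>k<m. \<epsilon> / real N)"
    by (intro sum_abs[THEN order_trans] sum_mono step) auto
  finally show ?thesis by (simp add: mult.commute)
qed

text \<open>i / (i + j) is the probability that Z_i > Z_j. The inner sum is j times a Riemann sum of
  the 1-Lipschitz function x / (1 + x), whose integral over [0, 1] is 1 - ln 2; each j contributes
  an error of at most 1. The rest of the error is (1 - ln 2) n / 2, from the sum of the j being
  n^2/2 + n/2.\<close>

lemma mean_asymptotics:
  "\<bar>(\<Sum>j=1..n. \<Sum>i=1..<j. real i / (real i + real j)) - (1 - ln 2) / 2 * (real n)\<^sup>2\<bar> \<le> 2 * real n"
proof -
  have lip: "\<bar>y / (1 + y) - x / (1 + x)\<bar> \<le> x - y" if "0 \<le> y" "y < x" for x y :: real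
  proof -
    have "x / (1 + x) - y / (1 + y) = (x - y) / ((1 + x) * (1 + y))" using that by (simp add: field_simps)
    moreover have "1 * 1 \<le> (1 + x) * (1 + y)" using that by (intro mult_mono) auto
    then have "(x - y) / ((1 + x) * (1 + y)) \<le> (x - y) / 1"
      using that by (intro divide_left_mono) auto
    moreover have "0 \<le> (x - y) / ((1 + x) * (1 + y))" using that by simp
    ultimately have "\<bar>y / (1 + y) - x / (1 + x)\<bar> \<le> (x - y) / 1"
      by (metis abs_minus_commute abs_of_nonneg)
    then show ?thesis by simp
  qed
  have inner: "\<bar>(\<Sum>i=1..<j. real i / (real i + real j)) - real j * (1 - ln 2)\<bar> \<le> 1" if j: "j \<ge> 1" for j
  proof -
    let ?g = "\<lambda>x::real. x / (1 + x)" and ?F = "\<lambda>x::real. x - ln (1 + x)"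
    have "\<bar>(\<Sum>k<j. ?g (real k / real j)) / real j - (?F (real j / real j) - ?F 0)\<bar> \<le> (1 / real j) * real j / real j"
    proof (rule riemann_sum_error)
      show "continuous_on {0..real j / real j} ?F" by (intro continuous_intros) auto
      show "(?F has_real_derivative ?g x) (at x)" if "0 < x" for x
        using that by (auto intro!: derivative_eq_intros simp: field_simps)
      show "\<bar>?g (real k / real j) - ?g x\<bar> \<le> 1 / real j" if x: "real k / real j < x" "x < real (Suc k) / real j" for k x
      proof -
        have "\<bar>?g (real k / real j) - ?g x\<bar> \<le> x - real k / real j" by (rule lip) (use x in auto)
        also have "\<dots> \<le> 1 / real j" using x j by (simp add: add_divide_distrib)
        finally show ?thesis .
      qed
    qed (use j in auto)
    moreover have "(\<Sum>k<j. ?g (real k / real j)) = (\<Sum>i=1..<j. real i / (real i + real j))"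
      using j by (intro sum.mono_neutral_cong_right) (auto simp: field_simps)
    ultimately have "\<bar>(\<Sum>i=1..<j. real i / (real i + real j)) / real j - (1 - ln 2)\<bar> \<le> 1 / real j" using j by simp
    then have "\<bar>(\<Sum>i=1..<j. real i / (real i + real j)) / real j - (1 - ln 2)\<bar> * real j \<le> 1" using j by (simp add: field_simps)
    moreover have "\<bar>a / real j - b\<bar> * real j = \<bar>a - real j * b\<bar>" for a b
      using j by (simp add: abs_mult_pos[symmetric] field_simps)
    ultimately show ?thesis by simp
  qed
  have s: "(\<Sum>j=1..n. real j) = (real n)\<^sup>2 / 2 + real n / 2"
    by (induction n) (auto simp: power2_eq_square field_simps)
  have "(\<Sum>j=1..n. \<Sum>i=1..<j. real i / (real i + real j)) - (1 - ln 2) * (\<Sum>j=1..n. real j)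
     = (\<Sum>j=1..n. (\<Sum>i=1..<j. real i / (real i + real j)) - real j * (1 - ln 2))"
    by (simp add: sum_subtractf sum_distrib_left mult.commute)
  also have "\<bar>\<dots>\<bar> \<le> (\<Sum>j=1..n. 1)"
    by (intro sum_abs[THEN order_trans] sum_mono inner) auto
  also have "\<dots> = real n" by simp
  finally have 1: "\<bar>(\<Sum>j=1..n. \<Sum>i=1..<j. real i / (real i + real j)) - (1 - ln 2) * ((real n)\<^sup>2 / 2 + real n / 2)\<bar> \<le> real n"
    unfolding s .
  have "0 \<le> ln (2::real)" "ln (2::real) \<le> 1" using ln_2_less_1 by auto
  then have "\<bar>(1 - ln 2) * (real n / 2)\<bar> \<le> 1 * (real n / 2)" unfolding abs_mult by (intro mult_mono) auto
  moreover have "(1 - ln 2) * ((real n)\<^sup>2 / 2 + real n / 2) = (1 - ln 2) / 2 * (real n)\<^sup>2 + (1 - ln 2) * (real n / 2)"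
    by (simp add: algebra_simps)
  ultimately show ?thesis using 1 by linarith
qed

section \<open>The limit constant as an integral of the increment density\<close>

definition limit_var :: real where
  "limit_var = 1/3 - pi^2/18 + 2 * ln 2 / 3 - ln 3 / 2 + 2 * (ln 2)^2 / 3"

text \<open>Equals \<open>2 * incr_kernel m j k\<close> at a = j / m, b = k / m for 0 < j < k. The
  factor 2 folds the symmetric double sum onto j < k.\<close>

definition incr_density :: "real \<Rightarrow> real \<Rightarrow> real" where
  "incr_density a b = 4 * a * b\<^sup>2 / ((1 + a) * (1 + b) * (1 + a + b) * (a + b))"

text \<open>The integral of \<open>incr_density a b\<close> over \<open>0 \<le> a \<le> b\<close>, for \<open>0 < b < 1\<close>.\<close>

definition incr_density_integral :: "real \<Rightarrow> real" where
  "incr_density_integral b = 4 * (b * (ln (1 + b) - ln 2) / (1 - b\<^sup>2) + b * ln 2 - b * ln (1 + 2 * b) + b * ln (1 + b))"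

text \<open>One of the two factors b goes into u = a b / (a + b), which stays bounded by 1 and
  1-Lipschitz although 1 / (a + b) is singular at the origin; this makes the constant uniform in b.
  The factors v and w have the same two bounds and the prefactor is at most 4, hence 12 = 4 *
  3.\<close>

lemma incr_density_lipschitz:
  assumes b: "0 < b" "b \<le> 1" and a: "0 \<le> a" "a \<le> a'"
  shows "\<bar>incr_density a b - incr_density a' b\<bar> \<le> 12 * (a' - a)"
proof -
  define u v w where "u a = b * a / (a + b)" and "v a = 1 / (1 + a)" and "w a = 1 / (1 + a + b)" for a :: real
  have P: "incr_density a b = 4 * (b / (1 + b)) * (u a * (v a * w a))" if "0 \<le> a" for a
    using b that by (simp add: incr_density_def u_def v_def w_def power2_eq_square mult_ac)
  have pr: "\<bar>x * y - x' * y'\<bar> \<le> \<bar>x - x'\<bar> + \<bar>y - y'\<bar>" if "\<bar>y\<bar> \<le> 1" "\<bar>x'\<bar> \<le> 1" for x y x' y' :: real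
  proof -
    have "x * y - x' * y' = (x - x') * y + x' * (y - y')" by (simp add: algebra_simps)
    also have "\<bar>\<dots>\<bar> \<le> \<bar>x - x'\<bar> * \<bar>y\<bar> + \<bar>x'\<bar> * \<bar>y - y'\<bar>" by (metis abs_mult abs_triangle_ineq)
    also have "\<dots> \<le> \<bar>x - x'\<bar> * 1 + 1 * \<bar>y - y'\<bar>" by (intro add_mono mult_mono that) auto
    finally show ?thesis by simp
  qed
  have uv: "\<bar>u a\<bar> \<le> 1" "\<bar>v a\<bar> \<le> 1" "\<bar>w a\<bar> \<le> 1" if "0 \<le> a" for a
  proof -
    have "b * a \<le> 1 * (a + b)" using b that by (simp add: add_increasing2 mult_left_le_one_le)
    then show "\<bar>u a\<bar> \<le> 1" "\<bar>v a\<bar> \<le> 1" "\<bar>w a\<bar> \<le> 1" using b that by (auto simp: u_def v_def w_def field_simps)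
  qed
  have a': "0 \<le> a'" using a by simp
  have quot: "\<bar>p / q\<bar> \<le> p" if "0 \<le> p" "1 \<le> q" for p q :: real
    using that mult_left_mono[of 1 q p] by (simp add: field_simps)
  have u: "\<bar>u a - u a'\<bar> \<le> a' - a"
  proof -
    define c where "c = b * b / ((a + b) * (a' + b))"
    have "b * b \<le> (a + b) * (a' + b)" using a b a' by (intro mult_mono) auto
    then have "0 \<le> c" "c \<le> 1" using a b a' by (auto simp: c_def divide_le_eq_1)
    moreover have "u a' - u a = (a' - a) * c"
      using a b a' by (simp add: u_def c_def field_simps)
    ultimately have "0 \<le> u a' - u a" "u a' - u a \<le> a' - a"
      using a mult_left_mono[of c 1 "a' - a"] by auto
    then show ?thesis by simp
  qed
  have v: "\<bar>v a - v a'\<bar> \<le> a' - a"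
  proof -
    have "v a - v a' = (a' - a) / ((1 + a) * (1 + a'))" using a a' by (simp add: v_def field_simps)
    moreover have "1 * 1 \<le> (1 + a) * (1 + a')" using a a' by (intro mult_mono) auto
    ultimately show ?thesis using quot a by simp
  qed
  have w: "\<bar>w a - w a'\<bar> \<le> a' - a"
  proof -
    have "w a - w a' = (a' - a) / ((1 + a + b) * (1 + a' + b))" using a a' b by (simp add: w_def field_simps)
    moreover have "1 * 1 \<le> (1 + a + b) * (1 + a' + b)" using a a' b by (intro mult_mono) auto
    ultimately show ?thesis using quot a by simp
  qed
  have s1: "\<bar>u a * (v a * w a) - u a' * (v a' * w a')\<bar> \<le> \<bar>u a - u a'\<bar> + \<bar>v a * w a - v a' * w a'\<bar>"
    using uv[OF a(1)] uv[OF a'] by (intro pr) (auto simp: abs_mult intro: mult_le_one)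
  have s2: "\<bar>v a * w a - v a' * w a'\<bar> \<le> \<bar>v a - v a'\<bar> + \<bar>w a - w a'\<bar>"
    using uv[OF a(1)] uv[OF a'] by (intro pr)
  have k: "\<bar>u a * (v a * w a) - u a' * (v a' * w a')\<bar> \<le> 3 * (a' - a)"
    using order_trans[OF s1 add_mono[OF u order_trans[OF s2 add_mono[OF v w]]]] by simp
  have "\<bar>incr_density a b - incr_density a' b\<bar> = 4 * (b / (1 + b)) * \<bar>u a * (v a * w a) - u a' * (v a' * w a')\<bar>"
    unfolding P[OF a(1)] P[OF a'] right_diff_distrib[symmetric] abs_mult using b by simp
  also have "\<dots> \<le> 4 * 1 * (3 * (a' - a))"
    using b k by (intro mult_mono) (auto simp: field_simps)
  finally show ?thesis by simp
qed

lemma incr_density_sum_error: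
  assumes k: "0 < k" "k < m"
  shows "\<bar>(\<Sum>j<k. incr_density (real j / real m) (real k / real m)) / real m - incr_density_integral (real k / real m)\<bar> \<le> 12 / real m"
proof -
  define b where "b = real k / real m"
  have b: "0 < b" "b < 1" using k by (auto simp: b_def)
  \<comment> \<open>The antiderivative in a, from the partial fractions of a / ((1 + a) (1 + a + b)
    (a + b)). Its coefficients have poles at b = 0 and b = 1, which 0 < k < m excludes.\<close>
  define F where "F a = 4 * b\<^sup>2 / (1 + b) * (ln (1 + a) / (b * (1 - b)) - (1 + b) / b * ln (1 + a + b) - b / (1 - b) * ln (a + b))" for a
  have "\<bar>(\<Sum>j<k. incr_density (real j / real m) b) / real m - (F (real k / real m) - F 0)\<bar> \<le> 12 * (1 / real m) * real k / real m"
  proof (rule riemann_sum_error)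
    show "continuous_on {0..real k / real m} F"
      unfolding F_def using b by (intro continuous_intros) auto
    show "(F has_real_derivative incr_density x b) (at x)" if x: "0 < x" for x
    proof -
      have "(F has_real_derivative 4 * b\<^sup>2 / (1 + b) * (1 / (1 + x) / (b * (1 - b)) - (1 + b) / b * (1 / (1 + x + b)) - b / (1 - b) * (1 / (x + b)))) (at x)"
        unfolding F_def[abs_def] using x b by (auto intro!: derivative_eq_intros simp: mult.commute)
      moreover have "1 / (1 + x) / (b * (1 - b)) - (1 + b) / b * (1 / (1 + x + b)) - b / (1 - b) * (1 / (x + b))
          = x / ((1 + x) * (1 + x + b) * (x + b))"
      proof -
        have nz: "1 + x \<noteq> 0" "b \<noteq> 0" "1 - b \<noteq> 0" "1 + x + b \<noteq> 0" "x + b \<noteq> 0" using x b by auto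
        show ?thesis using nz by (simp add: divide_simps) (simp add: algebra_simps power2_eq_square)
      qed
      moreover have "4 * b\<^sup>2 / (1 + b) * (x / ((1 + x) * (1 + x + b) * (x + b))) = incr_density x b"
        by (simp add: incr_density_def mult_ac)
      ultimately show ?thesis by (simp only:)
    qed
    show "\<bar>incr_density (real j / real m) b - incr_density x b\<bar> \<le> 12 * (1 / real m)"
      if "real j / real m < x" "x < real (Suc j) / real m" for j x
    proof -
      have "\<bar>incr_density (real j / real m) b - incr_density x b\<bar> \<le> 12 * (x - real j / real m)"
        using incr_density_lipschitz[of b "real j / real m" x] b that by simp
      also have "x - real j / real m \<le> 1 / real m" using that k by (simp add: add_divide_distrib)
      finally show ?thesis by simp
    qed
  qed (use k in auto)
  also have "12 * (1 / real m) * real k / real m \<le> 12 / real m" using k by (simp add: field_simps)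
  finally have 1: "\<bar>(\<Sum>j<k. incr_density (real j / real m) b) / real m - (F (real k / real m) - F 0)\<bar> \<le> 12 / real m" .
  have "ln (b + b) = ln 2 + ln b" using b ln_mult[of 2 b] by simp
  moreover have "ln (1 + b + b) = ln (1 + 2 * b)" by (simp add: algebra_simps)
  ultimately have "F b - F 0 = 4 * b\<^sup>2 / (1 + b) * (ln (1 + b) / (b * (1 - b)) - (1 + b) / b * (ln (1 + 2 * b) - ln (1 + b)) - b / (1 - b) * ln 2)"
    by (simp add: F_def algebra_simps)
  also have "\<dots> = incr_density_integral b"
  proof -
    have nz: "b \<noteq> 0" "1 - b \<noteq> 0" "1 + b \<noteq> 0" using b by auto
    have e: "1 - b\<^sup>2 = (1 - b) * (1 + b)" by (simp add: power2_eq_square algebra_simps)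
    show ?thesis unfolding incr_density_integral_def e using nz
      by (simp add: divide_simps) (simp add: algebra_simps power2_eq_square)
  qed
  finally show ?thesis using 1 by (simp add: b_def)
qed

lemma incr_density_integral_sum_tendsto:
  "(\<lambda>m. (\<Sum>k<m. incr_density_integral (real k / real m)) / real m) \<longlonglongrightarrow> 3 * limit_var"
proof -
  \<comment> \<open>The formula has a removable singularity at b = 1, where division by zero yields
    a value different from the limit. \<open>G\<close> repairs this one value, so that uniform
    continuity on [0, 1] applies; the sample points stay below 1.\<close>
  define G where "G b = (if b = 1 then -1 + 8 * ln 2 - 4 * ln 3 else incr_density_integral b)" for b :: real
  \<comment> \<open>b / (1 - b^2) is half of 1 / (1 - b) minus half of 1 / (1 + b). Multiplied by
    ln((1 + b) / 2), the first part integrates to dilog((1 - b) / 2) / 2 and the second to the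
    squared logarithm. The last two groups are b ln(1 + 2b) and b ln(1 + b), integrated by
    parts.\<close>
  define F where "F b = 4 * (dilog ((1 - b) / 2) / 2 - (ln ((1 + b) / 2))\<^sup>2 / 4 + b\<^sup>2 * ln 2 / 2
     - (b\<^sup>2 / 2 * ln (1 + 2 * b) - b\<^sup>2 / 4 + b / 4 - ln (1 + 2 * b) / 8)
     + (b\<^sup>2 / 2 * ln (1 + b) - b\<^sup>2 / 4 + b / 2 - ln (1 + b) / 2))" for b :: real
  \<comment> \<open>At b = 0 the dilogarithm is taken at 1/2, which brings in pi^2; at b = 1 its
    argument is 0.\<close>
  have F01: "F 1 - F 0 = 3 * limit_var"
    using dilog_half by (simp add: F_def limit_var_def ln_div power2_eq_square field_simps)
  have cF: "continuous_on {0..1} F"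
    unfolding F_def
    by (intro continuous_intros continuous_on_compose2[OF continuous_on_dilog]) auto
  have dF: "(F has_real_derivative incr_density_integral x) (at x)" if x: "0 < x" "x < 1" for x
  proof -
    have d1: "((\<lambda>b. dilog ((1 - b) / 2)) has_real_derivative ln ((1 + x) / 2) / (1 - x)) (at x)"
    proof -
      have "((\<lambda>b. dilog ((1 - b) / 2)) has_real_derivative (- ln (1 - (1 - x) / 2) / ((1 - x) / 2)) * (- 1 / 2)) (at x)"
        by (rule DERIV_chain'[OF _ dilog_has_derivative])
           (use x in \<open>auto intro!: derivative_eq_intros\<close>)
      moreover have "1 - (1 - x) / 2 = (1 + x) / 2" by (simp add: field_simps)
      ultimately show ?thesis using x by (simp add: field_simps)
    qed
    have l: "ln ((1 + x) / 2) = ln (1 + x) - ln 2" using x by (simp add: ln_div)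
    have d2: "((\<lambda>b. (ln ((1 + b) / 2))\<^sup>2) has_real_derivative 2 * ln ((1 + x) / 2) / (1 + x)) (at x)"
      using x by (auto intro!: derivative_eq_intros simp: field_simps)
    have d3: "((\<lambda>b. b\<^sup>2 / 2 * ln (1 + 2 * b)) has_real_derivative x * ln (1 + 2 * x) + x\<^sup>2 / (1 + 2 * x)) (at x)"
      using x by (auto intro!: derivative_eq_intros simp: field_simps)
    have d4: "((\<lambda>b. b\<^sup>2 / 2 * ln (1 + b)) has_real_derivative x * ln (1 + x) + x\<^sup>2 / 2 / (1 + x)) (at x)"
      using x by (auto intro!: derivative_eq_intros simp: field_simps)
    have d5: "((\<lambda>b. ln (1 + 2 * b)) has_real_derivative 2 / (1 + 2 * x)) (at x)"
      using x by (auto intro!: derivative_eq_intros)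
    have d6: "((\<lambda>b. ln (1 + b)) has_real_derivative 1 / (1 + x)) (at x)"
      using x by (auto intro!: derivative_eq_intros)
    have d2': "((\<lambda>b. (ln ((1 + b) / 2))\<^sup>2 / 4) has_real_derivative ln ((1 + x) / 2) / (1 + x) / 2) (at x)"
      by (rule DERIV_cong[OF DERIV_cdivide[OF d2, of 4]]) (use x in \<open>simp add: field_simps\<close>)
    have d5': "((\<lambda>b. ln (1 + 2 * b) / 8) has_real_derivative 1 / (1 + 2 * x) / 4) (at x)"
      by (rule DERIV_cong[OF DERIV_cdivide[OF d5, of 8]]) (use x in \<open>simp add: field_simps\<close>)
    have q: "((\<lambda>b. b\<^sup>2 * ln 2 / 2) has_real_derivative x * ln 2) (at x)"
      "((\<lambda>b. b\<^sup>2 / 4) has_real_derivative x / 2) (at x)"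
      "((\<lambda>b. b / 4) has_real_derivative 1 / 4) (at x)" "((\<lambda>b. b / 2) has_real_derivative 1 / 2) (at x)"
      by (auto intro!: derivative_eq_intros)
    note p3 = DERIV_diff[OF DERIV_add[OF DERIV_diff[OF d3 q(2)] q(3)] d5']
    note p4 = DERIV_diff[OF DERIV_add[OF DERIV_diff[OF d4 q(2)] q(4)] DERIV_cdivide[OF d6, of 2]]
    note p1 = DERIV_add[OF DERIV_diff[OF DERIV_cdivide[OF d1, of 2] d2'] q(1)]
    have "(F has_real_derivative 4 * (ln ((1 + x) / 2) / (1 - x) / 2 - ln ((1 + x) / 2) / (1 + x) / 2 + x * ln 2
      - (x * ln (1 + 2 * x) + x\<^sup>2 / (1 + 2 * x) - x / 2 + 1 / 4 - 1 / (1 + 2 * x) / 4)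
      + (x * ln (1 + x) + x\<^sup>2 / 2 / (1 + x) - x / 2 + 1 / 2 - 1 / (1 + x) / 2))) (at x)"
      unfolding F_def[abs_def] by (rule DERIV_cmult[OF DERIV_add[OF DERIV_diff[OF p1 p3] p4]])
    moreover have "ln ((1 + x) / 2) / (1 - x) / 2 - ln ((1 + x) / 2) / (1 + x) / 2 = x * (ln (1 + x) - ln 2) / (1 - x\<^sup>2)"
    proof -
      have nz: "1 - x \<noteq> 0" "1 + x \<noteq> 0" using x by auto
      have e: "1 - x\<^sup>2 = (1 - x) * (1 + x)" by (simp add: power2_eq_square algebra_simps)
      show ?thesis unfolding l e using nz by (simp add: divide_simps) (simp add: algebra_simps)
    qed
    moreover have "x * ln (1 + 2 * x) + x\<^sup>2 / (1 + 2 * x) - x / 2 + 1 / 4 - 1 / (1 + 2 * x) / 4 = x * ln (1 + 2 * x)"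
      using x by (simp add: divide_simps) (simp add: algebra_simps power2_eq_square)
    moreover have "x * ln (1 + x) + x\<^sup>2 / 2 / (1 + x) - x / 2 + 1 / 2 - 1 / (1 + x) / 2 = x * ln (1 + x)"
      using x by (simp add: divide_simps) (simp add: algebra_simps power2_eq_square)
    ultimately show ?thesis by (simp only: incr_density_integral_def)
  qed
  have G_at_1: "(incr_density_integral \<longlongrightarrow> -1 + 8 * ln 2 - 4 * ln 3) (at_left 1)"
    unfolding incr_density_integral_def[abs_def] by real_asymp
  have cG: "continuous_on {0..1} G"
  proof -
    have "continuous (at x within {0..1}) G" if x: "x \<in> {0..1}" for x
    proof (cases "x = 1")
      case True
      have "(G \<longlongrightarrow> G 1) (at_left 1)"
        by (rule Lim_transform_eventually[of incr_density_integral]) (use G_at_1 in \<open>auto simp: G_def eventually_at_filter\<close>)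
      then show ?thesis using True by (simp add: continuous_within at_within_Icc_at_left)
    next
      case False
      then have x1: "0 \<le> x" "x < 1" using x by auto
      have "isCont incr_density_integral x"
        unfolding incr_density_integral_def[abs_def] using x1 by (intro continuous_intros) (auto simp: power2_eq_1_iff)
      moreover have "\<forall>\<^sub>F y in nhds x. G y = incr_density_integral y"
        using x1 by (intro eventually_nhds_in_open[of "{..<1}" x, THEN eventually_mono]) (auto simp: G_def)
      ultimately have "isCont G x" by (simp add: isCont_cong)
      then show ?thesis by (rule continuous_at_imp_continuous_at_within)
    qed
    then show ?thesis by (simp add: continuous_on_eq_continuous_within)
  qed
  have "uniformly_continuous_on {0..1} G" by (rule compact_uniformly_continuous[OF cG]) simp
  show ?thesis
  proof (rule LIMSEQ_I)
    fix r :: real assume r: "0 < r"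
    obtain d where d: "d > 0" "\<And>x y. x \<in> {0..1} \<Longrightarrow> y \<in> {0..1} \<Longrightarrow> dist y x < d \<Longrightarrow> dist (G y) (G x) < r / 2"
      using \<open>uniformly_continuous_on {0..1} G\<close> r unfolding uniformly_continuous_on_def by (meson half_gt_zero)
    obtain N :: nat where N: "N > 0" "1 / real N < d"
      using reals_Archimedean[OF d(1)] by (metis inverse_eq_divide zero_less_Suc)
    have "\<bar>(\<Sum>k<m. incr_density_integral (real k / real m)) / real m - 3 * limit_var\<bar> < r" if m: "m \<ge> N" for m
    proof -
      have m0: "m > 0" using m N by simp
      have md: "1 / real m < d" using m N by (smt (verit) frac_le of_nat_0_less_iff of_nat_mono)
      have "\<bar>(\<Sum>k<m. incr_density_integral (real k / real m)) / real m - (F (real m / real m) - F 0)\<bar> \<le> r / 2 * real m / real m"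
      proof (rule riemann_sum_error[OF m0])
        show "continuous_on {0..real m / real m} F" using cF m0 by simp
        show "(F has_real_derivative incr_density_integral x) (at x)" if "0 < x" "x < real m / real m" for x
          using dF that m0 by simp
        fix k x assume k: "k < m" and x: "real k / real m < x" "x < real (Suc k) / real m"
        have k1: "0 \<le> real k / real m" "real k / real m < 1" using k m0 by auto
        have k2: "real (Suc k) / real m \<le> 1" using k m0 by (simp add: Suc_leI)
        have "x - real k / real m < 1 / real m" using x m0 by (simp add: add_divide_distrib)
        then have "dist (real k / real m) x < d" using x md by (simp add: dist_real_def)
        moreover have "0 \<le> x" "x \<le> 1" using x k1 k2 by linarith+
        then have "x \<in> {0..1}" "real k / real m \<in> {0..1}" using k1 by auto
        ultimately have "dist (G (real k / real m)) (G x) < r / 2" using d(2) by blast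
        then show "\<bar>incr_density_integral (real k / real m) - incr_density_integral x\<bar> \<le> r / 2"
          using k1 k2 x by (simp add: G_def dist_real_def split: if_splits)
      qed
      then show ?thesis using m0 r F01 by simp
    qed
    then show "\<exists>no. \<forall>n\<ge>no. norm ((\<Sum>k<n. incr_density_integral (real k / real n)) / real n - 3 * limit_var) < r" by auto
  qed
qed

text \<open>The value is only about 0.018, a near cancellation, so the numerical bounds leave little
  slack. Positivity is what turns the limit of the variance into a lower bound c n^3.\<close>

lemma limit_var_pos: "limit_var > 0"
proof -
  have l2: "ln (2::real) \<ge> 0.69" using ln_approx_bounds[of 2 2] by (simp add: eval_nat_numeral)
  have l3: "ln (3::real) \<le> 1.1" using ln_approx_bounds[of 3 3] by (simp add: eval_nat_numeral)
  have "pi \<le> 3.141592654" using pi_approx by simp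
  then have "pi\<^sup>2 \<le> 3.141592654\<^sup>2" using pi_ge_zero by (intro power_mono) auto
  moreover have "0.69\<^sup>2 \<le> (ln (2::real))\<^sup>2" using l2 by (intro power_mono) auto
  ultimately show ?thesis using l2 l3 unfolding limit_var_def by (simp add: power2_eq_square)
qed

section \<open>The projection variance as a signed triple sum\<close>

definition order_sign :: "nat \<Rightarrow> nat \<Rightarrow> real" where
  "order_sign i j = (if i < j then 1 else if j < i then - 1 else 0)"

text \<open>The covariance of \<open>Z\<^sub>i ^ j\<close> and \<open>Z\<^sub>i ^ k\<close>.\<close>

definition cov_kernel :: "nat \<Rightarrow> nat \<Rightarrow> nat \<Rightarrow> real" where
  "cov_kernel i j k = real i * real j * real k /
     ((real i + real j) * (real i + real k) * (real i + real j + real k))"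

definition proj_var :: "nat \<Rightarrow> real" where
  "proj_var n = (\<Sum>i=1..n. \<Sum>j=1..n. \<Sum>k=1..n. order_sign i j * order_sign i k * cov_kernel i j k)"

text \<open>The three positions of the largest index \<open>m\<close> in \<^const>\<open>proj_var\<close>, symmetrised in the other two.\<close>

definition incr_kernel :: "nat \<Rightarrow> nat \<Rightarrow> nat \<Rightarrow> real" where
  "incr_kernel m j k = 2 * real j * real k * real m * real (max j k) /
     ((real m + real j) * (real m + real k) * (real j + real k) * (real m + real j + real k))"

lemma incr_kernel_commute: "incr_kernel m j k = incr_kernel m k j"
  by (simp add: incr_kernel_def max.commute mult_ac add_ac)

text \<open>For j < k put p = a + b, q = a + c, r = b + c and s = a + b + c. Over the common
  denominator p q r s the numerators combine to a b c (p + r - q) = 2 a b^2 c, with b the larger of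
  the two indices. The negative fraction is absorbed, and this is where the positivity of the
  increments comes from.\<close>

lemma cov_kernel_combine:
  assumes "0 < j" "0 < k" "0 < m"
  shows "cov_kernel m j k + order_sign j k * (cov_kernel j k m - cov_kernel k j m) = incr_kernel m j k"
proof -
  define a b c where "a = real j" and "b = real k" and "c = real m"
  have pos: "a > 0" "b > 0" "c > 0" using assms by (auto simp: a_def b_def c_def)
  have *: "a * b * c / ((c + a) * (c + b) * (c + a + b)) +
      (a * b * c / ((a + b) * (a + c) * (a + b + c)) - b * a * c / ((b + a) * (b + c) * (b + a + c)))
      = 2 * a * b * c * b / ((c + a) * (c + b) * (a + b) * (c + a + b))" if "a > 0" "b > 0" "c > 0" for a b c :: real
  proof -
    define p q r s where "p = a + b" and "q = a + c" and "r = b + c" and "s = a + b + c"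
    have nz: "p \<noteq> 0" "q \<noteq> 0" "r \<noteq> 0" "s \<noteq> 0" using that by (auto simp: p_def q_def r_def s_def)
    have "a * b * c / (q * r * s) + (a * b * c / (p * q * s) - b * a * c / (p * r * s)) = a * b * c * (p + r - q) / (q * r * p * s)"
      using nz by (simp add: field_simps)
    moreover have "p + r - q = 2 * b" by (simp add: p_def q_def r_def)
    ultimately show ?thesis by (simp add: p_def q_def r_def s_def add_ac mult_ac)
  qed
  consider "j < k" | "k < j" | "j = k" by linarith
  then show ?thesis
  proof cases
    case 1
    then show ?thesis using *[OF pos]
      by (simp add: order_sign_def cov_kernel_def incr_kernel_def a_def b_def c_def max_def mult_ac)
  next
    case 2
    then show ?thesis using *[OF pos(2,1,3)]
      by (simp add: order_sign_def cov_kernel_def incr_kernel_def a_def b_def c_def max_def mult_ac add_ac)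
  next
    case 3
    then show ?thesis using *[OF pos(1,1,3)]
      by (simp add: order_sign_def cov_kernel_def incr_kernel_def a_def b_def c_def mult_ac)
  qed
qed

text \<open>The new terms are sorted by the indices equal to m = n + 1. One such index gives three
  double sums, in which every sign involving m is known because m is largest. With two or more, only
  j = k = m survives: \<open>order_sign m m = 0\<close> kills the terms where i is among
  them.\<close>

lemma proj_var_Suc:
  "proj_var (Suc n) = proj_var n +
     ((\<Sum>j=1..n. \<Sum>k=1..n. incr_kernel (Suc n) j k) + (\<Sum>i=1..n. cov_kernel i (Suc n) (Suc n)))"
proof -
  define m where "m = Suc n"
  have sg: "order_sign i m = 1" "order_sign m i = -1" if "Suc 0 \<le> i" "i \<le> n" for i
    using that by (auto simp: order_sign_def m_def)
  have sgm: "order_sign m m = 0" by (simp add: order_sign_def)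
  have split: "sum f {1..m} = sum f {1..n} + f m" for f :: "nat \<Rightarrow> real" by (simp add: m_def)
  have cm: "cov_kernel i j k = cov_kernel i k j" for i j k by (simp add: cov_kernel_def mult_ac add_ac)
  let ?S = "\<lambda>f :: nat \<Rightarrow> nat \<Rightarrow> real. \<Sum>j=1..n. \<Sum>k=1..n. f j k"
  have "proj_var m = proj_var n + ?S (\<lambda>i j. order_sign i j * cov_kernel i j m)
     + ?S (\<lambda>i k. order_sign i k * cov_kernel i m k) + (\<Sum>i=1..n. cov_kernel i m m) + ?S (\<lambda>j k. cov_kernel m j k)"
    unfolding proj_var_def split by (simp add: sgm sg sum.distrib cong: sum.cong_simp)
  \<comment> \<open>Renaming brings both signed sums to the same indices; antisymmetry of
    \<open>order_sign\<close> then produces the difference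
    \<open>cov_kernel j k m - cov_kernel k j m\<close>.\<close>
  also have "?S (\<lambda>i k. order_sign i k * cov_kernel i m k) = ?S (\<lambda>k i. order_sign i k * cov_kernel i k m)"
    by (subst sum.swap) (simp add: cm)
  also have "?S (\<lambda>k i. order_sign i k * cov_kernel i k m) = - ?S (\<lambda>k i. order_sign k i * cov_kernel i k m)"
    by (subst sum_negf[symmetric])+ (intro sum.cong refl, simp add: order_sign_def)
  finally have "proj_var m = proj_var n + (?S (\<lambda>j k. cov_kernel m j k + order_sign j k * (cov_kernel j k m - cov_kernel k j m))
     + (\<Sum>i=1..n. cov_kernel i m m))"
    by (simp add: sum.distrib sum_subtractf algebra_simps)
  also have "?S (\<lambda>j k. cov_kernel m j k + order_sign j k * (cov_kernel j k m - cov_kernel k j m)) = ?S (incr_kernel m)"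
    by (intro sum.cong refl cov_kernel_combine) (auto simp: m_def)
  finally show ?thesis by (simp only: m_def)
qed

lemma sum_symmetric:
  fixes f :: "nat \<Rightarrow> nat \<Rightarrow> real"
  assumes "\<And>j k. f j k = f k j"
  shows "(\<Sum>j=1..n. \<Sum>k=1..n. f j k) = 2 * (\<Sum>k=1..n. \<Sum>j=1..<k. f j k) + (\<Sum>k=1..n. f k k)"
proof (induction n)
  case (Suc n)
  have "(\<Sum>k=1..n. f (Suc n) k) = (\<Sum>j=1..n. f j (Suc n))" by (simp add: assms[of "Suc n"])
  moreover have "{1..<Suc n} = {1..n}" by auto
  ultimately show ?case using Suc by (simp add: sum.distrib)
qed simp

text \<open>After folding, the density sum reproduces the off-diagonal part exactly. What is left is
  the diagonal of \<open>incr_kernel\<close> and the terms \<open>cov_kernel k m m\<close>, all in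
  [0, 1] and fewer than m of each kind.\<close>

lemma proj_var_incr_approx:
  assumes m: "m > 0"
  shows "\<bar>(proj_var m - proj_var (m - 1)) - (\<Sum>k<m. \<Sum>j<k. incr_density (real j / real m) (real k / real m))\<bar> \<le> 2 * real m"
proof -
  obtain n where n: "m = Suc n" using m by (cases m) auto
  have incr_density: "incr_density (real j / real m) (real k / real m) = 2 * incr_kernel m j k" if "0 < j" "j < k" for j k
  proof -
    define a b c where "a = real j" and "b = real k" and "c = real m"
    have pos: "a > 0" "b > 0" "c > 0" using that m by (auto simp: a_def b_def c_def)
    have "incr_density (a / c) (b / c) = 4 * a * b\<^sup>2 * c / ((c + a) * (c + b) * (a + b) * (c + a + b))"
    proof -
      have e: "1 + a / c = (c + a) / c" "1 + b / c = (c + b) / c" "a / c + b / c = (a + b) / c" "1 + a / c + b / c = (c + a + b) / c"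
        using pos by (simp_all add: field_simps)
      show ?thesis unfolding incr_density_def e(4) unfolding e(1-3) using pos by (simp add: power2_eq_square mult_ac)
    qed
    then show ?thesis using that
      by (simp add: incr_kernel_def a_def b_def c_def max_def power2_eq_square mult_ac)
  qed
  have "(\<Sum>k<m. \<Sum>j<k. incr_density (real j / real m) (real k / real m)) = (\<Sum>k=1..n. \<Sum>j=1..<k. incr_density (real j / real m) (real k / real m))"
  proof -
    have "(\<Sum>j<k. incr_density (real j / real m) (real k / real m)) = (\<Sum>j=1..<k. incr_density (real j / real m) (real k / real m))" for k
      by (intro sum.mono_neutral_right) (auto simp: incr_density_def)
    then show ?thesis
      by (simp only:) (intro sum.mono_neutral_right, auto simp: n)
  qed
  also have "\<dots> = (\<Sum>k=1..n. \<Sum>j=1..<k. 2 * incr_kernel m j k)"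
    by (intro sum.cong refl incr_density) auto
  also have "\<dots> = 2 * (\<Sum>k=1..n. \<Sum>j=1..<k. incr_kernel m j k)" by (simp add: sum_distrib_left)
  finally have s: "(proj_var m - proj_var (m - 1)) - (\<Sum>k<m. \<Sum>j<k. incr_density (real j / real m) (real k / real m))
     = (\<Sum>k=1..n. incr_kernel m k k + cov_kernel k m m)"
    using proj_var_Suc[of n] sum_symmetric[of "incr_kernel m" n, OF incr_kernel_commute]
    by (simp add: n sum.distrib)
  have "\<bar>incr_kernel m k k + cov_kernel k m m\<bar> \<le> 2" if "k \<in> {1..n}" for k
  proof -
    define a c where "a = real k" and "c = real m"
    have pos: "a > 0" "c > 0" using that m by (auto simp: a_def c_def)
    have le: "x / y \<le> 1" "0 \<le> x / y" if "0 \<le> x" "x \<le> y" for x y :: real using that by (auto simp: divide_le_eq_1)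
    have "2 * a * a * c * a \<le> (c + a) * (c + a) * (a + a) * (c + a + a)"
    proof -
      have "a * a * c * (2 * a) \<le> (c + a) * (c + a + a) * (c + a) * (a + a)" using pos by (intro mult_mono) auto
      then show ?thesis by (simp only: mult_ac)
    qed
    then have 1: "0 \<le> incr_kernel m k k" "incr_kernel m k k \<le> 1"
      using pos unfolding incr_kernel_def max.idem a_def[symmetric] c_def[symmetric] by (auto intro!: le)
    have "a * c * c \<le> (a + c) * (a + c) * (a + c + c)"
    proof -
      have "a * c * c \<le> (a + c + c) * (a + c) * (a + c)" using pos by (intro mult_mono) auto
      then show ?thesis by (simp add: mult_ac)
    qed
    then have 2: "0 \<le> cov_kernel k m m" "cov_kernel k m m \<le> 1"
      using pos unfolding cov_kernel_def a_def[symmetric] c_def[symmetric] by (auto intro!: le)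
    show ?thesis using 1 2 by simp
  qed
  then have "\<bar>\<Sum>k=1..n. incr_kernel m k k + cov_kernel k m m\<bar> \<le> (\<Sum>k=1..n. 2)"
    by (intro sum_abs[THEN order_trans] sum_mono) auto
  also have "\<dots> \<le> 2 * real m" by (simp add: n)
  finally show ?thesis unfolding s .
qed

lemma proj_var_incr_tendsto:
  "(\<lambda>m. (proj_var m - proj_var (m - 1)) / (real m)\<^sup>2) \<longlonglongrightarrow> 3 * limit_var"
proof (rule LIM_zero_cancel, rule Lim_null_comparison)
  let ?P = "\<lambda>m. (\<Sum>k<m. \<Sum>j<k. incr_density (real j / real m) (real k / real m))"
  let ?I = "\<lambda>m. (\<Sum>k<m. incr_density_integral (real k / real m)) / real m"
  \<comment> \<open>14 = 2 + 12: the diagonal contributes 2 / m and the inner Riemann sums 12 / m.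
    The outer Riemann sum converges without a rate.\<close>
  show "\<forall>\<^sub>F m in sequentially. norm ((proj_var m - proj_var (m - 1)) / (real m)\<^sup>2 - 3 * limit_var) \<le> 14 / real m + \<bar>?I m - 3 * limit_var\<bar>"
  proof (rule eventually_sequentiallyI[of 1])
    fix m :: nat assume "1 \<le> m"
    then have m: "m > 0" by simp
    have 1: "\<bar>(proj_var m - proj_var (m - 1)) / (real m)\<^sup>2 - ?P m / (real m)\<^sup>2\<bar> \<le> 2 / real m"
    proof -
      have "\<bar>(proj_var m - proj_var (m - 1)) / (real m)\<^sup>2 - ?P m / (real m)\<^sup>2\<bar> = \<bar>(proj_var m - proj_var (m - 1)) - ?P m\<bar> / (real m)\<^sup>2"
        by (simp add: diff_divide_distrib[symmetric])
      also have "\<dots> \<le> 2 * real m / (real m)\<^sup>2" by (intro divide_right_mono proj_var_incr_approx m) auto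
      finally show ?thesis using m by (simp add: power2_eq_square)
    qed
    have 2: "\<bar>?P m / (real m)\<^sup>2 - ?I m\<bar> \<le> 12 / real m"
    proof -
      have "?P m / (real m)\<^sup>2 - ?I m = (\<Sum>k<m. ((\<Sum>j<k. incr_density (real j / real m) (real k / real m)) / real m - incr_density_integral (real k / real m))) / real m"
        by (simp add: sum_subtractf diff_divide_distrib sum_divide_distrib[symmetric] power2_eq_square)
      also have "\<bar>\<dots>\<bar> \<le> (\<Sum>k<m. 12 / real m) / real m"
        unfolding abs_divide abs_of_nat
      proof (intro divide_right_mono sum_abs[THEN order_trans] sum_mono)
        fix k assume "k \<in> {..<m}"
        \<comment> \<open>For k = 0 the sum is empty and \<open>incr_density_integral 0\<close> is
          0; \<open>incr_density_sum_error\<close> covers the other k.\<close>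
        then show "\<bar>(\<Sum>j<k. incr_density (real j / real m) (real k / real m)) / real m - incr_density_integral (real k / real m)\<bar> \<le> 12 / real m"
          using incr_density_sum_error[of k m] by (cases "k = 0") (auto simp: incr_density_integral_def)
      qed auto
      also have "\<dots> = 12 / real m" using m by simp
      finally show ?thesis .
    qed
    have "norm ((proj_var m - proj_var (m - 1)) / (real m)\<^sup>2 - 3 * limit_var) \<le> 2 / real m + (12 / real m + \<bar>?I m - 3 * limit_var\<bar>)"
      using 1 2 unfolding real_norm_def by linarith
    then show "norm ((proj_var m - proj_var (m - 1)) / (real m)\<^sup>2 - 3 * limit_var) \<le> 14 / real m + \<bar>?I m - 3 * limit_var\<bar>"
      by simp
  qed
  have "(\<lambda>m. \<bar>?I m - 3 * limit_var\<bar>) \<longlonglongrightarrow> 0"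
    using incr_density_integral_sum_tendsto by (intro tendsto_rabs_zero LIM_zero)
  moreover have "(\<lambda>m. 14 / real m) \<longlonglongrightarrow> 0" by real_asymp
  ultimately show "(\<lambda>m. 14 / real m + \<bar>?I m - 3 * limit_var\<bar>) \<longlonglongrightarrow> 0" by (rule tendsto_add_zero[rotated])
qed

text \<open>A Cesaro argument with weights m^2, whose sum is asymptotic to n^3 / 3. In the error sum
  the terms with m < N contribute at most a constant, the others at most n * n^2 * r / 2.\<close>

lemma sum_quadratic_growth_tendsto:
  fixes d :: "nat \<Rightarrow> real"
  assumes d: "(\<lambda>m. d m / (real m)\<^sup>2) \<longlonglongrightarrow> L"
  shows "(\<lambda>n. (\<Sum>m=1..n. d m) / (real n) ^ 3) \<longlonglongrightarrow> L / 3"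
proof -
  define e where "e m = d m / (real m)\<^sup>2 - L" for m
  have sq: "(\<Sum>m=1..n. (real m)\<^sup>2) = real n * (real n + 1) * (2 * real n + 1) / 6" for n
    by (induction n) (auto simp: power2_eq_square field_simps)
  have main: "(\<lambda>n. L * ((\<Sum>m=1..n. (real m)\<^sup>2) / (real n) ^ 3)) \<longlonglongrightarrow> L * (1 / 3)"
    unfolding sq by (intro tendsto_mult_left) real_asymp
  have err: "(\<lambda>n. (\<Sum>m=1..n. (real m)\<^sup>2 * e m) / (real n) ^ 3) \<longlonglongrightarrow> 0"
  proof (rule LIMSEQ_I)
    fix r :: real assume r: "0 < r"
    have "e \<longlonglongrightarrow> 0" unfolding e_def[abs_def] using d by (rule LIM_zero)
    then obtain N where N: "\<And>m. m \<ge> N \<Longrightarrow> \<bar>e m\<bar> < r / 2" using LIMSEQ_D[of e 0 "r / 2"] r by auto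
    define c where "c = (\<Sum>m<N. (real m)\<^sup>2 * \<bar>e m\<bar>)"
    have c: "0 \<le> c" unfolding c_def by (intro sum_nonneg) auto
    obtain N' where N': "real N' > 2 * c / r" using reals_Archimedean2 by blast
    have "norm ((\<Sum>m=1..n. (real m)\<^sup>2 * e m) / (real n) ^ 3 - 0) < r" if n: "n \<ge> max 1 N'" for n
    proof -
      have n1: "n \<ge> 1" using n by simp
      have "\<bar>\<Sum>m=1..n. (real m)\<^sup>2 * e m\<bar> \<le> (\<Sum>m=1..n. (real m)\<^sup>2 * \<bar>e m\<bar>)"
        by (rule order_trans[OF sum_abs]) (simp add: abs_mult)
      also have "\<dots> \<le> (\<Sum>m=1..n. (if m < N then (real m)\<^sup>2 * \<bar>e m\<bar> else 0) + (real n)\<^sup>2 * (r / 2))"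
      proof (intro sum_mono)
        fix m assume m: "m \<in> {1..n}"
        show "(real m)\<^sup>2 * \<bar>e m\<bar> \<le> (if m < N then (real m)\<^sup>2 * \<bar>e m\<bar> else 0) + (real n)\<^sup>2 * (r / 2)"
        proof (cases "m < N")
          case False
          then have "(real m)\<^sup>2 * \<bar>e m\<bar> \<le> (real n)\<^sup>2 * (r / 2)"
            using m N[of m] by (intro mult_mono power_mono) auto
          then show ?thesis using False by simp
        qed (use r in auto)
      qed
      also have "\<dots> = (\<Sum>m=1..n. if m < N then (real m)\<^sup>2 * \<bar>e m\<bar> else 0) + real n ^ 3 * (r / 2)"
        by (simp add: sum.distrib power3_eq_cube power2_eq_square)
      also have "(\<Sum>m=1..n. if m < N then (real m)\<^sup>2 * \<bar>e m\<bar> else 0) = (\<Sum>m\<in>{1..n} \<inter> {..<N}. (real m)\<^sup>2 * \<bar>e m\<bar>)"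
        by (subst sum.inter_restrict) (auto intro!: sum.cong)
      also have "\<dots> \<le> c" unfolding c_def by (rule sum_mono2) auto
      finally have "\<bar>\<Sum>m=1..n. (real m)\<^sup>2 * e m\<bar> \<le> c + real n ^ 3 * (r / 2)" by simp
      also have "c < real n * (r / 2)"
      proof -
        have "2 * c / r < real n" using N' n by (meson max.boundedE of_nat_le_iff order_less_le_trans)
        then show ?thesis using r by (simp add: field_simps)
      qed
      also have "real n * (r / 2) \<le> real n ^ 3 * (r / 2)"
        using n1 r by (intro mult_right_mono self_le_power) auto
      finally have "\<bar>\<Sum>m=1..n. (real m)\<^sup>2 * e m\<bar> < real n ^ 3 * r" by (simp add: mult.commute)
      then show ?thesis using n1 by (simp add: field_simps)
    qed
    then show "\<exists>no. \<forall>n\<ge>no. norm ((\<Sum>m=1..n. (real m)\<^sup>2 * e m) / (real n) ^ 3 - 0) < r" by blast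
  qed
  have "(\<Sum>m=1..n. d m) = L * (\<Sum>m=1..n. (real m)\<^sup>2) + (\<Sum>m=1..n. (real m)\<^sup>2 * e m)" for n
    unfolding sum_distrib_left sum.distrib[symmetric] by (intro sum.cong) (auto simp: e_def algebra_simps)
  then show ?thesis using tendsto_add[OF main err] by (simp add: add_divide_distrib)
qed

lemma proj_var_0 [simp]: "proj_var 0 = 0"
  by (simp add: proj_var_def)

lemma proj_var_tendsto: "(\<lambda>n. proj_var n / (real n) ^ 3) \<longlonglongrightarrow> limit_var"
proof -
  have "(\<Sum>m=1..n. proj_var m - proj_var (m - 1)) = proj_var n" for n
    by (induction n) auto
  then show ?thesis using sum_quadratic_growth_tendsto[OF proj_var_incr_tendsto] by simp
qed

lemma proj_var_nonneg: "0 \<le> proj_var n"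
proof (induction n)
  case (Suc n)
  then show ?case unfolding proj_var_Suc
    by (intro add_nonneg_nonneg sum_nonneg) (auto simp: incr_kernel_def cov_kernel_def)
qed simp

text \<open>The last increment contains a positive \<open>cov_kernel\<close> term. At n = 1 the
  projection variance is 0, so the range is exact.\<close>

lemma proj_var_pos:
  assumes "n \<ge> 2"
  shows "0 < proj_var n"
proof -
  obtain k where k: "n = Suc (Suc k)" using assms by (metis Suc_le_D numeral_2_eq_2 Suc_le_mono)
  have "0 < (\<Sum>i=1..Suc k. cov_kernel i (Suc (Suc k)) (Suc (Suc k)))"
    by (intro sum_pos) (auto simp: cov_kernel_def)
  moreover have "0 \<le> (\<Sum>j=1..Suc k. \<Sum>l=1..Suc k. incr_kernel (Suc (Suc k)) j l)"
    by (intro sum_nonneg) (auto simp: incr_kernel_def)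
  ultimately show ?thesis using proj_var_nonneg[of "Suc k"] unfolding k proj_var_Suc[of "Suc k"] by linarith
qed

text \<open>n^3 / proj_var n converges because \<open>limit_var\<close> is positive, hence it is
  bounded over all n at once; positivity for n \<ge> 2 allows the bound to be inverted.\<close>

lemma proj_var_lower_bound:
  obtains c where "c > 0" "\<And>n. n \<ge> 2 \<Longrightarrow> c * real n ^ 3 \<le> proj_var n"
proof -
  have "(\<lambda>n. inverse (proj_var n / (real n) ^ 3)) \<longlonglongrightarrow> inverse limit_var"
    using limit_var_pos by (intro tendsto_inverse proj_var_tendsto) auto
  then have "Bseq (\<lambda>n. inverse (proj_var n / (real n) ^ 3))" by (rule convergentI[THEN convergent_imp_Bseq])
  then obtain K where K: "K > 0" "\<And>n. norm (inverse (proj_var n / (real n) ^ 3)) \<le> K" unfolding Bseq_def by auto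
  show ?thesis
  proof (rule that[of "1 / K"])
    show "1 / K * real n ^ 3 \<le> proj_var n" if n: "n \<ge> 2" for n
      using K(2)[of n] K(1) proj_var_pos[OF n] n by (simp add: field_simps)
  qed (use K in auto)
qed

section \<open>Laws and independence of the maxima\<close>

text \<open>The maxima lie in \<open>(0, 1)\<close> only almost surely. With powers of the clamped value in place of powers,
  the Hoeffding terms below are bounded and degenerate for every argument.\<close>

definition clamp01 :: "real \<Rightarrow> real" where
  "clamp01 x = max 0 (min 1 x)"

lemma clamp01_range: "0 \<le> clamp01 x" "clamp01 x \<le> 1"
  by (auto simp: clamp01_def)

lemma clamp01_power_range: "0 \<le> clamp01 x ^ k" "clamp01 x ^ k \<le> 1"
  using clamp01_range[of x] by (auto intro: power_le_one)

lemma borel_measurable_clamp01 [measurable]: "clamp01 \<in> borel_measurable borel"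
  unfolding clamp01_def[abs_def] by measurable

lemma emeasure_uniform_01_atMost:
  "emeasure (uniform_measure lborel {0<..<1::real}) {..t} = ennreal (clamp01 t)"
proof -
  have "{0<..<1} \<inter> {..t} = (if t \<le> 0 then {} else if t < 1 then {0<..t} else {0<..<1})" by auto
  moreover have "a / 1 = a" for a :: ennreal by (simp add: divide_ennreal_def)
  ultimately show ?thesis by (auto simp: clamp01_def ennreal_neg)
qed

text \<open>The Beta(i, 1) law, that of the maximum of i uniform variables. The density form gives
  moments as integrals of monomials and shows that there are no atoms.\<close>

definition power_law :: "nat \<Rightarrow> real measure" where
  "power_law i = density lborel (\<lambda>x. ennreal (real i * x ^ (i - 1)) * indicator {0..1} x)"

lemma sets_power_law [simp, measurable_cong]: "sets (power_law i) = sets borel"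
  and space_power_law [simp]: "space (power_law i) = UNIV"
  by (simp_all add: power_law_def)

lemma power_law_density_eq:
  "ennreal (real i * x ^ (i - 1)) * indicator {0..1} x = ennreal (real i * x ^ (i - 1) * indicator {0..1} x)"
  by (auto split: split_indicator)

lemma emeasure_power_law_atMost:
  assumes i: "i \<ge> 1"
  shows "emeasure (power_law i) {..t} = ennreal (clamp01 t ^ i)"
proof -
  have F: "(\<integral>\<^sup>+x. ennreal (real i * x ^ (i - 1)) * indicator {0..b} x \<partial>lborel) = ennreal (b ^ i)" if b: "0 \<le> b" for b
  proof -
    have "(\<integral>\<^sup>+x. ennreal (real i * x ^ (i - 1)) * indicator {0..b} x \<partial>lborel) = ennreal (b ^ i - 0 ^ i)"
      by (rule nn_integral_FTC_Icc) (use b i in \<open>auto intro!: derivative_eq_intros\<close>)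
    then show ?thesis using i by (cases i) auto
  qed
  have "emeasure (power_law i) {..t} = (\<integral>\<^sup>+x. ennreal (real i * x ^ (i - 1)) * indicator {0..1} x * indicator {..t} x \<partial>lborel)"
    by (simp add: power_law_def emeasure_density)
  \<comment> \<open>For t < 0 the left integrand is 0 while {0..\<open>clamp01 t\<close>} still
    contains the point 0, hence the equality almost everywhere.\<close>
  also have "\<dots> = (\<integral>\<^sup>+x. ennreal (real i * x ^ (i - 1)) * indicator {0..clamp01 t} x \<partial>lborel)"
    by (rule nn_integral_cong_AE)
       (use AE_lborel_singleton[of "0::real"] in \<open>auto elim!: eventually_mono simp: clamp01_def split: split_indicator\<close>)
  also have "\<dots> = ennreal (clamp01 t ^ i)" by (rule F[OF clamp01_range(1)])
  finally show ?thesis .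
qed

lemma real_distribution_power_law:
  assumes i: "i \<ge> 1"
  shows "real_distribution (power_law i)"
proof -
  have "emeasure (power_law i) UNIV = emeasure (power_law i) {..1}"
    by (auto simp: power_law_def emeasure_density intro!: nn_integral_cong split: split_indicator)
  also have "\<dots> = 1" using emeasure_power_law_atMost[OF i, of 1] by (simp add: clamp01_def)
  finally have "prob_space (power_law i)" by (intro prob_spaceI) simp
  then show ?thesis by (simp add: real_distribution_def real_distribution_axioms_def)
qed

lemma integral_power_law:
  assumes i: "i \<ge> 1"
  shows "(\<integral>x. clamp01 x ^ p \<partial>power_law i) = real i / (real i + real p)"
proof -
  have "(\<integral>x. clamp01 x ^ p \<partial>power_law i) = (\<integral>x. real i * x ^ (i - 1) * indicator {0..1} x * clamp01 x ^ p \<partial>lborel)"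
    unfolding power_law_def power_law_density_eq
    by (subst integral_density) (auto split: split_indicator)
  also have "\<dots> = (\<integral>x. real i * (x ^ (i - 1 + p) * indicator {0..1} x) \<partial>lborel)"
    by (rule Bochner_Integration.integral_cong) (auto simp: clamp01_def power_add split: split_indicator)
  also have "\<dots> = real i * (1 / real (Suc (i - 1 + p)))"
    by (subst integral_mult_right_zero, subst integral_power) auto
  also have "real (Suc (i - 1 + p)) = real i + real p" using i by simp
  finally show ?thesis by simp
qed

lemma AE_power_law_neq: "AE y in power_law i. y \<noteq> x"
proof -
  have "AE y in lborel. 0 < ennreal (real i * y ^ (i - 1)) * indicator {0..1} y \<longrightarrow> y \<noteq> x"
    using AE_lborel_singleton[of x] by (rule eventually_mono) simp
  then show ?thesis unfolding power_law_def by (subst AE_density) simp_all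
qed

context unfair_array
begin

abbreviation Z :: "nat \<Rightarrow> 'a \<Rightarrow> real" where
  "Z \<equiv> unfair_max X"

lemma X_measurable:
  assumes "1 \<le> i" "i \<le> n" "1 \<le> j" "j \<le> i"
  shows "X i j \<in> borel_measurable M"
proof -
  have "\<forall>p\<in>(SIGMA i:{1..n}. {1..i}). random_variable borel (case p of (i, j) \<Rightarrow> X i j)"
    using indep[unfolded indep_vars_def] by (rule conjunct1)
  from bspec[OF this, of "(i, j)"] assms show ?thesis by simp
qed

text \<open>Z_i is a measurable function of row i of the array, and the rows are disjoint blocks of
  an independent family.\<close>

lemma indep_Z: "indep_vars (\<lambda>_. borel) Z {1..n}"
proof -
  define K where "K i = {i} \<times> {1..i}" for i :: nat
  define Y where "Y i f = Max ((\<lambda>j. f (i, j)) ` {1..i})" for i and f :: "nat \<times> nat \<Rightarrow> real"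
  have "indep_vars (\<lambda>i. PiM (K i) (\<lambda>_. borel)) (\<lambda>i \<omega>. restrict (\<lambda>p. (case p of (i, j) \<Rightarrow> X i j) \<omega>) (K i)) {1..n}"
    by (rule indep_vars_restrict[OF indep]) (auto simp: K_def disjoint_family_on_def)
  then have "indep_vars (\<lambda>_. borel) (\<lambda>i \<omega>. Y i (restrict (\<lambda>p. (case p of (i, j) \<Rightarrow> X i j) \<omega>) (K i))) {1..n}"
  proof (rule indep_vars_compose2)
    fix i assume i: "i \<in> {1..n}"
    have [measurable]: "(\<lambda>f. f (i, j)) \<in> borel_measurable (PiM (K i) (\<lambda>_. borel :: real measure))" if "j \<in> {1..i}" for j
      by (rule measurable_component_singleton) (use that in \<open>auto simp: K_def\<close>)
    show "Y i \<in> borel_measurable (PiM (K i) (\<lambda>_. borel))"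
      unfolding Y_def[abs_def] by measurable
  qed
  moreover have "Y i (restrict (\<lambda>p. (case p of (i, j) \<Rightarrow> X i j) \<omega>) (K i)) = Z i \<omega>" for i \<omega>
    unfolding Y_def unfair_max_def by (rule arg_cong[where f = Max], rule image_cong) (auto simp: K_def)
  ultimately show ?thesis by simp
qed

lemma Z_measurable: "i \<in> {1..n} \<Longrightarrow> Z i \<in> borel_measurable M"
  using indep_Z by (auto simp: indep_vars_def)

text \<open>A maximum is at most t iff every entry of its row is, so independence gives the
  distribution function as a product of i equal factors.\<close>

lemma distr_Z:
  assumes i: "i \<in> {1..n}"
  shows "distr M borel (Z i) = power_law i"
proof (rule cdf_unique)
  have i1: "i \<ge> 1" using i by simp
  note [measurable] = Z_measurable[OF i]
  show "real_distribution (distr M borel (Z i))" by (rule real_distribution_distr) simp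
  show "real_distribution (power_law i)" by (rule real_distribution_power_law[OF i1])
  have "cdf (distr M borel (Z i)) t = cdf (power_law i) t" for t
  proof -
    have p: "prob (X i j -` {..t} \<inter> space M) = clamp01 t" if j: "j \<in> {1..i}" for j
    proof -
      have "X i j \<in> borel_measurable M" using i j by (intro X_measurable) auto
      then have "prob (X i j -` {..t} \<inter> space M) = measure (distr M borel (X i j)) {..t}"
        by (simp add: measure_distr)
      also have "\<dots> = clamp01 t"
        using uniform[of i j] i j emeasure_uniform_01_atMost[of t] clamp01_range[of t]
        by (simp add: measure_def)
      finally show ?thesis .
    qed
    have "cdf (distr M borel (Z i)) t = prob (Z i -` {..t} \<inter> space M)"
      by (simp add: cdf_def measure_distr)
    also have "Z i -` {..t} \<inter> space M = (\<Inter>p\<in>{i} \<times> {1..i}. (case p of (i, j) \<Rightarrow> X i j) -` {..t} \<inter> space M)"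
      using i by (auto simp: unfair_max_def Max_le_iff)
    also have "prob \<dots> = (\<Prod>p\<in>{i} \<times> {1..i}. prob ((case p of (i, j) \<Rightarrow> X i j) -` {..t} \<inter> space M))"
      by (rule indep_varsD[OF indep]) (use i in auto)
    also have "\<dots> = (\<Prod>p\<in>{i} \<times> {1..i}. clamp01 t)"
      by (rule prod.cong) (use p in auto)
    also have "\<dots> = clamp01 t ^ i" by (simp add: card_cartesian_product)
    also have "\<dots> = cdf (power_law i) t"
      using emeasure_power_law_atMost[OF i1, of t] clamp01_power_range[of t i]
      by (simp add: cdf_def measure_def)
    finally show ?thesis .
  qed
  then show "cdf (distr M borel (Z i)) = cdf (power_law i)" by blast
qed

lemma expectation_clamp01_power:
  assumes i: "i \<in> {1..n}"
  shows "expectation (\<lambda>\<omega>. clamp01 (Z i \<omega>) ^ p) = real i / (real i + real p)"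
proof -
  have "expectation (\<lambda>\<omega>. clamp01 (Z i \<omega>) ^ p) = (\<integral>x. clamp01 x ^ p \<partial>distr M borel (Z i))"
    using Z_measurable[OF i] by (subst integral_distr) auto
  then show ?thesis using i integral_power_law by (simp add: distr_Z)
qed

text \<open>The law has no atoms, so strict and weak inequalities have equal probability and the
  distribution function decides both.\<close>

lemma expectation_Z_less:
  assumes i: "i \<in> {1..n}"
  shows "expectation (\<lambda>\<omega>. if Z i \<omega> < x then 1 else 0) = clamp01 x ^ i"
    and "expectation (\<lambda>\<omega>. if x < Z i \<omega> then 1 else 0) = 1 - clamp01 x ^ i"
proof -
  have [measurable]: "Z i \<in> borel_measurable M" by (rule Z_measurable[OF i])
  have "AE y in distr M borel (Z i). y \<noteq> x" unfolding distr_Z[OF i] by (rule AE_power_law_neq)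
  then have ne: "AE \<omega> in M. Z i \<omega> \<noteq> x" by (subst (asm) AE_distr_iff) auto
  have le: "expectation (\<lambda>\<omega>. if Z i \<omega> \<le> x then 1 else 0) = clamp01 x ^ i"
  proof -
    have "expectation (\<lambda>\<omega>. if Z i \<omega> \<le> x then 1 else 0) = (\<integral>y. indicat_real {..x} y \<partial>distr M borel (Z i))"
      by (subst integral_distr) (auto intro!: Bochner_Integration.integral_cong split: split_indicator)
    also have "\<dots> = measure (power_law i) {..x}" by (simp add: distr_Z[OF i])
    also have "\<dots> = clamp01 x ^ i"
      using emeasure_power_law_atMost[of i x] clamp01_power_range[of x i] i
      by (simp add: measure_def)
    finally show ?thesis .
  qed
  have "expectation (\<lambda>\<omega>. if Z i \<omega> < x then 1 else 0) = expectation (\<lambda>\<omega>. if Z i \<omega> \<le> x then 1 else 0 :: real)"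
    by (rule integral_cong_AE) (use ne in auto)
  then show "expectation (\<lambda>\<omega>. if Z i \<omega> < x then 1 else 0) = clamp01 x ^ i" using le by simp
  have "expectation (\<lambda>\<omega>. if x < Z i \<omega> then 1 else 0) = expectation (\<lambda>\<omega>. 1 - (if Z i \<omega> \<le> x then 1 else 0 :: real))"
    by (rule Bochner_Integration.integral_cong) auto
  also have "\<dots> = 1 - expectation (\<lambda>\<omega>. if Z i \<omega> \<le> x then 1 else 0)"
  proof -
    have "integrable M (\<lambda>\<omega>. if Z i \<omega> \<le> x then 1 else 0 :: real)"
      by (rule integrable_const_bound[where B = 1]) auto
    then show ?thesis by (simp add: prob_space)
  qed
  finally show "expectation (\<lambda>\<omega>. if x < Z i \<omega> then 1 else 0) = 1 - clamp01 x ^ i" using le by simp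
qed

text \<open>The variables other than Z_l are independent of Z_l, so Fubini allows integrating over
  Z_l first, and that inner integral vanishes for every y. All orthogonality relations of the
  remainder go back to this.\<close>

lemma expectation_degenerate:
  fixes F :: "(nat \<Rightarrow> real) \<Rightarrow> real \<Rightarrow> real"
  assumes l: "l \<in> {1..n}"
    and F [measurable]: "(\<lambda>(y, z). F y z) \<in> borel_measurable (PiM ({1..n} - {l}) (\<lambda>_. borel) \<Otimes>\<^sub>M borel)"
    and bound: "\<And>y z. \<bar>F y z\<bar> \<le> B"
    and zero: "\<And>y. expectation (\<lambda>\<omega>. F y (Z l \<omega>)) = 0"
  shows "expectation (\<lambda>\<omega>. F (restrict (\<lambda>i. Z i \<omega>) ({1..n} - {l})) (Z l \<omega>)) = 0"
proof -
  define N where "N = PiM ({1..n} - {l}) (\<lambda>_. borel :: real measure)"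
  define Y where "Y \<omega> = restrict (\<lambda>i. Z i \<omega>) ({1..n} - {l})" for \<omega>
  \<comment> \<open>Z_l is carried as a family with one coordinate, so that it is the second of two
    disjoint blocks.\<close>
  define L where "L = PiM {l} (\<lambda>_. borel :: real measure)"
  define V where "V \<omega> = restrict (\<lambda>i. Z i \<omega>) {l}" for \<omega>
  have ind: "indep_var N Y L V"
    unfolding N_def L_def Y_def[abs_def] V_def[abs_def] by (rule indep_var_restrict[OF indep_Z]) (use l in auto)
  have [measurable]: "Y \<in> measurable M N" "V \<in> measurable M L"
    using indep_var_rv1[OF ind] indep_var_rv2[OF ind] .
  have Ll [measurable]: "(\<lambda>v. v l) \<in> borel_measurable L" unfolding L_def by measurable
  interpret P: prob_space "distr M N Y" by (rule prob_space_distr) simp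
  interpret Q: prob_space "distr M L V" by (rule prob_space_distr) simp
  interpret PQ: pair_prob_space "distr M N Y" "distr M L V" ..
  have eq: "distr M N Y \<Otimes>\<^sub>M distr M L V = distr M (N \<Otimes>\<^sub>M L) (\<lambda>\<omega>. (Y \<omega>, V \<omega>))"
    using ind unfolding indep_var_distribution_eq by simp
  have Fm: "(\<lambda>p. F (fst p) (snd p l)) \<in> borel_measurable (N \<Otimes>\<^sub>M L)"
  proof -
    have "(\<lambda>p. (fst p, snd p l)) \<in> measurable (N \<Otimes>\<^sub>M L) (N \<Otimes>\<^sub>M borel)" by measurable
    from measurable_compose[OF this F[folded N_def]] show ?thesis by simp
  qed
  have Fy: "(\<lambda>v. F y (v l)) \<in> borel_measurable L" if "y \<in> space N" for y
    using measurable_Pair2[OF Fm that] by simp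
  have int: "integrable (distr M N Y \<Otimes>\<^sub>M distr M L V) (\<lambda>p. F (fst p) (snd p l))"
    by (rule PQ.P.integrable_const_bound[where B = B]) (use bound Fm in auto)
  have "expectation (\<lambda>\<omega>. F (Y \<omega>) (V \<omega> l)) = integral\<^sup>L (distr M (N \<Otimes>\<^sub>M L) (\<lambda>\<omega>. (Y \<omega>, V \<omega>))) (\<lambda>p. F (fst p) (snd p l))"
    using Fm by (subst integral_distr) auto
  also have "\<dots> = (\<integral>y. (\<integral>v. F y (v l) \<partial>distr M L V) \<partial>distr M N Y)"
    using PQ.integral_fst'[OF int] by (simp add: eq)
  also have "\<dots> = (\<integral>y. 0 \<partial>distr M N Y)"
  proof (rule Bochner_Integration.integral_cong)
    fix y assume "y \<in> space (distr M N Y)"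
    then have "(\<integral>v. F y (v l) \<partial>distr M L V) = expectation (\<lambda>\<omega>. F y (V \<omega> l))"
      using Fy[of y] by (subst integral_distr) auto
    then show "(\<integral>v. F y (v l) \<partial>distr M L V) = 0" by (simp add: V_def zero)
  qed simp
  finally show ?thesis by (simp add: Y_def V_def)
qed

end

section \<open>Hoeffding decomposition of the number of inversions\<close>

definition hoeffding_proj :: "nat \<Rightarrow> nat \<Rightarrow> real \<Rightarrow> real" where
  "hoeffding_proj n i x = (\<Sum>j=1..n. order_sign i j * (clamp01 x ^ j - real i / (real i + real j)))"

text \<open>The indicator of y < x minus its two conditional means x^j (given Z_i = x) and 1 - y^i
  (given Z_j = y), plus the mean i / (i + j). The constants -1 + i / (i + j) combine to -j / (i +
  j).\<close>

definition hoeffding_rem :: "nat \<Rightarrow> nat \<Rightarrow> real \<Rightarrow> real \<Rightarrow> real" where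
  "hoeffding_rem i j x y = (if y < x then 1 else 0) - clamp01 x ^ j + clamp01 y ^ i - real j / (real i + real j)"

lemma borel_measurable_hoeffding_proj [measurable]: "hoeffding_proj n i \<in> borel_measurable borel"
  unfolding hoeffding_proj_def[abs_def] by measurable

lemma borel_measurable_hoeffding_rem [measurable]:
  assumes [measurable]: "f \<in> borel_measurable N" "g \<in> borel_measurable N"
  shows "(\<lambda>\<omega>. hoeffding_rem i j (f \<omega>) (g \<omega>)) \<in> borel_measurable N"
  unfolding hoeffding_rem_def by measurable

lemma fraction_range: "0 \<le> real j / (real i + real j)" "real j / (real i + real j) \<le> 1"
  by (auto simp: divide_le_eq_1)

lemma abs_clamp01_power_diff_le: "\<bar>clamp01 x ^ k - real i / (real i + real j)\<bar> \<le> 1"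
proof -
  have "0 \<le> real i / (real i + real j)" "real i / (real i + real j) \<le> 1" by (auto simp: divide_le_eq_1)
  then show ?thesis using clamp01_power_range[of x k] by (intro abs_leI; linarith)
qed

lemma abs_hoeffding_rem_le: "\<bar>hoeffding_rem i j x y\<bar> \<le> 2"
  using clamp01_power_range[of x j] clamp01_power_range[of y i] fraction_range[of j i]
  unfolding hoeffding_rem_def by (intro abs_leI; cases "y < x"; simp only: if_True if_False; linarith)

lemma abs_hoeffding_proj_le: "\<bar>hoeffding_proj n i x\<bar> \<le> real n"
proof -
  have "\<bar>hoeffding_proj n i x\<bar> \<le> (\<Sum>j=1..n. 1)"
    unfolding hoeffding_proj_def
  proof (intro sum_abs[THEN order_trans] sum_mono)
    fix j
    have "\<bar>order_sign i j\<bar> \<le> 1" by (simp add: order_sign_def)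
    moreover note abs_clamp01_power_diff_le[of x j i j]
    ultimately have "\<bar>order_sign i j\<bar> * \<bar>clamp01 x ^ j - real i / (real i + real j)\<bar> \<le> 1 * 1"
      by (intro mult_mono) auto
    then show "\<bar>order_sign i j * (clamp01 x ^ j - real i / (real i + real j))\<bar> \<le> 1"
      by (simp add: abs_mult)
  qed
  then show ?thesis by simp
qed

text \<open>Each ordered pair is joined with its reverse, so that a possible inversion i < j
  collects the contribution of Z_i with sign + and that of Z_j with sign -.\<close>

lemma sum_order_sign:
  "(\<Sum>i=1..n. \<Sum>j=1..n. order_sign i j * a i j) = (\<Sum>j=1..n. \<Sum>i=1..<j. a i j - a j i)"
proof (induction n)
  case (Suc n)
  have "(\<Sum>i=1..n. order_sign i (Suc n) * a i (Suc n)) = (\<Sum>i=1..n. a i (Suc n))"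
    "(\<Sum>j=1..n. order_sign (Suc n) j * a (Suc n) j) = (\<Sum>i=1..n. - a (Suc n) i)"
    by (intro sum.cong; auto simp: order_sign_def)+
  moreover have "order_sign (Suc n) (Suc n) = 0" by (simp add: order_sign_def)
  moreover have "{1..<Suc n} = {1..n}" by auto
  ultimately show ?case using Suc by (simp add: sum.distrib sum_subtractf sum_negf)
qed simp

definition mean_inversions :: "nat \<Rightarrow> real" where
  "mean_inversions n = (\<Sum>j=1..n. \<Sum>i=1..<j. real i / (real i + real j))"

context unfair_array
begin

abbreviation Inv :: "'a \<Rightarrow> real" where
  "Inv \<equiv> \<lambda>\<omega>. real (inversions n (inverse_unfair n X \<omega>))"

text \<open>Ranks count the values below or equal, so tied values get equal ranks. The equivalence
  therefore holds for every outcome and no null set has to be removed.\<close>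

lemma inverse_unfair_less_iff:
  assumes "i \<in> {1..n}" "j \<in> {1..n}"
  shows "inverse_unfair n X \<omega> j < inverse_unfair n X \<omega> i \<longleftrightarrow> Z j \<omega> < Z i \<omega>"
proof
  assume "Z j \<omega> < Z i \<omega>"
  then have "{k \<in> {1..n}. Z k \<omega> \<le> Z j \<omega>} \<subseteq> {k \<in> {1..n}. Z k \<omega> \<le> Z i \<omega>}"
    "i \<in> {k \<in> {1..n}. Z k \<omega> \<le> Z i \<omega>}" "i \<notin> {k \<in> {1..n}. Z k \<omega> \<le> Z j \<omega>}"
    using assms by auto
  then have "{k \<in> {1..n}. Z k \<omega> \<le> Z j \<omega>} \<subset> {k \<in> {1..n}. Z k \<omega> \<le> Z i \<omega>}" by blast
  then show "inverse_unfair n X \<omega> j < inverse_unfair n X \<omega> i"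
    using assms by (simp add: inverse_unfair_def psubset_card_mono)
next
  assume l: "inverse_unfair n X \<omega> j < inverse_unfair n X \<omega> i"
  show "Z j \<omega> < Z i \<omega>"
  proof (rule ccontr)
    assume "\<not> Z j \<omega> < Z i \<omega>"
    then have "card {k \<in> {1..n}. Z k \<omega> \<le> Z i \<omega>} \<le> card {k \<in> {1..n}. Z k \<omega> \<le> Z j \<omega>}"
      by (intro card_mono) auto
    then show False using l assms by (simp add: inverse_unfair_def)
  qed
qed

lemma Inv_eq: "Inv \<omega> = (\<Sum>j=1..n. \<Sum>i=1..<j. if Z j \<omega> < Z i \<omega> then 1 else 0)"
  unfolding inversions_def of_nat_sum
  by (intro sum.cong refl) (auto simp: inverse_unfair_less_iff of_bool_def)

text \<open>The larger index comes first, matching sums over j and then over i < j; hence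
  \<open>fst\<close> and \<open>snd\<close> appear interchanged in the arguments of
  \<open>hoeffding_rem\<close>.\<close>

abbreviation pairs :: "(nat \<times> nat) set" where
  "pairs \<equiv> SIGMA j:{1..n}. {1..<j}"

definition proj_part :: "'a \<Rightarrow> real" where
  "proj_part \<omega> = (\<Sum>i=1..n. hoeffding_proj n i (Z i \<omega>))"

definition rem_term :: "nat \<times> nat \<Rightarrow> 'a \<Rightarrow> real" where
  "rem_term p \<omega> = hoeffding_rem (snd p) (fst p) (Z (snd p) \<omega>) (Z (fst p) \<omega>)"

definition rem_part :: "'a \<Rightarrow> real" where
  "rem_part \<omega> = (\<Sum>p\<in>pairs. rem_term p \<omega>)"

text \<open>Pairwise and for every outcome, the powers in the projection cancel those in the
  remainder, and so do the fractions; only the indicator is left.\<close>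

lemma Inv_decomposition: "Inv \<omega> = mean_inversions n + proj_part \<omega> + rem_part \<omega>"
proof -
  define a where "a i j = clamp01 (Z i \<omega>) ^ j - real i / (real i + real j)" for i j
  have "proj_part \<omega> = (\<Sum>j=1..n. \<Sum>i=1..<j. a i j - a j i)"
    unfolding proj_part_def hoeffding_proj_def sum_order_sign[symmetric] a_def ..
  moreover have "rem_part \<omega> = (\<Sum>j=1..n. \<Sum>i=1..<j. rem_term (j, i) \<omega>)"
    unfolding rem_part_def by (subst sum.Sigma) auto
  ultimately have "mean_inversions n + proj_part \<omega> + rem_part \<omega>
     = (\<Sum>j=1..n. \<Sum>i=1..<j. real i / (real i + real j) + (a i j - a j i) + rem_term (j, i) \<omega>)"
    by (simp add: mean_inversions_def sum.distrib)
  also have "\<dots> = Inv \<omega>"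
    unfolding Inv_eq
  proof (intro sum.cong refl)
    fix j i assume "j \<in> {1..n}" "i \<in> {1..<j}"
    then have "real i / (real i + real j) + real j / (real i + real j) = 1"
      by (simp add: add_divide_distrib[symmetric])
    then show "real i / (real i + real j) + (a i j - a j i) + rem_term (j, i) \<omega> = (if Z j \<omega> < Z i \<omega> then 1 else 0)"
      by (simp add: a_def rem_term_def hoeffding_rem_def add.commute)
  qed
  finally show ?thesis by simp
qed

lemma rem_term_measurable [measurable]: "p \<in> pairs \<Longrightarrow> rem_term p \<in> borel_measurable M"
proof -
  assume "p \<in> pairs"
  then have [measurable]: "Z (fst p) \<in> borel_measurable M" "Z (snd p) \<in> borel_measurable M"
    by (auto intro!: Z_measurable)
  show ?thesis unfolding rem_term_def[abs_def] by measurable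
qed

lemma abs_rem_term_le: "\<bar>rem_term p \<omega>\<bar> \<le> 2"
  unfolding rem_term_def by (rule abs_hoeffding_rem_le)

lemma proj_measurable [measurable]:
  "i \<in> {1..n} \<Longrightarrow> (\<lambda>\<omega>. hoeffding_proj n i (Z i \<omega>)) \<in> borel_measurable M"
  using Z_measurable[of i] by measurable

lemma integrable_bounded:
  fixes f :: "'a \<Rightarrow> real"
  assumes "f \<in> borel_measurable M" "\<And>\<omega>. \<bar>f \<omega>\<bar> \<le> B"
  shows "integrable M f"
  by (rule integrable_const_bound[where B = B]) (use assms in auto)

lemma integrable_mult_bounded:
  fixes f g :: "'a \<Rightarrow> real"
  assumes [measurable]: "f \<in> borel_measurable M" "g \<in> borel_measurable M"
    and B: "\<And>\<omega>. \<bar>f \<omega>\<bar> \<le> B" "\<And>\<omega>. \<bar>g \<omega>\<bar> \<le> C"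
  shows "integrable M (\<lambda>\<omega>. f \<omega> * g \<omega>)"
proof (rule integrable_bounded[where B = "B * C"])
  have "0 \<le> B" using B(1)[of undefined] by linarith
  then show "\<bar>f \<omega> * g \<omega>\<bar> \<le> B * C" for \<omega> unfolding abs_mult by (intro mult_mono B) auto
qed simp

lemma integrable_clamp01: "i \<in> {1..n} \<Longrightarrow> integrable M (\<lambda>\<omega>. clamp01 (Z i \<omega>) ^ k)"
  using Z_measurable[of i] clamp01_power_range by (intro integrable_bounded[where B = 1]) auto

lemma expectation_hoeffding_rem:
  assumes i: "i \<in> {1..n}" and j: "j \<in> {1..n}"
  shows "expectation (\<lambda>\<omega>. hoeffding_rem i j x (Z j \<omega>)) = 0"
    and "expectation (\<lambda>\<omega>. hoeffding_rem i j (Z i \<omega>) y) = 0"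
proof -
  note [measurable] = Z_measurable[OF i] Z_measurable[OF j]
  have I: "integrable M (\<lambda>\<omega>. if Z j \<omega> < x then 1 else 0 :: real)" "integrable M (\<lambda>\<omega>. if y < Z i \<omega> then 1 else 0 :: real)"
    by (rule integrable_bounded[where B = 1]; auto)+
  show "expectation (\<lambda>\<omega>. hoeffding_rem i j x (Z j \<omega>)) = 0"
    unfolding hoeffding_rem_def using I integrable_clamp01[OF j, of i]
    by (simp add: expectation_Z_less[OF j] expectation_clamp01_power[OF j] prob_space add.commute)
  have "real i / (real i + real j) + real j / (real i + real j) = 1"
    using i by (simp add: add_divide_distrib[symmetric])
  then show "expectation (\<lambda>\<omega>. hoeffding_rem i j (Z i \<omega>) y) = 0"
    unfolding hoeffding_rem_def using I integrable_clamp01[OF i, of j]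
    by (simp add: expectation_Z_less[OF i] expectation_clamp01_power[OF i] prob_space)
qed

text \<open>A remainder term has mean 0 in either of its two variables when the other is fixed.
  Hence it is orthogonal to any bounded function that avoids one of them. The three lemmas below
  differ only in the choice of l and q.\<close>

lemma rem_orthogonal:
  fixes q :: "(nat \<Rightarrow> real) \<Rightarrow> real"
  assumes p: "p \<in> pairs" and l: "l = fst p \<or> l = snd p"
    and q [measurable]: "q \<in> borel_measurable (PiM ({1..n} - {l}) (\<lambda>_. borel))" and qb: "\<And>y. \<bar>q y\<bar> \<le> B"
  shows "expectation (\<lambda>\<omega>. q (restrict (\<lambda>i. Z i \<omega>) ({1..n} - {l})) * rem_term p \<omega>) = 0"
proof -
  obtain j i where ji: "p = (j, i)" by force
  have r: "i \<in> {1..n}" "j \<in> {1..n}" "i \<noteq> j" using p ji by auto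
  have B: "0 \<le> B" using qb[of undefined] by linarith
  have bound: "\<bar>q y * hoeffding_rem i' j' x z\<bar> \<le> B * 2" for y i' j' x z
    unfolding abs_mult by (intro mult_mono qb abs_hoeffding_rem_le) (use B in auto)
  from l ji consider "l = j" | "l = i" by auto
  then show ?thesis
  proof cases
    case 1
    have [measurable]: "(\<lambda>f. f i) \<in> borel_measurable (PiM ({1..n} - {l}) (\<lambda>_. borel :: real measure))"
      by (rule measurable_component_singleton) (use r 1 in auto)
    have "expectation (\<lambda>\<omega>. (\<lambda>y z. q y * hoeffding_rem i j (y i) z) (restrict (\<lambda>i. Z i \<omega>) ({1..n} - {l})) (Z l \<omega>)) = 0"
    proof (rule expectation_degenerate[where B = "B * 2"])
      show "(\<lambda>(y, z). q y * hoeffding_rem i j (y i) z) \<in> borel_measurable (PiM ({1..n} - {l}) (\<lambda>_. borel) \<Otimes>\<^sub>M borel)"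
        by measurable
    qed (use r 1 bound expectation_hoeffding_rem(1)[OF r(1,2)] in auto)
    then show ?thesis using r 1 by (simp add: rem_term_def ji)
  next
    case 2
    have [measurable]: "(\<lambda>f. f j) \<in> borel_measurable (PiM ({1..n} - {l}) (\<lambda>_. borel :: real measure))"
      by (rule measurable_component_singleton) (use r 2 in auto)
    have "expectation (\<lambda>\<omega>. (\<lambda>y z. q y * hoeffding_rem i j z (y j)) (restrict (\<lambda>i. Z i \<omega>) ({1..n} - {l})) (Z l \<omega>)) = 0"
    proof (rule expectation_degenerate[where B = "B * 2"])
      show "(\<lambda>(y, z). q y * hoeffding_rem i j z (y j)) \<in> borel_measurable (PiM ({1..n} - {l}) (\<lambda>_. borel) \<Otimes>\<^sub>M borel)"
        by measurable
    qed (use r 2 bound expectation_hoeffding_rem(2)[OF r(1,2)] in auto)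
    then show ?thesis using r 2 by (simp add: rem_term_def ji)
  qed
qed

lemma expectation_rem:
  assumes p: "p \<in> pairs"
  shows "expectation (rem_term p) = 0"
  using rem_orthogonal[OF p, of "fst p" "\<lambda>_. 1" 1] by simp

text \<open>A pair has two distinct indices, so at least one of them differs from m and can be
  integrated out.\<close>

lemma expectation_proj_rem:
  assumes p: "p \<in> pairs" and m: "m \<in> {1..n}"
  shows "expectation (\<lambda>\<omega>. hoeffding_proj n m (Z m \<omega>) * rem_term p \<omega>) = 0"
proof -
  obtain l where l: "l = fst p \<or> l = snd p" "l \<noteq> m" using p by (cases "fst p = m") auto
  have [measurable]: "(\<lambda>f. f m) \<in> borel_measurable (PiM ({1..n} - {l}) (\<lambda>_. borel :: real measure))"
    by (rule measurable_component_singleton) (use l m in auto)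
  have "expectation (\<lambda>\<omega>. hoeffding_proj n m (restrict (\<lambda>i. Z i \<omega>) ({1..n} - {l}) m) * rem_term p \<omega>) = 0"
    by (rule rem_orthogonal[OF p l(1) _ abs_hoeffding_proj_le]) measurable
  then show ?thesis using l m by simp
qed

lemma expectation_rem_rem:
  assumes p: "p \<in> pairs" and p': "p' \<in> pairs" and ne: "p \<noteq> p'"
  shows "expectation (\<lambda>\<omega>. rem_term p' \<omega> * rem_term p \<omega>) = 0"
proof -
  obtain j i j' i' where ji: "p = (j, i)" "p' = (j', i')" by force
  have r: "i \<in> {1..n}" "j \<in> {1..n}" "i < j" "i' \<in> {1..n}" "j' \<in> {1..n}" "i' < j'" using p p' ji by auto
  \<comment> \<open>If both indices of p occurred in p', the two ordered pairs would
    coincide.\<close>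
  have "\<exists>l. (l = fst p \<or> l = snd p) \<and> l \<noteq> i' \<and> l \<noteq> j'"
  proof (rule ccontr)
    assume "\<not> ?thesis"
    then have "j = i' \<or> j = j'" "i = i' \<or> i = j'" by (auto simp only: ji fst_conv snd_conv)
    then have "j = j'" "i = i'" using r by linarith+
    then show False using ne ji by simp
  qed
  then obtain l where l: "l = fst p \<or> l = snd p" "l \<noteq> i'" "l \<noteq> j'" by blast
  have [measurable]: "(\<lambda>f. f i') \<in> borel_measurable (PiM ({1..n} - {l}) (\<lambda>_. borel :: real measure))"
    "(\<lambda>f. f j') \<in> borel_measurable (PiM ({1..n} - {l}) (\<lambda>_. borel :: real measure))"
    by (rule measurable_component_singleton; use l r in auto)+
  have "expectation (\<lambda>\<omega>. (\<lambda>y. hoeffding_rem i' j' (y i') (y j')) (restrict (\<lambda>i. Z i \<omega>) ({1..n} - {l})) * rem_term p \<omega>) = 0"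
    by (rule rem_orthogonal[OF p l(1) _ abs_hoeffding_rem_le]) measurable
  then show ?thesis using l r by (simp add: rem_term_def ji)
qed

lemma expectation_hoeffding_proj:
  assumes i: "i \<in> {1..n}"
  shows "expectation (\<lambda>\<omega>. hoeffding_proj n i (Z i \<omega>)) = 0"
  unfolding hoeffding_proj_def using integrable_clamp01[OF i]
  by (subst Bochner_Integration.integral_sum) (auto simp: expectation_clamp01_power[OF i] prob_space)

text \<open>The covariance of Z_i^j and Z_i^k is x / (x + y + z) - x^2 / ((x + y) (x + z)) with x,
  y, z for i, j, k. Its numerator collapses by (x + y) (x + z) - x (x + y + z) = y z to
  \<open>cov_kernel\<close>.\<close>

lemma expectation_hoeffding_proj_square:
  assumes i: "i \<in> {1..n}"
  shows "expectation (\<lambda>\<omega>. (hoeffding_proj n i (Z i \<omega>))\<^sup>2)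
    = (\<Sum>j=1..n. \<Sum>k=1..n. order_sign i j * order_sign i k * cov_kernel i j k)"
proof -
  define a where "a j = real i / (real i + real j)" for j
  have cov: "expectation (\<lambda>\<omega>. (clamp01 (Z i \<omega>) ^ j - a j) * (clamp01 (Z i \<omega>) ^ k - a k)) = cov_kernel i j k" for j k
  proof -
    have "expectation (\<lambda>\<omega>. (clamp01 (Z i \<omega>) ^ j - a j) * (clamp01 (Z i \<omega>) ^ k - a k))
        = expectation (\<lambda>\<omega>. clamp01 (Z i \<omega>) ^ (j + k) - a k * clamp01 (Z i \<omega>) ^ j - a j * clamp01 (Z i \<omega>) ^ k + a j * a k)"
      by (intro Bochner_Integration.integral_cong) (auto simp: algebra_simps power_add)
    also have "\<dots> = a (j + k) - a j * a k"
      using integrable_clamp01[OF i] by (simp add: expectation_clamp01_power[OF i] prob_space a_def)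
    also have "\<dots> = cov_kernel i j k"
    proof -
      define x y z where "x = real i" and "y = real j" and "z = real k"
      have nn: "x > 0" "y \<ge> 0" "z \<ge> 0" using i by (auto simp: x_def y_def z_def)
      define p q r where "p = x + y" and "q = x + z" and "r = x + y + z"
      have pos: "p \<noteq> 0" "q \<noteq> 0" "r \<noteq> 0" using nn by (auto simp: p_def q_def r_def)
      have "x / r - (x / p) * (x / q) = x * (p * q - x * r) / (p * q * r)"
        using pos by (simp add: field_simps)
      also have "p * q - x * r = y * z" by (simp add: p_def q_def r_def algebra_simps)
      finally show ?thesis
        by (simp add: a_def cov_kernel_def p_def q_def r_def x_def y_def z_def mult.assoc add.assoc)
    qed
    finally show ?thesis .
  qed
  have sq: "(hoeffding_proj n i x)\<^sup>2 = (\<Sum>j=1..n. \<Sum>k=1..n. order_sign i j * order_sign i k *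
      ((clamp01 x ^ j - a j) * (clamp01 x ^ k - a k)))" for x
    unfolding power2_eq_square hoeffding_proj_def sum_product a_def by (intro sum.cong refl) (simp add: mult_ac)
  have int: "integrable M (\<lambda>\<omega>. (clamp01 (Z i \<omega>) ^ j - a j) * (clamp01 (Z i \<omega>) ^ k - a k))" for j k
  proof -
    note [measurable] = Z_measurable[OF i]
    have "\<bar>clamp01 x ^ j - a j\<bar> \<le> 1" for x j
      unfolding a_def by (rule abs_clamp01_power_diff_le)
    then show ?thesis by (intro integrable_mult_bounded[where B = 1 and C = 1]) auto
  qed
  show ?thesis unfolding sq using int
    by (simp add: cov)
qed

lemma proj_part_measurable [measurable]: "proj_part \<in> borel_measurable M"
  unfolding proj_part_def[abs_def] by measurable

lemma rem_part_measurable [measurable]: "rem_part \<in> borel_measurable M"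
  unfolding rem_part_def[abs_def] by (intro borel_measurable_sum rem_term_measurable)

lemma abs_proj_part_le: "\<bar>proj_part \<omega>\<bar> \<le> real n * real n"
proof -
  have "\<bar>proj_part \<omega>\<bar> \<le> (\<Sum>i=1..n. real n)"
    unfolding proj_part_def by (intro sum_abs[THEN order_trans] sum_mono abs_hoeffding_proj_le)
  then show ?thesis by simp
qed

lemma card_pairs_le: "real (card pairs) \<le> real n * real n"
proof -
  have "card pairs \<le> card ({1..n} \<times> {1..n})" by (rule card_mono) auto
  then have "real (card pairs) \<le> real (n * n)" by (intro of_nat_mono) simp
  then show ?thesis by simp
qed

lemma abs_rem_part_le: "\<bar>rem_part \<omega>\<bar> \<le> 2 * (real n * real n)"
proof -
  have "\<bar>rem_part \<omega>\<bar> \<le> (\<Sum>p\<in>pairs. 2)"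
    unfolding rem_part_def by (intro sum_abs[THEN order_trans] sum_mono abs_rem_term_le)
  also have "\<dots> \<le> 2 * (real n * real n)" unfolding sum_constant using card_pairs_le by linarith
  finally show ?thesis .
qed

lemma indep_proj: "indep_vars (\<lambda>_. borel) (\<lambda>i \<omega>. hoeffding_proj n i (Z i \<omega>)) {1..n}"
  by (rule indep_vars_compose2[OF indep_Z]) simp

lemma expectation_parts: "expectation proj_part = 0" "expectation rem_part = 0"
proof -
  have "integrable M (\<lambda>\<omega>. hoeffding_proj n i (Z i \<omega>))" if "i \<in> {1..n}" for i
    using that by (intro integrable_bounded[where B = n] proj_measurable abs_hoeffding_proj_le)
  then show "expectation proj_part = 0"
    unfolding proj_part_def[abs_def] by (simp add: expectation_hoeffding_proj)
  have "integrable M (rem_term p)" if "p \<in> pairs" for p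
    using that by (intro integrable_bounded[where B = 2] rem_term_measurable abs_rem_term_le)
  then show "expectation rem_part = 0"
    unfolding rem_part_def[abs_def] using expectation_rem by (subst Bochner_Integration.integral_sum) auto
qed

lemma expectation_proj_part_square: "expectation (\<lambda>\<omega>. (proj_part \<omega>)\<^sup>2) = proj_var n"
proof -
  let ?\<xi> = "\<lambda>i \<omega>. hoeffding_proj n i (Z i \<omega>)"
  have int: "integrable M (\<lambda>\<omega>. ?\<xi> i \<omega> * ?\<xi> j \<omega>)" if "i \<in> {1..n}" "j \<in> {1..n}" for i j
    by (intro integrable_mult_bounded[where B = n and C = n] proj_measurable that abs_hoeffding_proj_le)
  have off: "expectation (\<lambda>\<omega>. ?\<xi> i \<omega> * ?\<xi> j \<omega>) = 0" if ij: "i \<in> {1..n}" "j \<in> {1..n}" "i \<noteq> j" for i j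
  proof -
    have "indep_var borel (?\<xi> i) borel (\<lambda>\<omega>. \<Sum>i\<in>{j}. ?\<xi> i \<omega>)"
      by (rule indep_vars_sum) (use ij indep_vars_subset[OF indep_proj] in auto)
    then have "indep_var borel (?\<xi> i) borel (?\<xi> j)" by simp
    then have "expectation (\<lambda>\<omega>. ?\<xi> i \<omega> * ?\<xi> j \<omega>) = expectation (?\<xi> i) * expectation (?\<xi> j)"
      using ij by (intro indep_var_lebesgue_integral integrable_bounded[where B = n] proj_measurable abs_hoeffding_proj_le)
    then show ?thesis using ij by (simp add: expectation_hoeffding_proj)
  qed
  have "expectation (\<lambda>\<omega>. (proj_part \<omega>)\<^sup>2) = (\<Sum>i=1..n. \<Sum>j=1..n. expectation (\<lambda>\<omega>. ?\<xi> i \<omega> * ?\<xi> j \<omega>))"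
    unfolding power2_eq_square proj_part_def sum_product
    by (subst Bochner_Integration.integral_sum, force intro: Bochner_Integration.integrable_sum int)
       (intro sum.cong refl Bochner_Integration.integral_sum int)
  also have "\<dots> = (\<Sum>i=1..n. expectation (\<lambda>\<omega>. (?\<xi> i \<omega>)\<^sup>2))"
  proof (intro sum.cong refl)
    fix i assume i: "i \<in> {1..n}"
    have "(\<Sum>j=1..n. expectation (\<lambda>\<omega>. ?\<xi> i \<omega> * ?\<xi> j \<omega>)) = (\<Sum>j\<in>{i}. expectation (\<lambda>\<omega>. ?\<xi> i \<omega> * ?\<xi> j \<omega>))"
      by (rule sum.mono_neutral_right) (use i off in auto)
    then show "(\<Sum>j=1..n. expectation (\<lambda>\<omega>. ?\<xi> i \<omega> * ?\<xi> j \<omega>)) = expectation (\<lambda>\<omega>. (?\<xi> i \<omega>)\<^sup>2)"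
      by (simp add: power2_eq_square)
  qed
  also have "\<dots> = proj_var n"
    unfolding proj_var_def by (intro sum.cong refl expectation_hoeffding_proj_square)
  finally show ?thesis .
qed

text \<open>Only the diagonal of the double sum survives: at most n^2 squares, each bounded by
  4.\<close>

lemma expectation_rem_part_square: "expectation (\<lambda>\<omega>. (rem_part \<omega>)\<^sup>2) \<le> (2 * real n)\<^sup>2"
proof -
  have int: "integrable M (\<lambda>\<omega>. rem_term p \<omega> * rem_term q \<omega>)" if "p \<in> pairs" "q \<in> pairs" for p q
    by (intro integrable_mult_bounded[where B = 2 and C = 2] rem_term_measurable that abs_rem_term_le)
  have "expectation (\<lambda>\<omega>. (rem_part \<omega>)\<^sup>2) = (\<Sum>p\<in>pairs. \<Sum>q\<in>pairs. expectation (\<lambda>\<omega>. rem_term p \<omega> * rem_term q \<omega>))"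
    unfolding power2_eq_square rem_part_def sum_product
    by (subst Bochner_Integration.integral_sum, force intro: Bochner_Integration.integrable_sum int)
       (intro sum.cong refl Bochner_Integration.integral_sum int)
  also have "\<dots> = (\<Sum>p\<in>pairs. expectation (\<lambda>\<omega>. rem_term p \<omega> * rem_term p \<omega>))"
  proof (intro sum.cong refl)
    fix p assume p: "p \<in> pairs"
    have "(\<Sum>q\<in>pairs. expectation (\<lambda>\<omega>. rem_term p \<omega> * rem_term q \<omega>)) = (\<Sum>q\<in>{p}. expectation (\<lambda>\<omega>. rem_term p \<omega> * rem_term q \<omega>))"
      by (rule sum.mono_neutral_right) (use p expectation_rem_rem in auto)
    then show "(\<Sum>q\<in>pairs. expectation (\<lambda>\<omega>. rem_term p \<omega> * rem_term q \<omega>)) = expectation (\<lambda>\<omega>. rem_term p \<omega> * rem_term p \<omega>)" by simp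
  qed
  also have "\<dots> \<le> (\<Sum>p\<in>pairs. 4)"
  proof (intro sum_mono)
    fix p assume p: "p \<in> pairs"
    have "rem_term p \<omega> * rem_term p \<omega> \<le> 2 * 2" for \<omega>
      using mult_mono[OF abs_rem_term_le abs_rem_term_le, of p \<omega> p \<omega>] by (simp flip: abs_mult)
    then have "expectation (\<lambda>\<omega>. rem_term p \<omega> * rem_term p \<omega>) \<le> expectation (\<lambda>\<omega>. 4)"
      by (intro integral_mono int p) auto
    then show "expectation (\<lambda>\<omega>. rem_term p \<omega> * rem_term p \<omega>) \<le> 4" by (simp add: prob_space)
  qed
  also have "\<dots> \<le> (2 * real n)\<^sup>2"
    unfolding sum_constant using card_pairs_le by (simp only: power2_eq_square)
  finally show ?thesis .
qed

lemma expectation_proj_part_rem_part: "expectation (\<lambda>\<omega>. proj_part \<omega> * rem_part \<omega>) = 0"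
proof -
  have int: "integrable M (\<lambda>\<omega>. hoeffding_proj n i (Z i \<omega>) * rem_term p \<omega>)" if "i \<in> {1..n}" "p \<in> pairs" for i p
    by (intro integrable_mult_bounded[where B = n and C = 2] proj_measurable rem_term_measurable that abs_rem_term_le abs_hoeffding_proj_le)
  have "expectation (\<lambda>\<omega>. proj_part \<omega> * rem_part \<omega>) = (\<Sum>i=1..n. \<Sum>p\<in>pairs. expectation (\<lambda>\<omega>. hoeffding_proj n i (Z i \<omega>) * rem_term p \<omega>))"
    unfolding proj_part_def rem_part_def sum_product
    by (subst Bochner_Integration.integral_sum, force intro: Bochner_Integration.integrable_sum int)
       (intro sum.cong refl Bochner_Integration.integral_sum int)
  also have "\<dots> = 0" by (intro sum.neutral ballI expectation_proj_rem)
  finally show ?thesis .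
qed

text \<open>The cross term vanishes by orthogonality. Consequently the standard deviation lies
  between sqrt(proj_var n) and sqrt(proj_var n) + 2n, which is how the true normalisation is
  compared with that of the projection.\<close>

lemma variance_Inv: "variance Inv = proj_var n + expectation (\<lambda>\<omega>. (rem_part \<omega>)\<^sup>2)"
proof -
  have i1: "integrable M proj_part" "integrable M rem_part"
    by (rule integrable_bounded[OF proj_part_measurable abs_proj_part_le], rule integrable_bounded[OF rem_part_measurable abs_rem_part_le])
  have i2: "integrable M (\<lambda>\<omega>. (proj_part \<omega>)\<^sup>2)" "integrable M (\<lambda>\<omega>. (rem_part \<omega>)\<^sup>2)" "integrable M (\<lambda>\<omega>. proj_part \<omega> * rem_part \<omega>)"
    unfolding power2_eq_square
    by (rule integrable_mult_bounded proj_part_measurable rem_part_measurable abs_proj_part_le abs_rem_part_le)+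
  have mean: "expectation Inv = mean_inversions n"
    unfolding Inv_decomposition using i1 by (simp add: expectation_parts prob_space)
  have "variance Inv = expectation (\<lambda>\<omega>. (proj_part \<omega>)\<^sup>2 + 2 * (proj_part \<omega> * rem_part \<omega>) + (rem_part \<omega>)\<^sup>2)"
    unfolding mean unfolding Inv_decomposition
    by (intro Bochner_Integration.integral_cong) (auto simp: power2_eq_square algebra_simps)
  also have "\<dots> = proj_var n + expectation (\<lambda>\<omega>. (rem_part \<omega>)\<^sup>2)"
    using i2 by (simp add: expectation_proj_part_square expectation_proj_part_rem_part)
  finally show ?thesis .
qed

end

section \<open>Normal approximation\<close>

text \<open>Cauchy-Schwarz against the constant 1, read off from the nonnegativity of the variance
  of |f|.\<close>

lemma (in prob_space) expectation_abs_le_sqrt: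
  fixes f :: "'a \<Rightarrow> real"
  assumes "integrable M f" "integrable M (\<lambda>\<omega>. (f \<omega>)\<^sup>2)"
  shows "expectation (\<lambda>\<omega>. \<bar>f \<omega>\<bar>) \<le> sqrt (expectation (\<lambda>\<omega>. (f \<omega>)\<^sup>2))"
proof (rule real_le_rsqrt)
  have "0 \<le> variance (\<lambda>\<omega>. \<bar>f \<omega>\<bar>)" by (rule variance_positive)
  then show "(expectation (\<lambda>\<omega>. \<bar>f \<omega>\<bar>))\<^sup>2 \<le> expectation (\<lambda>\<omega>. (f \<omega>)\<^sup>2)"
    using assms by (subst (asm) variance_eq) auto
qed

context unfair_array
begin

lemma Inv_measurable [measurable]: "Inv \<in> borel_measurable M"
  unfolding Inv_decomposition by measurable

lemma expectation_abs_parts: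
  "expectation (\<lambda>\<omega>. \<bar>proj_part \<omega>\<bar>) \<le> sqrt (proj_var n)"
  "expectation (\<lambda>\<omega>. \<bar>rem_part \<omega>\<bar>) \<le> 2 * real n"
proof -
  have i: "integrable M proj_part" "integrable M rem_part"
    by (rule integrable_bounded[OF proj_part_measurable abs_proj_part_le], rule integrable_bounded[OF rem_part_measurable abs_rem_part_le])
  have i2: "integrable M (\<lambda>\<omega>. (proj_part \<omega>)\<^sup>2)" "integrable M (\<lambda>\<omega>. (rem_part \<omega>)\<^sup>2)"
    unfolding power2_eq_square
    by (rule integrable_mult_bounded proj_part_measurable rem_part_measurable abs_proj_part_le abs_rem_part_le)+
  show "expectation (\<lambda>\<omega>. \<bar>proj_part \<omega>\<bar>) \<le> sqrt (proj_var n)"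
    using expectation_abs_le_sqrt[OF i(1) i2(1)] by (simp add: expectation_proj_part_square)
  have "sqrt (expectation (\<lambda>\<omega>. (rem_part \<omega>)\<^sup>2)) \<le> 2 * real n"
    using expectation_rem_part_square by (intro real_le_lsqrt) auto
  then show "expectation (\<lambda>\<omega>. \<bar>rem_part \<omega>\<bar>) \<le> 2 * real n"
    using expectation_abs_le_sqrt[OF i(2) i2(2)] by linarith
qed

lemma normalized_proj_normal_approx:
  assumes n: "n \<ge> 2" and h: "1-lipschitz_on UNIV h"
  shows "\<bar>expectation (\<lambda>\<omega>. h (proj_part \<omega> / sqrt (proj_var n))) - normal_mean h\<bar>
    \<le> 2 * stein_const * (real n / sqrt (proj_var n))"
proof -
  define \<sigma> where "\<sigma> = sqrt (proj_var n)"
  have \<sigma>: "\<sigma> > 0" "\<sigma>\<^sup>2 = proj_var n" using proj_var_pos[OF n] by (auto simp: \<sigma>_def)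
  let ?\<xi> = "\<lambda>i \<omega>. hoeffding_proj n i (Z i \<omega>) / \<sigma>"
  have "\<bar>expectation (\<lambda>\<omega>. h (\<Sum>i=1..n. ?\<xi> i \<omega>)) - normal_mean h\<bar> \<le> 2 * stein_const * (real n / \<sigma>)"
  proof (rule stein_lipschitz_bound)
    show "indep_vars (\<lambda>_. borel) ?\<xi> {1..n}"
      by (rule indep_vars_compose2[OF indep_proj]) simp
    show "AE \<omega> in M. \<bar>?\<xi> i \<omega>\<bar> \<le> real n / \<sigma>" for i
      using abs_hoeffding_proj_le \<sigma>(1) by (intro AE_I2) (simp add: divide_right_mono)
    show "expectation (?\<xi> i) = 0" if "i \<in> {1..n}" for i
      using expectation_hoeffding_proj[OF that] by simp
    have "(\<Sum>i=1..n. expectation (\<lambda>\<omega>. (?\<xi> i \<omega>)\<^sup>2)) = (\<Sum>i=1..n. expectation (\<lambda>\<omega>. (hoeffding_proj n i (Z i \<omega>))\<^sup>2)) / \<sigma>\<^sup>2"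
      by (simp add: power_divide sum_divide_distrib)
    also have "(\<Sum>i=1..n. expectation (\<lambda>\<omega>. (hoeffding_proj n i (Z i \<omega>))\<^sup>2)) = proj_var n"
      unfolding proj_var_def by (intro sum.cong refl expectation_hoeffding_proj_square)
    finally show "(\<Sum>i=1..n. expectation (\<lambda>\<omega>. (?\<xi> i \<omega>)\<^sup>2)) = 1" using \<sigma> proj_var_pos[OF n] by simp
  qed (use \<sigma> h in auto)
  then show ?thesis by (simp add: proj_part_def \<sigma>_def sum_divide_distrib)
qed

text \<open>Three sources of error: Stein's bound for the normalised projection; 2n / s from the
  centring and 2n / s from the remainder; and the change of scale from sqrt(proj_var n) to s, where
  E |S| \<le> sqrt(proj_var n) is used. The scale s is free so that it can be the true standard
  deviation as well as its asymptotic form.\<close>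

lemma Inv_normal_approx:
  assumes n: "n \<ge> 2" and s: "s > 0" and h: "1-lipschitz_on UNIV h"
  shows "\<bar>expectation (\<lambda>\<omega>. h ((Inv \<omega> - (1 - ln 2) / 2 * real n ^ 2) / s)) - normal_mean h\<bar>
    \<le> 2 * stein_const * (real n / sqrt (proj_var n)) + 4 * real n / s + \<bar>sqrt (proj_var n) / s - 1\<bar>"
proof -
  define \<sigma> where "\<sigma> = sqrt (proj_var n)"
  have \<sigma>: "\<sigma> > 0" using proj_var_pos[OF n] by (auto simp: \<sigma>_def)
  define d where "d = mean_inversions n - (1 - ln 2) / 2 * real n ^ 2"
  have d: "\<bar>d\<bar> \<le> 2 * real n" using mean_asymptotics[of n] by (simp add: d_def mean_inversions_def)
  have i: "integrable M proj_part" "integrable M rem_part"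
    by (rule integrable_bounded[OF proj_part_measurable abs_proj_part_le], rule integrable_bounded[OF rem_part_measurable abs_rem_part_le])
  define W where "W \<omega> = (Inv \<omega> - (1 - ln 2) / 2 * real n ^ 2) / s" for \<omega>
  define V where "V \<omega> = proj_part \<omega> / \<sigma>" for \<omega>
  have W: "W \<omega> = (d + proj_part \<omega> + rem_part \<omega>) / s" for \<omega>
    unfolding W_def Inv_decomposition d_def by (simp add: algebra_simps)
  have iW: "integrable M W" unfolding W using i by simp
  have iV: "integrable M V" unfolding V_def using i by simp
  define e where "e = \<bar>1 / s - 1 / \<sigma>\<bar>"
  have "\<bar>expectation (\<lambda>\<omega>. h (W \<omega>)) - expectation (\<lambda>\<omega>. h (V \<omega>))\<bar> = \<bar>expectation (\<lambda>\<omega>. h (W \<omega>) - h (V \<omega>))\<bar>"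
    using integrable_lipschitz[OF h iW] integrable_lipschitz[OF h iV] by simp
  also have "\<dots> \<le> expectation (\<lambda>\<omega>. \<bar>h (W \<omega>) - h (V \<omega>)\<bar>)" by (rule integral_abs_bound)
  also have "\<dots> \<le> expectation (\<lambda>\<omega>. \<bar>d\<bar> / s + \<bar>rem_part \<omega>\<bar> / s + \<bar>proj_part \<omega>\<bar> * e)"
  proof (rule integral_mono)
    show "integrable M (\<lambda>\<omega>. \<bar>h (W \<omega>) - h (V \<omega>)\<bar>)"
      using integrable_lipschitz[OF h iW] integrable_lipschitz[OF h iV] by auto
    show "integrable M (\<lambda>\<omega>. \<bar>d\<bar> / s + \<bar>rem_part \<omega>\<bar> / s + \<bar>proj_part \<omega>\<bar> * e)"
      using i by auto
    fix \<omega>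
    have "W \<omega> - V \<omega> = d / s + rem_part \<omega> / s + proj_part \<omega> * (1 / s - 1 / \<sigma>)"
      unfolding W V_def by (simp add: algebra_simps add_divide_distrib)
    also have "\<bar>\<dots>\<bar> \<le> \<bar>d / s\<bar> + \<bar>rem_part \<omega> / s\<bar> + \<bar>proj_part \<omega> * (1 / s - 1 / \<sigma>)\<bar>"
      by (rule order_trans[OF abs_triangle_ineq]) (intro add_right_mono abs_triangle_ineq)
    also have "\<dots> = \<bar>d\<bar> / s + \<bar>rem_part \<omega>\<bar> / s + \<bar>proj_part \<omega>\<bar> * e"
      using s by (simp add: e_def abs_mult)
    finally show "\<bar>h (W \<omega>) - h (V \<omega>)\<bar> \<le> \<bar>d\<bar> / s + \<bar>rem_part \<omega>\<bar> / s + \<bar>proj_part \<omega>\<bar> * e"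
      using lipschitz_1_abs_le[OF h, of "W \<omega>" "V \<omega>"] by linarith
  qed
  also have "\<dots> = \<bar>d\<bar> / s + expectation (\<lambda>\<omega>. \<bar>rem_part \<omega>\<bar>) / s + expectation (\<lambda>\<omega>. \<bar>proj_part \<omega>\<bar>) * e"
    using i by (simp add: prob_space)
  also have "\<dots> \<le> 2 * real n / s + 2 * real n / s + \<sigma> * e"
    using d s expectation_abs_parts by (intro add_mono divide_right_mono mult_right_mono) (auto simp: \<sigma>_def e_def)
  also have "\<sigma> * e = \<bar>\<sigma> / s - 1\<bar>"
  proof -
    have "\<sigma> / s - 1 = \<sigma> * (1 / s - 1 / \<sigma>)" using \<sigma> by (simp add: right_diff_distrib)
    then show ?thesis using \<sigma> by (simp add: e_def abs_mult)
  qed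
  finally have "\<bar>expectation (\<lambda>\<omega>. h (W \<omega>)) - expectation (\<lambda>\<omega>. h (V \<omega>))\<bar> \<le> 4 * real n / s + \<bar>\<sigma> / s - 1\<bar>" by simp
  moreover have "\<bar>expectation (\<lambda>\<omega>. h (V \<omega>)) - normal_mean h\<bar> \<le> 2 * stein_const * (real n / \<sigma>)"
    using normalized_proj_normal_approx[OF n h] by (simp add: V_def \<sigma>_def)
  ultimately show ?thesis unfolding W_def[symmetric] \<sigma>_def[symmetric] by linarith
qed

lemma wasserstein_Inv_le:
  assumes n: "n \<ge> 2" and c: "c > 0" "c * real n ^ 3 \<le> proj_var n"
  shows "wasserstein (distr M borel (\<lambda>\<omega>. (Inv \<omega> - (1 - ln 2) / 2 * real n ^ 2) / sqrt (variance Inv))) std_normal_distribution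
    \<le> ereal ((2 * stein_const + 6) / sqrt c / sqrt (real n))"
  unfolding wasserstein_def
proof (rule SUP_least)
  fix h :: "real \<Rightarrow> real" assume "h \<in> {h. 1-lipschitz_on UNIV h}"
  then have h: "1-lipschitz_on UNIV h" by simp
  define s where "s = sqrt (variance Inv)"
  define \<sigma> where "\<sigma> = sqrt (proj_var n)"
  \<comment> \<open>\<open>\<epsilon>\<close> dominates n / \<open>\<sigma>\<close>, because
    \<open>\<sigma>\<close> is at least sqrt(c n^3), and then also n / s. The constant is 2 K from
    Stein's bound with K = \<open>stein_const\<close>, 4 from centring and remainder, and 2 from s -
    \<open>\<sigma>\<close> \<le> 2n.\<close>
  define \<epsilon> where "\<epsilon> = 1 / (sqrt c * sqrt (real n))"
  have \<sigma>: "\<sigma> > 0" using proj_var_pos[OF n] by (auto simp: \<sigma>_def)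
  have \<sigma>s: "\<sigma> \<le> s" unfolding s_def variance_Inv \<sigma>_def by simp
  have s: "s > 0" using \<sigma> \<sigma>s by linarith
  have "s \<le> \<sigma> + sqrt (expectation (\<lambda>\<omega>. (rem_part \<omega>)\<^sup>2))"
    unfolding s_def variance_Inv \<sigma>_def by (rule sqrt_add_le_add_sqrt) (auto simp: proj_var_nonneg)
  also have "sqrt (expectation (\<lambda>\<omega>. (rem_part \<omega>)\<^sup>2)) \<le> 2 * real n"
    using expectation_rem_part_square by (intro real_le_lsqrt) auto
  finally have s\<sigma>: "s \<le> \<sigma> + 2 * real n" by simp
  have "sqrt c * sqrt (real n) * real n = sqrt (c * real n ^ 3)"
    by (simp add: real_sqrt_mult power3_eq_cube)
  also have "\<dots> \<le> \<sigma>" unfolding \<sigma>_def using c(2) by simp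
  finally have n\<sigma>: "real n / \<sigma> \<le> \<epsilon>" using \<sigma> c n by (simp add: \<epsilon>_def field_simps)
  have ns: "real n / s \<le> \<epsilon>"
    using n\<sigma> \<sigma>s \<sigma> by (meson divide_left_mono mult_pos_pos of_nat_0_le_iff order_trans s)
  have "\<bar>\<sigma> / s - 1\<bar> = (s - \<sigma>) / s" using \<sigma>s s by (simp add: field_simps)
  also have "\<dots> \<le> 2 * real n / s" using s\<sigma> s by (intro divide_right_mono) auto
  also have "\<dots> \<le> 2 * \<epsilon>" using ns by simp
  finally have 1: "\<bar>\<sigma> / s - 1\<bar> \<le> 2 * \<epsilon>" .
  have K: "0 \<le> stein_const" by (simp add: stein_const_def)
  have [measurable]: "h \<in> borel_measurable borel" by (rule lipschitz_1_borel_measurable[OF h])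
  have "\<bar>expectation (\<lambda>\<omega>. h ((Inv \<omega> - (1 - ln 2) / 2 * real n ^ 2) / s)) - normal_mean h\<bar>
    \<le> 2 * stein_const * (real n / \<sigma>) + 4 * real n / s + \<bar>\<sigma> / s - 1\<bar>"
    unfolding \<sigma>_def by (rule Inv_normal_approx[OF n s h])
  also have "\<dots> \<le> 2 * stein_const * \<epsilon> + 4 * \<epsilon> + 2 * \<epsilon>"
    using n\<sigma> ns 1 K by (intro add_mono mult_left_mono) auto
  also have "\<dots> = (2 * stein_const + 6) / sqrt c / sqrt (real n)"
    by (simp add: \<epsilon>_def field_simps add_divide_distrib)
  finally show "ereal \<bar>(\<integral>x. h x \<partial>distr M borel (\<lambda>\<omega>. (Inv \<omega> - (1 - ln 2) / 2 * real n ^ 2) / sqrt (variance Inv))) - normal_mean h\<bar>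
    \<le> ereal ((2 * stein_const + 6) / sqrt c / sqrt (real n))"
    unfolding s_def[symmetric] by (subst integral_distr) auto
qed

end

text \<open>A continuous step descends from 1 to 0 with slope -1 / (b - a). Rescaled like this it is
  an admissible test function, so bounds for Lipschitz functions yield weak convergence.\<close>

lemma lipschitz_cts_step:
  assumes "a < b"
  shows "1-lipschitz_on UNIV (\<lambda>x. (b - a) * cts_step a b x)"
proof (rule lipschitz_onI)
  have "(b - a) * cts_step a b x = max 0 (min (b - a) (b - x))" for x
    using assms by (auto simp: cts_step_def)
  then show "dist ((b - a) * cts_step a b x) ((b - a) * cts_step a b y) \<le> 1 * dist x y" for x y
    by (auto simp: dist_real_def)
qed simp

lemma sqrt_proj_var_ratio_tendsto: "(\<lambda>n. sqrt (proj_var n) / (sqrt limit_var * real n powr (3/2))) \<longlonglongrightarrow> 1"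
proof (rule Lim_transform_eventually)
  have "(\<lambda>n. sqrt (proj_var n / real n ^ 3 / limit_var)) \<longlonglongrightarrow> sqrt (limit_var / limit_var)"
    using limit_var_pos by (intro tendsto_intros proj_var_tendsto) auto
  then show "(\<lambda>n. sqrt (proj_var n / real n ^ 3 / limit_var)) \<longlonglongrightarrow> 1" using limit_var_pos by simp
  have "sqrt (real n ^ 3) = real n powr (3/2)" if "n \<ge> 1" for n
    using that by (simp add: powr_half_sqrt[symmetric] powr_powr flip: powr_numeral)
  then show "\<forall>\<^sub>F n in sequentially. sqrt (proj_var n / real n ^ 3 / limit_var) = sqrt (proj_var n) / (sqrt limit_var * real n powr (3/2))"
    by (intro eventually_sequentiallyI[of 1]) (simp add: real_sqrt_divide real_sqrt_mult)
qed

lemma normal_approx_bound_tendsto: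
  "(\<lambda>n. 2 * stein_const * (real n / sqrt (proj_var n)) + 4 * real n / (sqrt limit_var * real n powr (3/2))
     + \<bar>sqrt (proj_var n) / (sqrt limit_var * real n powr (3/2)) - 1\<bar>) \<longlonglongrightarrow> 0"
proof -
  have 1: "(\<lambda>n. \<bar>sqrt (proj_var n) / (sqrt limit_var * real n powr (3/2)) - 1\<bar>) \<longlonglongrightarrow> 0"
    by (intro tendsto_rabs_zero LIM_zero sqrt_proj_var_ratio_tendsto)
  define v where "v = sqrt limit_var"
  have v: "v > 0" using limit_var_pos by (simp add: v_def)
  have 2: "(\<lambda>n. real n / (v * real n powr (3/2))) \<longlonglongrightarrow> 0" using v by real_asymp
  \<comment> \<open>The ratio of the two scales tends to 1, so n / sqrt(proj_var n) has the limit of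
    n / (v n^(3/2)).\<close>
  have "(\<lambda>n. (real n / (v * real n powr (3/2))) * inverse (sqrt (proj_var n) / (v * real n powr (3/2)))) \<longlonglongrightarrow> 0 * inverse 1"
    unfolding v_def by (intro tendsto_mult tendsto_inverse sqrt_proj_var_ratio_tendsto 2[unfolded v_def]) simp
  moreover have "\<forall>\<^sub>F n in sequentially. (real n / (v * real n powr (3/2))) * inverse (sqrt (proj_var n) / (v * real n powr (3/2)))
     = real n / sqrt (proj_var n)"
    using v by (intro eventually_sequentiallyI[of 1]) (simp add: field_simps)
  ultimately have 3: "(\<lambda>n. real n / sqrt (proj_var n)) \<longlonglongrightarrow> 0" by (auto intro: Lim_transform_eventually)
  have "(\<lambda>n. 2 * stein_const * (real n / sqrt (proj_var n)) + 4 * (real n / (v * real n powr (3/2)))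
     + \<bar>sqrt (proj_var n) / (v * real n powr (3/2)) - 1\<bar>) \<longlonglongrightarrow> 2 * stein_const * 0 + 4 * 0 + 0"
    by (intro tendsto_intros 2 3 1[folded v_def])
  then show ?thesis by (simp add: v_def)
qed

text \<open>The free scale is taken to be sqrt(limit_var) n^(3/2), and continuous steps are the test
  functions. The sequence is shifted by 2 because the bound needs n \<ge> 2 and \<open>M 0\<close>
  is arbitrary, possibly not a probability space; the shift leaves the limit unchanged.\<close>

lemma weak_conv_Inv:
  fixes M :: "nat \<Rightarrow> 'a measure"
  assumes A: "\<And>n. n \<ge> 1 \<Longrightarrow> unfair_array (M n) n (X n)"
  shows "weak_conv_m
        (\<lambda>n. distr (M n) borel
          (\<lambda>\<omega>. (real (inversions n (inverse_unfair n (X n) \<omega>)) - (1 - ln 2) / 2 * real n ^ 2) /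
            (sqrt limit_var * real n powr (3/2))))
        std_normal_distribution"
proof -
  define W where "W n \<omega> = (real (inversions n (inverse_unfair n (X n) \<omega>)) - (1 - ln 2) / 2 * real n ^ 2) /
            (sqrt limit_var * real n powr (3/2))" for n \<omega>
  have Wm: "W n \<in> borel_measurable (M n)" if "n \<ge> 1" for n
  proof -
    interpret unfair_array "M n" n "X n" by (rule A[OF that])
    show ?thesis unfolding W_def[abs_def] by measurable
  qed
  have "weak_conv_m (\<lambda>n. distr (M (n + 2)) borel (W (n + 2))) std_normal_distribution"
  proof (rule integral_cts_step_conv_imp_weak_conv)
    show "real_distribution (distr (M (n + 2)) borel (W (n + 2)))" for n
    proof -
      interpret unfair_array "M (n + 2)" "n + 2" "X (n + 2)" by (rule A) simp
      show ?thesis by (rule real_distribution_distr) (rule Wm, simp)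
    qed
    show "real_distribution std_normal_distribution" by (rule real_dist_normal_dist)
    fix x y :: real assume xy: "x < y"
    define h where "h = (\<lambda>z. (y - x) * cts_step x y z)"
    have h: "1-lipschitz_on UNIV h" unfolding h_def by (rule lipschitz_cts_step[OF xy])
    have ch: "cts_step x y = (\<lambda>z. h z / (y - x))" using xy by (auto simp: h_def)
    have hm: "h \<in> borel_measurable borel" by (rule lipschitz_1_borel_measurable[OF h])
    have "(\<lambda>n. integral\<^sup>L (distr (M (n + 2)) borel (W (n + 2))) h) \<longlonglongrightarrow> normal_mean h"
    proof (rule LIM_zero_cancel, rule Lim_null_comparison)
      show "\<forall>\<^sub>F n in sequentially. norm (integral\<^sup>L (distr (M (n + 2)) borel (W (n + 2))) h - normal_mean h)
        \<le> (\<lambda>n. 2 * stein_const * (real n / sqrt (proj_var n)) + 4 * real n / (sqrt limit_var * real n powr (3/2))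
     + \<bar>sqrt (proj_var n) / (sqrt limit_var * real n powr (3/2)) - 1\<bar>) (n + 2)"
      proof (rule always_eventually, rule allI)
        fix n
        interpret unfair_array "M (n + 2)" "n + 2" "X (n + 2)" by (rule A) simp
        have "integral\<^sup>L (distr (M (n + 2)) borel (W (n + 2))) h = expectation (\<lambda>\<omega>. h (W (n + 2) \<omega>))"
          by (rule integral_distr) (use Wm hm in auto)
        then show "norm (integral\<^sup>L (distr (M (n + 2)) borel (W (n + 2))) h - normal_mean h)
        \<le> (\<lambda>n. 2 * stein_const * (real n / sqrt (proj_var n)) + 4 * real n / (sqrt limit_var * real n powr (3/2))
     + \<bar>sqrt (proj_var n) / (sqrt limit_var * real n powr (3/2)) - 1\<bar>) (n + 2)"
          using Inv_normal_approx[of "sqrt limit_var * real (n + 2) powr (3/2)" h] limit_var_pos h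
          unfolding W_def by (simp only: real_norm_def) simp
      qed
      show "(\<lambda>n. (\<lambda>n. 2 * stein_const * (real n / sqrt (proj_var n)) + 4 * real n / (sqrt limit_var * real n powr (3/2))
     + \<bar>sqrt (proj_var n) / (sqrt limit_var * real n powr (3/2)) - 1\<bar>) (n + 2)) \<longlonglongrightarrow> 0"
        by (rule LIMSEQ_ignore_initial_segment[OF normal_approx_bound_tendsto])
    qed
    then show "(\<lambda>n. integral\<^sup>L (distr (M (n + 2)) borel (W (n + 2))) (cts_step x y)) \<longlonglongrightarrow> integral\<^sup>L std_normal_distribution (cts_step x y)"
      unfolding ch using xy by (simp add: tendsto_divide)
  qed
  then have "weak_conv_m (\<lambda>n. distr (M n) borel (W n)) std_normal_distribution"
    unfolding weak_conv_m_def weak_conv_def by (auto intro: LIMSEQ_offset[where k = 2])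
  then show ?thesis unfolding W_def .
qed

theorem theorem4p1:
  shows "(\<exists>C::real. \<forall>n\<ge>2. \<forall>(M :: 'a measure) X. unfair_array M n X \<longrightarrow>
      (let Inv = (\<lambda>\<omega>. real (inversions n (inverse_unfair n X \<omega>))) in
       wasserstein
         (distr M borel (\<lambda>\<omega>. (Inv \<omega> - (1 - ln 2) / 2 * real n ^ 2) / sqrt (prob_space.variance M Inv)))
         std_normal_distribution
       \<le> ereal (C / sqrt (real n)))) \<and>
    (\<forall>(M :: nat \<Rightarrow> 'a measure) X. (\<forall>n\<ge>1. unfair_array (M n) n (X n)) \<longrightarrow>
      weak_conv_m
        (\<lambda>n. distr (M n) borel
          (\<lambda>\<omega>. (real (inversions n (inverse_unfair n (X n) \<omega>)) - (1 - ln 2) / 2 * real n ^ 2) /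
            (sqrt (1/3 - pi^2/18 + 2 * ln 2 / 3 - ln 3 / 2 + 2 * (ln 2)^2 / 3) * real n powr (3/2))))
        std_normal_distribution)"
proof (rule conjI)
  \<comment> \<open>c is fixed before the space and the array, so the constant built from it depends
    on neither of them nor on n.\<close>
  obtain c where c: "c > 0" "\<And>n. n \<ge> 2 \<Longrightarrow> c * real n ^ 3 \<le> proj_var n"
    using proj_var_lower_bound by blast
  show "\<exists>C::real. \<forall>n\<ge>2. \<forall>(M :: 'a measure) X. unfair_array M n X \<longrightarrow>
      (let Inv = (\<lambda>\<omega>. real (inversions n (inverse_unfair n X \<omega>))) in
       wasserstein
         (distr M borel (\<lambda>\<omega>. (Inv \<omega> - (1 - ln 2) / 2 * real n ^ 2) / sqrt (prob_space.variance M Inv)))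
         std_normal_distribution
       \<le> ereal (C / sqrt (real n)))"
    unfolding Let_def
    by (intro exI[of _ "(2 * stein_const + 6) / sqrt c"] allI impI unfair_array.wasserstein_Inv_le c)
  show "\<forall>(M :: nat \<Rightarrow> 'a measure) X. (\<forall>n\<ge>1. unfair_array (M n) n (X n)) \<longrightarrow>
      weak_conv_m
        (\<lambda>n. distr (M n) borel
          (\<lambda>\<omega>. (real (inversions n (inverse_unfair n (X n) \<omega>)) - (1 - ln 2) / 2 * real n ^ 2) /
            (sqrt (1/3 - pi^2/18 + 2 * ln 2 / 3 - ln 3 / 2 + 2 * (ln 2)^2 / 3) * real n powr (3/2))))
        std_normal_distribution"
    unfolding limit_var_def[symmetric] by (intro allI impI weak_conv_Inv) blast
qed

end
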